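(* Let $F$ be a field of characteristic $\neq2$ which is not formally real and satisfies $|\dot F/\dot F^2|=2^n$. Let $\mathcal{R}\subset H^*(\mathcal{G}_F,\mathbb{F}_2)$ be the subring generated by $H^1(\mathcal{G}_F,\mathbb{F}_2)$ and let $c(F)$ be the largest degree in which $\mathcal{R}$ has a nonzero element. Then $c(F)\le n$.
   Context: $\dot F=F^\times$; $\mathcal{G}_F=G_F/G_F^4[G_F^2,G_F]$ is the W-group of $F$, $G_F$ being the Galois group of the quadratic closure of $F$. Formally real means $-1$ is not a sum of squares. *)

theory Defs
  imports Main "HOL-Algebra.Algebra" "HOL-Library.Z2"
begin

definition formally_real :: "'a::field itself \<Rightarrow> bool" where
  "formally_real _ \<longleftrightarrow> \<not> (\<exists>xs::'a list. - 1 = (\<Sum>x\<leftarrow>xs. x ^ 2))"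

definition square_classes :: "'a::field set set" where
  "square_classes = {x::'a. x \<noteq> 0} // {(x, y). x \<noteq> 0 \<and> y \<noteq> 0 \<and> (\<exists>z. z \<noteq> 0 \<and> x = y * z ^ 2)}"

definition field_emb :: "('a::field \<Rightarrow> 'b::field) \<Rightarrow> bool" where
  "field_emb i \<longleftrightarrow> i 1 = 1 \<and> (\<forall>x y. i (x + y) = i x + i y) \<and> (\<forall>x y. i (x * y) = i x * i y)"

inductive_set sqrt_tower :: "('a::field \<Rightarrow> 'b::field) \<Rightarrow> 'b set" for i where
  base: "i x \<in> sqrt_tower i"
| add: "x \<in> sqrt_tower i \<Longrightarrow> y \<in> sqrt_tower i \<Longrightarrow> x + y \<in> sqrt_tower i"
| neg: "x \<in> sqrt_tower i \<Longrightarrow> - x \<in> sqrt_tower i"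
| mult: "x \<in> sqrt_tower i \<Longrightarrow> y \<in> sqrt_tower i \<Longrightarrow> x * y \<in> sqrt_tower i"
| inv: "x \<in> sqrt_tower i \<Longrightarrow> inverse x \<in> sqrt_tower i"
| sqrt: "y \<in> sqrt_tower i \<Longrightarrow> x * x = y \<Longrightarrow> x \<in> sqrt_tower i"

definition is_quadratic_closure :: "('a::field \<Rightarrow> 'b::field) \<Rightarrow> bool" where
  "is_quadratic_closure i \<longleftrightarrow> field_emb i \<and> (\<forall>y::'b. \<exists>x. x * x = y) \<and> sqrt_tower i = UNIV"

definition galois_group :: "('a::field \<Rightarrow> 'b::field) \<Rightarrow> ('b \<Rightarrow> 'b) monoid" where
  "galois_group i = \<lparr>carrier = {\<sigma>. bij \<sigma> \<and> field_emb \<sigma> \<and> (\<forall>x. \<sigma> (i x) = i x)},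
                      monoid.mult = (\<circ>), one = id\<rparr>"

definition W_subgroup :: "('g, 'm) monoid_scheme \<Rightarrow> 'g set" where
  "W_subgroup G = generate G ({x [^]\<^bsub>G\<^esub> (4::nat) | x. x \<in> carrier G} \<union>
     {inv\<^bsub>G\<^esub> (x [^]\<^bsub>G\<^esub> (2::nat)) \<otimes>\<^bsub>G\<^esub> inv\<^bsub>G\<^esub> y \<otimes>\<^bsub>G\<^esub> (x [^]\<^bsub>G\<^esub> (2::nat)) \<otimes>\<^bsub>G\<^esub> y
        | x y. x \<in> carrier G \<and> y \<in> carrier G})"

definition W_group :: "('g, 'm) monoid_scheme \<Rightarrow> 'g set monoid" where
  "W_group G = G Mod W_subgroup G"

section \<open>Cohomology with F_2 = bit coefficients (trivial action), inhomogeneous cochains\<close>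

text \<open>A k-cochain is a function on lists of length k of group elements.\<close>
definition coboundary :: "('g, 'm) monoid_scheme \<Rightarrow> nat \<Rightarrow> ('g list \<Rightarrow> bit) \<Rightarrow> 'g list \<Rightarrow> bit" where
  "coboundary G k f gs = f (tl gs)
     + (\<Sum>j<k. f (take j gs @ [gs ! j \<otimes>\<^bsub>G\<^esub> gs ! Suc j] @ drop (Suc (Suc j)) gs))
     + f (take k gs)"

definition cocycle :: "('g, 'm) monoid_scheme \<Rightarrow> nat \<Rightarrow> ('g list \<Rightarrow> bit) \<Rightarrow> bool" where
  "cocycle G k f \<longleftrightarrow> (\<forall>gs. set gs \<subseteq> carrier G \<and> length gs = Suc k \<longrightarrow> coboundary G k f gs = 0)"

definition is_coboundary :: "('g, 'm) monoid_scheme \<Rightarrow> nat \<Rightarrow> ('g list \<Rightarrow> bit) \<Rightarrow> bool" where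
  "is_coboundary G k c \<longleftrightarrow>
     (if k = 0 then c [] = 0
      else \<exists>h. \<forall>gs. set gs \<subseteq> carrier G \<and> length gs = k \<longrightarrow> c gs = coboundary G (k - 1) h gs)"

definition cup :: "nat \<Rightarrow> ('g list \<Rightarrow> bit) \<Rightarrow> ('g list \<Rightarrow> bit) \<Rightarrow> 'g list \<Rightarrow> bit" where
  "cup p f g gs = f (take p gs) * g (drop p gs)"

fun cup_list :: "('g list \<Rightarrow> bit) list \<Rightarrow> 'g list \<Rightarrow> bit" where
  "cup_list [] = (\<lambda>_. 1)"
| "cup_list (a # as) = cup 1 a (cup_list as)"

text \<open>Degree-k part of the subring R of H^*(G,F_2) generated by H^1: cochains that are
  sums of cup products of k one-cocycles.\<close>
definition R_deg :: "('g, 'm) monoid_scheme \<Rightarrow> nat \<Rightarrow> ('g list \<Rightarrow> bit) set" where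
  "R_deg G k = {c. \<exists>(m::nat) A. (\<forall>j<m. length (A j) = k \<and> (\<forall>a\<in>set (A j). cocycle G 1 a))
                     \<and> c = (\<lambda>gs. \<Sum>j<m. cup_list (A j) gs)}"

end

theory Submission
  imports Defs "HOL-Analysis.Function_Topology"
begin

text \<open>The cohomology ring generated by degree one is treated as a symbol algebra: by Kummer theory a
  class in \<open>H\<^sup>1\<close> is the character \<open>(a)\<close> of a square class, products are bilinear and commutative,
  and \<open>(a)(1 - a) = 0\<close> because the obstruction is split by a dihedral extension, which lives on the
  W-group. For a symbol \<open>\<alpha>\<close> let \<open>U(\<alpha>)\<close> be the group of square classes of all \<open>b\<close> with
  \<open>(b) \<alpha> = 0\<close>. If \<open>(a) \<alpha> \<noteq> 0\<close>, then \<open>U(\<alpha>)\<close> is properly contained in \<open>U((a) \<alpha>)\<close>: otherwise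
  \<open>(- a) \<alpha> = 0\<close>, the set \<open>U(\<alpha>)\<close> is closed under adding squares, hence contains \<open>- 1\<close>, which is a sum
  of squares, and \<open>(a) \<alpha> = 0\<close> follows. So the order of \<open>U\<close> at least doubles with every factor, and a
  nonzero symbol has at most \<open>n\<close> factors.

  The Galois group carries no topology here, so one has to know that abstract homomorphisms to
  \<open>\<int>/2\<close> are continuous. This is Serre's theorem for finitely generated pro-2 groups: the elements
  that fix all square roots of the base field are products of a bounded number of squares in every
  finite quotient, hence by compactness in the group itself.\<close>

section \<open>Lower two-central series and products of squares\<close>

text \<open>Cochains in \<open>R_deg\<close> are arbitrary functions on the abstract W-group, so a
  degree-one class is an abstract homomorphism to F_2. Continuity serves only to identify it with a
  square class; the relations between symbols are witnessed by explicit cochains that descend to the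
  abstract W-group, hence hold in abstract cohomology directly. The obstacle is that the closed
  subgroup generated by the squares could be larger than the abstract one. A bound on the number of
  squares that is uniform over the finite quotients removes it: tuples of a fixed length have
  limits, words of growing length need not. The bound comes from adjusting a word without
  lengthening it: replacing a factor y by y u, with u deep in the series, multiplies its square by
  u^2 [u, y], which is central modulo the term after next. One layer of the series is corrected at a
  time.\<close>

definition commutator :: "('g, 'm) monoid_scheme \<Rightarrow> 'g \<Rightarrow> 'g \<Rightarrow> 'g" where
  "commutator G u q = inv\<^bsub>G\<^esub> u \<otimes>\<^bsub>G\<^esub> inv\<^bsub>G\<^esub> q \<otimes>\<^bsub>G\<^esub> u \<otimes>\<^bsub>G\<^esub> q"

definition central :: "('g, 'm) monoid_scheme \<Rightarrow> 'g \<Rightarrow> bool" where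
  "central G c \<longleftrightarrow> c \<in> carrier G \<and> (\<forall>x\<in>carrier G. c \<otimes>\<^bsub>G\<^esub> x = x \<otimes>\<^bsub>G\<^esub> c)"

definition square_gens :: "('g, 'm) monoid_scheme \<Rightarrow> 'g set \<Rightarrow> 'g set" where
  "square_gens G A = {u \<otimes>\<^bsub>G\<^esub> u | u. u \<in> A}"

definition commutator_gens :: "('g, 'm) monoid_scheme \<Rightarrow> 'g set \<Rightarrow> 'g set" where
  "commutator_gens G A = {commutator G u q | u q. u \<in> A \<and> q \<in> carrier G}"

text \<open>The lower exponent-2 central series, starting at \<open>0\<close>. Squares make each
  layer elementary abelian, commutators with the whole group make it central; both are used when a
  layer is corrected.\<close>

primrec lower_series :: "('g, 'm) monoid_scheme \<Rightarrow> nat \<Rightarrow> 'g set" where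
  "lower_series G 0 = carrier G"
| "lower_series G (Suc i) =
     generate G (square_gens G (lower_series G i) \<union> commutator_gens G (lower_series G i))"

definition square_word :: "('g, 'm) monoid_scheme \<Rightarrow> 'g list \<Rightarrow> 'g" where
  "square_word G ys = foldr (\<lambda>y z. y \<otimes>\<^bsub>G\<^esub> y \<otimes>\<^bsub>G\<^esub> z) ys \<one>\<^bsub>G\<^esub>"

lemma square_gens_mono: "A \<subseteq> B \<Longrightarrow> square_gens G A \<subseteq> square_gens G B"
  unfolding square_gens_def by blast

lemma commutator_gens_mono: "A \<subseteq> B \<Longrightarrow> commutator_gens G A \<subseteq> commutator_gens G B"
  unfolding commutator_gens_def by blast

context group
begin

lemma cancel_left_inv: "x \<in> carrier G \<Longrightarrow> y \<in> carrier G \<Longrightarrow> x \<otimes> (inv x \<otimes> y) = y"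
  "x \<in> carrier G \<Longrightarrow> y \<in> carrier G \<Longrightarrow> inv x \<otimes> (x \<otimes> y) = y"
  by (simp_all add: m_assoc[symmetric])

text \<open>Brings group words into right-nested form with adjacent inverses cancelled, so that
  identities of the free group follow by simplification.\<close>

lemmas group_word_simps = commutator_def m_assoc inv_mult_group cancel_left_inv

lemma commutator_closed [simp, intro]:
  "u \<in> carrier G \<Longrightarrow> q \<in> carrier G \<Longrightarrow> commutator G u q \<in> carrier G"
  by (simp add: commutator_def)

lemma mult_commutator:
  "u \<in> carrier G \<Longrightarrow> q \<in> carrier G \<Longrightarrow> q \<otimes> u \<otimes> commutator G u q = u \<otimes> q"
  by (simp add: group_word_simps)

lemma commutator_eq_one_iff:
  "u \<in> carrier G \<Longrightarrow> q \<in> carrier G \<Longrightarrow> commutator G u q = \<one> \<longleftrightarrow> u \<otimes> q = q \<otimes> u"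
  using mult_commutator[of u q] r_cancel_one'[of "commutator G u q" "q \<otimes> u"]
    r_cancel_one[of "q \<otimes> u" "commutator G u q"] l_cancel_one[of "q \<otimes> u" "commutator G u q"] by auto

lemma central_closed: "central G c \<Longrightarrow> c \<in> carrier G"
  by (simp add: central_def)

text \<open>The correction mechanism. Moving the inner \<open>u\<close> to the left past
  \<open>y\<close> costs exactly one commutator, which centrality lets drift to the end.\<close>

lemma square_perturb:
  assumes "y \<in> carrier G" "u \<in> carrier G" "central G (commutator G u y)"
  shows "(y \<otimes> u) \<otimes> (y \<otimes> u) = y \<otimes> y \<otimes> (u \<otimes> u \<otimes> commutator G u y)"
proof -
  have "(y \<otimes> u) \<otimes> (y \<otimes> u) = y \<otimes> (u \<otimes> y) \<otimes> u"
    using assms by (simp add: m_assoc)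
  also have "\<dots> = y \<otimes> (y \<otimes> u \<otimes> commutator G u y) \<otimes> u"
    using assms by (simp add: mult_commutator)
  also have "\<dots> = y \<otimes> y \<otimes> (u \<otimes> (commutator G u y \<otimes> u))"
    using assms by (simp add: m_assoc)
  also have "\<dots> = y \<otimes> y \<otimes> (u \<otimes> (u \<otimes> commutator G u y))"
    using assms by (simp add: central_def)
  finally show ?thesis using assms by (simp add: m_assoc)
qed

text \<open>In general the second factor would appear conjugated by \<open>p\<close>; centrality
  removes the conjugation.\<close>

lemma commutator_mult_right:
  assumes "u \<in> carrier G" "p \<in> carrier G" "q \<in> carrier G" "central G (commutator G u q)"
  shows "commutator G u (q \<otimes> p) = commutator G u p \<otimes> commutator G u q"
proof -
  have "commutator G u (q \<otimes> p) = inv u \<otimes> inv p \<otimes> u \<otimes> (commutator G u q \<otimes> p)"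
    using assms(1-3) by (simp add: group_word_simps)
  also have "\<dots> = inv u \<otimes> inv p \<otimes> u \<otimes> (p \<otimes> commutator G u q)"
    using assms by (simp add: central_def)
  also have "\<dots> = commutator G u p \<otimes> commutator G u q"
    using assms(1-3) by (simp add: commutator_def m_assoc)
  finally show ?thesis .
qed

lemma commutator_eq_squares:
  assumes "u \<in> carrier G" "q \<in> carrier G"
  shows "commutator G u q = (inv u \<otimes> inv u) \<otimes> ((u \<otimes> inv q) \<otimes> (u \<otimes> inv q)) \<otimes> (q \<otimes> q)"
  using assms by (simp add: group_word_simps)

lemma central_mult:
  assumes "central G c" "central G d"
  shows "central G (c \<otimes> d)"
proof -
  have "c \<otimes> d \<otimes> x = x \<otimes> (c \<otimes> d)" if x: "x \<in> carrier G" for x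
  proof -
    have cd: "c \<in> carrier G" "d \<in> carrier G" "c \<otimes> x = x \<otimes> c" "d \<otimes> x = x \<otimes> d"
      using assms x by (auto simp only: central_def)
    have "c \<otimes> d \<otimes> x = c \<otimes> (x \<otimes> d)" using cd x by (simp only: m_assoc cd(4))
    also have "\<dots> = x \<otimes> c \<otimes> d" using cd x by (simp only: m_assoc[symmetric] cd(3))
    finally show ?thesis using cd x by (simp only: m_assoc)
  qed
  then show ?thesis using assms by (simp add: central_closed central_def[of _ "c \<otimes> d"])
qed

text \<open>Serves to cancel an unwanted square that has been inserted on both sides of a central
  element.\<close>

lemma central_conj_involution:
  assumes "central G c" "a \<in> carrier G" "a \<otimes> a = \<one>"
  shows "a \<otimes> c \<otimes> a = c"
proof -
  have "c \<otimes> a = a \<otimes> c" "c \<in> carrier G" using assms by (auto simp: central_def)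
  then have "a \<otimes> c \<otimes> a = (a \<otimes> a) \<otimes> c" using assms(2) by (simp add: m_assoc)
  then show ?thesis using assms(3) \<open>c \<in> carrier G\<close> by simp
qed

lemma square_word_Nil [simp]: "square_word G [] = \<one>"
  by (simp add: square_word_def)

lemma square_word_Cons [simp]: "square_word G (y # ys) = y \<otimes> y \<otimes> square_word G ys"
  by (simp add: square_word_def)

lemma square_word_closed [simp, intro]: "set ys \<subseteq> carrier G \<Longrightarrow> square_word G ys \<in> carrier G"
  by (induction ys) auto

text \<open>The central factor \<open>c\<close> travels past the rest of the word, so a change at
  any position acts on the whole product by right multiplication.\<close>

lemma square_word_update:
  assumes "set ys \<subseteq> carrier G" "y \<in> carrier G" "central G c" "k < length ys"
    and "y \<otimes> y = ys ! k \<otimes> ys ! k \<otimes> c"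
  shows "square_word G (ys[k := y]) = square_word G ys \<otimes> c"
  using assms
proof (induction ys arbitrary: k)
  case (Cons z zs)
  show ?case
  proof (cases k)
    case 0
    have "square_word G zs \<in> carrier G" using Cons by auto
    with Cons 0 show ?thesis by (auto simp: central_def m_assoc)
  next
    case (Suc l)
    have "square_word G zs \<in> carrier G" using Cons by auto
    with Cons Suc show ?thesis by (auto simp: central_def m_assoc)
  qed
qed simp

lemma square_gens_closed: "A \<subseteq> carrier G \<Longrightarrow> square_gens G A \<subseteq> carrier G"
  by (auto simp: square_gens_def)

lemma commutator_gens_closed: "A \<subseteq> carrier G \<Longrightarrow> commutator_gens G A \<subseteq> carrier G"
  by (auto simp: commutator_gens_def)

lemma lower_series_closed: "lower_series G i \<subseteq> carrier G"
proof (induction i)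
  case (Suc i)
  then show ?case
    using square_gens_closed commutator_gens_closed unfolding lower_series.simps by (intro generate_incl Un_least)
qed simp

lemma conj_square:
  "\<lbrakk>u \<in> carrier G; g \<in> carrier G\<rbrakk> \<Longrightarrow>
   g \<otimes> (u \<otimes> u) \<otimes> inv g = (g \<otimes> u \<otimes> inv g) \<otimes> (g \<otimes> u \<otimes> inv g)"
  by (simp add: group_word_simps)

lemma conj_commutator:
  "\<lbrakk>u \<in> carrier G; g \<in> carrier G; q \<in> carrier G\<rbrakk> \<Longrightarrow>
   g \<otimes> commutator G u q \<otimes> inv g = commutator G (g \<otimes> u \<otimes> inv g) (g \<otimes> q \<otimes> inv g)"
  by (simp add: group_word_simps)

lemma lower_series_normal: "lower_series G i \<lhd> G"
proof (induction i)
  case 0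
  show ?case
    by (auto simp: normal_inv_iff subgroup_self)
next
  case (Suc i)
  let ?A = "lower_series G i"
  have cl: "square_gens G ?A \<union> commutator_gens G ?A \<subseteq> carrier G"
    using square_gens_closed commutator_gens_closed lower_series_closed by blast
  have conj: "g \<otimes> u \<otimes> inv g \<in> ?A" if "u \<in> ?A" "g \<in> carrier G" for u g
    using normal_invE(2)[OF Suc] that by blast
  have "g \<otimes> h \<otimes> inv g \<in> square_gens G ?A \<union> commutator_gens G ?A"
    if h: "h \<in> square_gens G ?A \<union> commutator_gens G ?A" and g: "g \<in> carrier G" for h g
    using h
  proof
    assume "h \<in> square_gens G ?A"
    then obtain u where u: "u \<in> ?A" "h = u \<otimes> u" by (auto simp: square_gens_def)
    then have "u \<in> carrier G" using lower_series_closed by blast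
    with u g conj show ?thesis by (auto simp: square_gens_def conj_square)
  next
    assume "h \<in> commutator_gens G ?A"
    then obtain u q where u: "u \<in> ?A" "q \<in> carrier G" "h = commutator G u q"
      by (auto simp: commutator_gens_def)
    then have "u \<in> carrier G" using lower_series_closed by blast
    moreover have "g \<otimes> q \<otimes> inv g \<in> carrier G" using u g by simp
    ultimately show ?thesis using u g conj[of u g] unfolding commutator_gens_def conj_commutator[OF _ g u(2), of u]
      by (auto simp: conj_commutator)
  qed
  then show ?case unfolding lower_series.simps by (intro normal_generateI cl)
qed

lemma lower_series_subgroup: "subgroup (lower_series G i) G"
  using lower_series_normal normal_imp_subgroup by blast

lemma lower_series_square: "u \<in> lower_series G i \<Longrightarrow> u \<otimes> u \<in> lower_series G (Suc i)"
  by (auto intro!: generate.incl simp: square_gens_def)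

lemma lower_series_commutator:
  "u \<in> lower_series G i \<Longrightarrow> q \<in> carrier G \<Longrightarrow> commutator G u q \<in> lower_series G (Suc i)"
  by (auto intro!: generate.incl simp: commutator_gens_def)

text \<open>A commutator is a product of three squares by \<open>commutator_eq_squares\<close>, so
  the commutator generators add nothing at this first stage.\<close>

lemma lower_series_one: "lower_series G (Suc 0) = generate G (square_gens G (carrier G))"
proof
  have cl: "square_gens G (carrier G) \<subseteq> carrier G" by (simp add: square_gens_closed)
  have sq: "v \<otimes> v \<in> generate G (square_gens G (carrier G))" if "v \<in> carrier G" for v
    using that by (auto intro!: generate.incl simp: square_gens_def)
  have "commutator_gens G (carrier G) \<subseteq> generate G (square_gens G (carrier G))"
  proof
    fix x assume "x \<in> commutator_gens G (carrier G)"
    then obtain u q where "u \<in> carrier G" "q \<in> carrier G" "x = commutator G u q"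
      by (auto simp: commutator_gens_def)
    then show "x \<in> generate G (square_gens G (carrier G))"
      by (auto simp: commutator_eq_squares intro!: generate.eng sq)
  qed
  then show "lower_series G (Suc 0) \<subseteq> generate G (square_gens G (carrier G))"
    unfolding lower_series.simps
    by (intro generate_subgroup_incl[OF _ generate_is_subgroup[OF cl]] Un_least)
      (auto intro: generate.incl)
  show "generate G (square_gens G (carrier G)) \<subseteq> lower_series G (Suc 0)"
    by (auto intro!: mono_generate)
qed

lemma lower_series_Suc_subset: "lower_series G (Suc i) \<subseteq> lower_series G i"
proof -
  interpret N: normal "lower_series G i" G by (rule lower_series_normal)
  have "commutator G u q \<in> lower_series G i" if "u \<in> lower_series G i" "q \<in> carrier G" for u q
  proof -
    have "inv u \<otimes> (inv q \<otimes> u \<otimes> q) \<in> lower_series G i"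
      using that N.inv_op_closed1 by blast
    moreover have "u \<in> carrier G" using that lower_series_closed by blast
    ultimately show ?thesis using that by (simp add: commutator_def m_assoc)
  qed
  then have "square_gens G (lower_series G i) \<union> commutator_gens G (lower_series G i) \<subseteq> lower_series G i"
    by (auto simp: square_gens_def commutator_gens_def)
  then show ?thesis
    by (simp add: generate_subgroup_incl lower_series_subgroup)
qed

lemma lower_series_antimono: "i \<le> j \<Longrightarrow> lower_series G j \<subseteq> lower_series G i"
  using lift_Suc_antimono_le[of "lower_series G"] lower_series_Suc_subset by blast

end

context group_hom
begin

lemma hom_commutator:
  "u \<in> carrier G \<Longrightarrow> q \<in> carrier G \<Longrightarrow> h (commutator G u q) = commutator H (h u) (h q)"
  by (simp add: commutator_def)

lemma hom_square_word:
  "set ys \<subseteq> carrier G \<Longrightarrow> h (square_word G ys) = square_word H (map h ys)"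
  by (induction ys) auto

end

text \<open>Replaces the coset model by a surjective homomorphism with known kernel, so that later
  arguments compute with images of elements.\<close>

lemma (in normal) exists_quotient_hom:
  obtains Q :: "'a set monoid" and \<phi> where
    "group_hom G Q \<phi>" "carrier Q = \<phi> ` carrier G"
    "\<And>x. x \<in> carrier G \<Longrightarrow> \<phi> x = \<one>\<^bsub>Q\<^esub> \<longleftrightarrow> x \<in> H"
    "order Q * card H = order G"
proof
  show "group_hom G (G Mod H) (\<lambda>x. H #> x)"
    by (simp add: group_hom_def group_hom_axioms_def factorgroup_is_group r_coset_hom_Mod is_group)
  show "carrier (G Mod H) = (\<lambda>x. H #> x) ` carrier G"
    by (rule carrier_FactGroup)
  show "H #> x = \<one>\<^bsub>G Mod H\<^esub> \<longleftrightarrow> x \<in> H" if "x \<in> carrier G" for x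
    using coset_join1[of H x] coset_join2[of x H] is_subgroup that by auto
  show "order (G Mod H) * card H = order G"
    using lagrange[OF is_subgroup] by (simp add: order_def FactGroup_def)
qed

context group
begin

section \<open>Correcting words of squares layer by layer\<close>

lemma lower_series_central_mod:
  assumes \<phi>: "group_hom G Q \<phi>" "carrier Q = \<phi> ` carrier G"
    "\<And>x. x \<in> carrier G \<Longrightarrow> \<phi> x = \<one>\<^bsub>Q\<^esub> \<longleftrightarrow> x \<in> lower_series G (Suc i)"
    and w: "w \<in> lower_series G i"
  shows "central Q (\<phi> w)"
proof -
  interpret h: group_hom G Q \<phi> by fact
  have wc: "w \<in> carrier G" using w lower_series_closed by blast
  have "\<phi> w \<otimes>\<^bsub>Q\<^esub> \<phi> g = \<phi> g \<otimes>\<^bsub>Q\<^esub> \<phi> w" if "g \<in> carrier G" for g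
  proof -
    have "\<phi> (commutator G w g) = \<one>\<^bsub>Q\<^esub>"
      using lower_series_commutator[OF w that] \<phi>(3) that wc by blast
    then show ?thesis
      using that wc by (simp add: h.hom_commutator h.H.commutator_eq_one_iff)
  qed
  then show ?thesis using wc \<phi>(2) by (auto simp: central_def)
qed

text \<open>Modulo the target term, \<open>q \<mapsto> commutator G u q\<close> is a homomorphism
  into central elements of order at most two. It therefore kills squares, and these generate the
  first term.\<close>

lemma commutator_lower_series_one:
  assumes u: "u \<in> lower_series G i" and p: "p \<in> lower_series G (Suc 0)"
  shows "commutator G u p \<in> lower_series G (Suc (Suc i))"
proof -
  interpret N: normal "lower_series G (Suc (Suc i))" G by (rule lower_series_normal)
  obtain Q :: "'a set monoid" and \<phi> where \<phi>: "group_hom G Q \<phi>" "carrier Q = \<phi> ` carrier G"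
    "\<And>x. x \<in> carrier G \<Longrightarrow> \<phi> x = \<one>\<^bsub>Q\<^esub> \<longleftrightarrow> x \<in> lower_series G (Suc (Suc i))"
    by (rule N.exists_quotient_hom) blast
  interpret h: group_hom G Q \<phi> by fact
  have uc: "u \<in> carrier G" using u lower_series_closed by blast
  have cent: "central Q (commutator Q (\<phi> u) (\<phi> q))" if "q \<in> carrier G" for q
    using lower_series_central_mod[OF \<phi> lower_series_commutator[OF u that]] uc that
    by (simp add: h.hom_commutator)
  have sq: "commutator Q (\<phi> u) (\<phi> q) \<otimes>\<^bsub>Q\<^esub> commutator Q (\<phi> u) (\<phi> q) = \<one>\<^bsub>Q\<^esub>"
    if "q \<in> carrier G" for q
  proof -
    let ?c = "commutator G u q"
    have c: "?c \<in> carrier G" using uc that by simp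
    have "?c \<otimes> ?c \<in> lower_series G (Suc (Suc i))"
      using lower_series_square[OF lower_series_commutator[OF u that]] .
    then have "\<phi> (?c \<otimes> ?c) = \<one>\<^bsub>Q\<^esub>" using \<phi>(3) c by blast
    then show ?thesis using uc that by (simp add: h.hom_commutator)
  qed
  have pc: "p \<in> generate G (square_gens G (carrier G))" using p lower_series_one by simp
  have cl: "square_gens G (carrier G) \<subseteq> carrier G" by (simp add: square_gens_closed)
  have comm: "\<phi> u \<otimes>\<^bsub>Q\<^esub> \<phi> x = \<phi> x \<otimes>\<^bsub>Q\<^esub> \<phi> u" if "x \<in> square_gens G (carrier G)" for x
  proof -
    from that obtain q where q: "q \<in> carrier G" "x = q \<otimes> q" by (auto simp: square_gens_def)
    have "commutator Q (\<phi> u) (\<phi> q \<otimes>\<^bsub>Q\<^esub> \<phi> q) = \<one>\<^bsub>Q\<^esub>"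
      using q uc cent sq by (simp add: h.H.commutator_mult_right)
    then show ?thesis using q uc h.H.commutator_eq_one_iff by simp
  qed
  from pc have "\<phi> u \<otimes>\<^bsub>Q\<^esub> \<phi> p = \<phi> p \<otimes>\<^bsub>Q\<^esub> \<phi> u"
  proof (induction p rule: generate.induct)
    case one
    then show ?case using uc by simp
  next
    case (incl x)
    then show ?case by (rule comm)
  next
    case (inv x)
    then have x: "x \<in> carrier G" using cl by blast
    have "inv\<^bsub>Q\<^esub> \<phi> x \<otimes>\<^bsub>Q\<^esub> (\<phi> u \<otimes>\<^bsub>Q\<^esub> \<phi> x) \<otimes>\<^bsub>Q\<^esub> inv\<^bsub>Q\<^esub> \<phi> x
        = inv\<^bsub>Q\<^esub> \<phi> x \<otimes>\<^bsub>Q\<^esub> (\<phi> x \<otimes>\<^bsub>Q\<^esub> \<phi> u) \<otimes>\<^bsub>Q\<^esub> inv\<^bsub>Q\<^esub> \<phi> x"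
      using comm[OF inv] by simp
    then show ?case using uc x by (simp add: h.H.m_assoc h.H.cancel_left_inv)
  next
    case (eng x y)
    then have x: "x \<in> carrier G" "y \<in> carrier G" using generate_in_carrier[OF cl] by blast+
    have "\<phi> u \<otimes>\<^bsub>Q\<^esub> (\<phi> x \<otimes>\<^bsub>Q\<^esub> \<phi> y) = \<phi> x \<otimes>\<^bsub>Q\<^esub> (\<phi> u \<otimes>\<^bsub>Q\<^esub> \<phi> y)"
      using eng(3) uc x by (simp add: h.H.m_assoc[symmetric])
    with eng(4) uc x show ?case by (simp add: h.H.m_assoc)
  qed
  moreover have "p \<in> carrier G" using p lower_series_closed by blast
  ultimately have "\<phi> (commutator G u p) = \<one>\<^bsub>Q\<^esub>"
    using uc by (simp add: h.hom_commutator h.H.commutator_eq_one_iff)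
  then show ?thesis using \<phi>(3) uc \<open>p \<in> carrier G\<close> by blast
qed

text \<open>The first half of the word consists of perturbed representatives modulo squares and reaches
  the deeper terms of the series; the second half switches the squares of the representatives on and
  off, which covers the first term modulo the second.\<close>

definition admissible :: "'a list \<Rightarrow> 'a list \<Rightarrow> bool" where
  "admissible rs ys \<longleftrightarrow> length ys = 2 * length rs \<and> set ys \<subseteq> carrier G
     \<and> (\<forall>k<length rs. inv (rs ! k) \<otimes> ys ! k \<in> lower_series G (Suc 0))
     \<and> (\<forall>k<length rs. ys ! (length rs + k) \<in> {\<one>, rs ! k})"

text \<open>The \<open>k\<close>-th factor \<open>y\<close> is replaced by
  \<open>y \<otimes> u\<close>. Because \<open>i > 0\<close>, \<open>u\<close> lies in the first
  term and \<open>y\<close> stays in the coset of its representative. The gain is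
  \<open>u \<otimes> u\<close> times the commutator of \<open>u\<close> with \<open>y\<close>; since
  \<open>y\<close> and \<open>q\<close> differ by an element of the first term, that commutator may
  be taken with the prescribed \<open>q\<close> instead.\<close>

lemma admissible_perturb:
  assumes \<phi>: "group_hom G Q \<phi>" "carrier Q = \<phi> ` carrier G"
    "\<And>x. x \<in> carrier G \<Longrightarrow> \<phi> x = \<one>\<^bsub>Q\<^esub> \<longleftrightarrow> x \<in> lower_series G (Suc (Suc i))"
    and i: "i > 0" and rs: "set rs \<subseteq> carrier G" and u: "u \<in> lower_series G i"
    and k: "k < length rs" and q: "q \<in> carrier G" "inv (rs ! k) \<otimes> q \<in> lower_series G (Suc 0)"
    and ys: "admissible rs ys"
  shows "\<exists>ys'. admissible rs ys' \<and> \<phi> (square_word G ys') =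
    \<phi> (square_word G ys) \<otimes>\<^bsub>Q\<^esub> (\<phi> u \<otimes>\<^bsub>Q\<^esub> \<phi> u \<otimes>\<^bsub>Q\<^esub> commutator Q (\<phi> u) (\<phi> q))"
proof -
  interpret h: group_hom G Q \<phi> by fact
  interpret P1: subgroup "lower_series G (Suc 0)" G by (rule lower_series_subgroup)
  have uc: "u \<in> carrier G" using u lower_series_closed by blast
  have rk: "rs ! k \<in> carrier G" using rs k by auto
  let ?y = "ys ! k"
  have k2: "k < length ys" and ysc: "set ys \<subseteq> carrier G" using ys k by (auto simp: admissible_def)
  then have yc: "?y \<in> carrier G" by auto
  have u1: "u \<in> lower_series G (Suc 0)"
    using lower_series_antimono[of "Suc 0" i] i u by auto
  have ry: "inv (rs ! k) \<otimes> ?y \<in> lower_series G (Suc 0)" using ys k by (simp add: admissible_def)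
  have adm: "admissible rs (ys[k := ?y \<otimes> u])"
    unfolding admissible_def
  proof (intro conjI allI impI)
    show "length (ys[k := ?y \<otimes> u]) = 2 * length rs" using ys by (simp add: admissible_def)
    show "set (ys[k := ?y \<otimes> u]) \<subseteq> carrier G"
      using set_update_subset_insert[of ys k "?y \<otimes> u"] ysc yc uc by auto
    fix l assume l: "l < length rs"
    show "ys[k := ?y \<otimes> u] ! (length rs + l) \<in> {\<one>, rs ! l}"
      using ys k l by (simp add: admissible_def)
    show "inv (rs ! l) \<otimes> ys[k := ?y \<otimes> u] ! l \<in> lower_series G (Suc 0)"
    proof (cases "l = k")
      case True
      have "(inv (rs ! k) \<otimes> ?y) \<otimes> u \<in> lower_series G (Suc 0)" using ry u1 by (rule P1.m_closed)
      with True k2 rk yc uc show ?thesis by (simp add: m_assoc)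
    next
      case False
      with ys l show ?thesis by (simp add: admissible_def)
    qed
  qed
  define p where "p = inv q \<otimes> ?y"
  have pc: "p \<in> carrier G" using q yc by (simp add: p_def)
  have "inv (inv (rs ! k) \<otimes> q) \<otimes> (inv (rs ! k) \<otimes> ?y) \<in> lower_series G (Suc 0)"
    by (rule P1.m_closed[OF P1.m_inv_closed[OF q(2)] ry])
  then have p1: "p \<in> lower_series G (Suc 0)"
    using q rk yc by (simp add: p_def group_word_simps)
  have yqp: "?y = q \<otimes> p" using q yc by (simp add: p_def group_word_simps)
  have cent: "central Q (\<phi> w)" if "w \<in> lower_series G (Suc i)" for w
    using lower_series_central_mod[OF \<phi> that] .
  have "\<phi> (commutator G u p) = \<one>\<^bsub>Q\<^esub>"
    using commutator_lower_series_one[OF u p1] \<phi>(3) uc pc by blast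
  moreover have "central Q (commutator Q (\<phi> u) (\<phi> q))"
    using cent[OF lower_series_commutator[OF u q(1)]] uc q by (simp add: h.hom_commutator)
  ultimately have cy: "commutator Q (\<phi> u) (\<phi> ?y) = commutator Q (\<phi> u) (\<phi> q)"
    using uc q pc by (simp add: yqp h.hom_commutator h.H.commutator_mult_right)
  let ?c = "u \<otimes> u \<otimes> commutator G u ?y"
  interpret P: subgroup "lower_series G (Suc i)" G by (rule lower_series_subgroup)
  have cc: "central Q (\<phi> ?c)"
    by (rule cent) (intro P.m_closed lower_series_square lower_series_commutator u yc)
  have "square_word Q ((map \<phi> ys)[k := \<phi> (?y \<otimes> u)]) = square_word Q (map \<phi> ys) \<otimes>\<^bsub>Q\<^esub> \<phi> ?c"
  proof (rule h.H.square_word_update)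
    show "set (map \<phi> ys) \<subseteq> carrier Q" using ysc by auto
    show "\<phi> (?y \<otimes> u) \<in> carrier Q" using yc uc by simp
    show "central Q (\<phi> ?c)" by fact
    show "k < length (map \<phi> ys)" using k2 by simp
    have "central Q (commutator Q (\<phi> u) (\<phi> ?y))"
      using cent[OF lower_series_commutator[OF u yc]] uc yc by (simp add: h.hom_commutator)
    then show "\<phi> (?y \<otimes> u) \<otimes>\<^bsub>Q\<^esub> \<phi> (?y \<otimes> u) = map \<phi> ys ! k \<otimes>\<^bsub>Q\<^esub> map \<phi> ys ! k \<otimes>\<^bsub>Q\<^esub> \<phi> ?c"
      using yc uc k2 by (simp add: h.H.square_perturb h.hom_commutator)
  qed
  moreover have "set (ys[k := ?y \<otimes> u]) \<subseteq> carrier G" using adm by (simp add: admissible_def)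
  ultimately have "\<phi> (square_word G (ys[k := ?y \<otimes> u])) =
      \<phi> (square_word G ys) \<otimes>\<^bsub>Q\<^esub> \<phi> ?c"
    using ysc by (simp add: h.hom_square_word map_update)
  also have "\<phi> ?c = \<phi> u \<otimes>\<^bsub>Q\<^esub> \<phi> u \<otimes>\<^bsub>Q\<^esub> commutator Q (\<phi> u) (\<phi> q)"
    using uc yc cy by (simp add: h.hom_commutator)
  finally show ?thesis using adm by blast
qed

text \<open>Perturbation by an arbitrary group element would leave the prescribed coset, so the
  first layer is handled by the second half of the word. Modulo the second term,
  \<open>v \<otimes> v\<close> equals the square of the representative, is central and squares to
  one; hence switching an entry on and switching it off both multiply by it.\<close>

lemma admissible_toggle:
  assumes \<phi>: "group_hom G Q \<phi>" "carrier Q = \<phi> ` carrier G"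
    "\<And>x. x \<in> carrier G \<Longrightarrow> \<phi> x = \<one>\<^bsub>Q\<^esub> \<longleftrightarrow> x \<in> lower_series G (Suc (Suc 0))"
    and rs: "set rs \<subseteq> carrier G"
    and k: "k < length rs" and v: "v \<in> carrier G" "inv (rs ! k) \<otimes> v \<in> lower_series G (Suc 0)"
    and ys: "admissible rs ys"
  shows "\<exists>ys'. admissible rs ys' \<and> \<phi> (square_word G ys') = \<phi> (square_word G ys) \<otimes>\<^bsub>Q\<^esub> \<phi> (v \<otimes> v)"
proof -
  interpret h: group_hom G Q \<phi> by fact
  let ?r = "rs ! k" and ?l = "length rs + k"
  have rk: "?r \<in> carrier G" using rs k by auto
  define p where "p = inv ?r \<otimes> v"
  have pc: "p \<in> carrier G" and p1: "p \<in> lower_series G (Suc 0)" and vrp: "v = ?r \<otimes> p"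
    using rk v by (simp_all add: p_def group_word_simps)
  have one: "\<phi> x = \<one>\<^bsub>Q\<^esub>" if "x \<in> lower_series G (Suc (Suc 0))" for x
    using that \<phi>(3) lower_series_closed by blast
  have "\<phi> (commutator G p ?r) = \<one>\<^bsub>Q\<^esub>" "\<phi> (p \<otimes> p) = \<one>\<^bsub>Q\<^esub>"
    using one lower_series_commutator[OF p1 rk] lower_series_square[OF p1] by blast+
  then have vv: "\<phi> (v \<otimes> v) = \<phi> ?r \<otimes>\<^bsub>Q\<^esub> \<phi> ?r"
    using h.H.square_perturb[of "\<phi> ?r" "\<phi> p"] pc rk
    by (simp add: vrp h.hom_commutator central_def)
  have rr: "?r \<otimes> ?r \<in> lower_series G (Suc 0)" using rk by (intro lower_series_square) simp
  have cent: "central Q (\<phi> (v \<otimes> v))"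
    using lower_series_central_mod[OF \<phi> rr] vv rk by simp
  have r4: "\<phi> (v \<otimes> v) \<otimes>\<^bsub>Q\<^esub> \<phi> (v \<otimes> v) = \<one>\<^bsub>Q\<^esub>"
    using one[OF lower_series_square[OF rr]] rk vv by simp
  define y where "y = (if ys ! ?l = \<one> then ?r else \<one>)"
  have l: "?l < length ys" and ysc: "set ys \<subseteq> carrier G" and yl: "ys ! ?l \<in> {\<one>, ?r}"
    using ys k by (auto simp: admissible_def)
  have yc: "y \<in> carrier G" using rk by (simp add: y_def)
  have adm: "admissible rs (ys[?l := y])"
    unfolding admissible_def
  proof (intro conjI allI impI)
    show "length (ys[?l := y]) = 2 * length rs" using ys by (simp add: admissible_def)
    show "set (ys[?l := y]) \<subseteq> carrier G"
      using set_update_subset_insert[of ys ?l y] ysc yc by auto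
    fix j assume j: "j < length rs"
    show "ys[?l := y] ! (length rs + j) \<in> {\<one>, rs ! j}"
      using ys j l by (cases "j = k") (auto simp: admissible_def y_def)
    show "inv (rs ! j) \<otimes> ys[?l := y] ! j \<in> lower_series G (Suc 0)"
      using ys j by (simp add: admissible_def)
  qed
  have "square_word Q ((map \<phi> ys)[?l := \<phi> y]) = square_word Q (map \<phi> ys) \<otimes>\<^bsub>Q\<^esub> \<phi> (v \<otimes> v)"
  proof (rule h.H.square_word_update)
    show "set (map \<phi> ys) \<subseteq> carrier Q" using ysc by auto
    show "\<phi> y \<in> carrier Q" using yc by simp
    show "?l < length (map \<phi> ys)" using l by simp
    show "\<phi> y \<otimes>\<^bsub>Q\<^esub> \<phi> y = map \<phi> ys ! ?l \<otimes>\<^bsub>Q\<^esub> map \<phi> ys ! ?l \<otimes>\<^bsub>Q\<^esub> \<phi> (v \<otimes> v)"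
      using yl l r4 v rk vv by (auto simp: y_def)
  qed (fact cent)
  then have "\<phi> (square_word G (ys[?l := y])) = \<phi> (square_word G ys) \<otimes>\<^bsub>Q\<^esub> \<phi> (v \<otimes> v)"
    using ysc adm by (simp add: h.hom_square_word map_update admissible_def)
  then show ?thesis using adm by blast
qed

text \<open>The step must start from any admissible word, since the factors of \<open>w\<close> are
  absorbed one after the other. Inverses cost nothing because the generators become involutions or
  trivial under \<open>\<phi>\<close>.\<close>

lemma admissible_absorb_generate:
  assumes \<phi>: "group_hom G Q \<phi>" and K: "K \<subseteq> carrier G"
    and inv2: "\<And>x. x \<in> K \<Longrightarrow> \<phi> (x \<otimes> x) = \<one>\<^bsub>Q\<^esub>"
    and step: "\<And>x ys. x \<in> K \<Longrightarrow> admissible rs ys \<Longrightarrow>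
      \<exists>ys'. admissible rs ys' \<and> \<phi> (square_word G ys') = \<phi> (square_word G ys) \<otimes>\<^bsub>Q\<^esub> \<phi> x"
    and w: "w \<in> generate G K" and ys: "admissible rs ys"
  shows "\<exists>ys'. admissible rs ys' \<and> \<phi> (square_word G ys') = \<phi> (square_word G ys) \<otimes>\<^bsub>Q\<^esub> \<phi> w"
proof -
  interpret h: group_hom G Q \<phi> by fact
  have sc: "\<phi> (square_word G ys) \<in> carrier Q" if "admissible rs ys" for ys
    using that by (simp add: admissible_def square_word_closed)
  from w ys show ?thesis
  proof (induction w arbitrary: ys rule: generate.induct)
    case one
    then show ?case using sc by auto
  next
    case (incl x)
    then show ?case by (rule step)
  next
    case (inv x)
    then have x: "x \<in> carrier G" using K by blast
    with inv2[OF inv(1)] have "\<phi> (inv x) = \<phi> x" by (simp add: h.H.inv_equality)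
    then show ?case using step[OF inv] by simp
  next
    case (eng x y)
    then have x: "x \<in> carrier G" "y \<in> carrier G" using generate_in_carrier[OF K] by blast+
    obtain zs where zs: "admissible rs zs"
      "\<phi> (square_word G zs) = \<phi> (square_word G ys) \<otimes>\<^bsub>Q\<^esub> \<phi> x"
      using eng by blast
    obtain zs' where "admissible rs zs'"
      "\<phi> (square_word G zs') = \<phi> (square_word G zs) \<otimes>\<^bsub>Q\<^esub> \<phi> y"
      using eng zs by blast
    then show ?case using zs x sc[OF eng.prems] by (auto simp: h.H.m_assoc intro!: exI[of _ zs'])
  qed
qed

lemma admissible_step:
  assumes \<phi>: "group_hom G Q \<phi>" "carrier Q = \<phi> ` carrier G"
    "\<And>x. x \<in> carrier G \<Longrightarrow> \<phi> x = \<one>\<^bsub>Q\<^esub> \<longleftrightarrow> x \<in> lower_series G (Suc (Suc i))"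
    and rs: "set rs \<subseteq> carrier G"
    and cover: "\<And>q. q \<in> carrier G \<Longrightarrow> \<exists>k<length rs. inv (rs ! k) \<otimes> q \<in> lower_series G (Suc 0)"
    and w: "w \<in> lower_series G (Suc i)" and ys: "admissible rs ys"
  shows "\<exists>ys'. admissible rs ys' \<and> \<phi> (square_word G ys') = \<phi> (square_word G ys) \<otimes>\<^bsub>Q\<^esub> \<phi> w"
proof -
  interpret h: group_hom G Q \<phi> by fact
  have sc: "\<phi> (square_word G ys) \<in> carrier Q" if "admissible rs ys" for ys
    using that by (simp add: admissible_def square_word_closed)
  have one: "\<phi> x = \<one>\<^bsub>Q\<^esub>" if "x \<in> lower_series G (Suc (Suc i))" for x
    using that \<phi>(3) lower_series_closed by blast
  have inv2: "\<phi> (x \<otimes> x) = \<one>\<^bsub>Q\<^esub>" if "x \<in> lower_series G (Suc i)" for x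
    using one lower_series_square[OF that] by blast
  show ?thesis
  proof (cases "i = 0")
    case True
    let ?K = "square_gens G (carrier G)"
    have w': "w \<in> generate G ?K" using w True lower_series_one by simp
    have K: "?K \<subseteq> carrier G" by (simp add: square_gens_closed)
    show ?thesis
    proof (rule admissible_absorb_generate[OF \<phi>(1) K _ _ w' ys])
      fix x assume "x \<in> ?K"
      then obtain v where v: "v \<in> carrier G" "x = v \<otimes> v" by (auto simp: square_gens_def)
      then show "\<phi> (x \<otimes> x) = \<one>\<^bsub>Q\<^esub>"
        using inv2[of x] lower_series_square[of v 0] True by simp
      fix ys assume ys: "admissible rs ys"
      obtain k where k: "k < length rs" "inv (rs ! k) \<otimes> v \<in> lower_series G (Suc 0)"
        using cover v by blast
      show "\<exists>ys'. admissible rs ys' \<and> \<phi> (square_word G ys') = \<phi> (square_word G ys) \<otimes>\<^bsub>Q\<^esub> \<phi> x"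
        using admissible_toggle[OF \<phi>[unfolded True] rs k(1) v(1) k(2) ys] v(2) by simp
    qed
  next
    case False
    then have i: "i > 0" by simp
    let ?A = "lower_series G i"
    let ?K = "square_gens G ?A \<union> commutator_gens G ?A"
    have w': "w \<in> generate G ?K" using w by simp
    have K: "?K \<subseteq> carrier G"
      using square_gens_closed commutator_gens_closed lower_series_closed by blast
    have KS: "?K \<subseteq> lower_series G (Suc i)" by (auto intro: generate.incl)
    have square: "\<exists>ys'. admissible rs ys' \<and>
        \<phi> (square_word G ys') = \<phi> (square_word G ys) \<otimes>\<^bsub>Q\<^esub> \<phi> (u \<otimes> u)"
      if u: "u \<in> ?A" and ys: "admissible rs ys" for u ys
    proof -
      have uc: "u \<in> carrier G" using u lower_series_closed by blast
      \<comment> \<open>At the representative of the coset of \<open>\<one>\<close> the commutator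
        contribution is trivial, so the perturbation yields the bare square.\<close>
      obtain k where "k < length rs" "inv (rs ! k) \<otimes> \<one> \<in> lower_series G (Suc 0)"
        using cover by blast
      from admissible_perturb[OF \<phi> i rs u this(1) one_closed this(2) ys]
      show ?thesis using uc h.H.commutator_eq_one_iff[of "\<phi> u" "\<one>\<^bsub>Q\<^esub>"] by simp
    qed
    show ?thesis
    proof (rule admissible_absorb_generate[OF \<phi>(1) K _ _ w' ys])
      fix x assume x: "x \<in> ?K"
      then show "\<phi> (x \<otimes> x) = \<one>\<^bsub>Q\<^esub>" using inv2[of x] KS by blast
      fix ys assume ys: "admissible rs ys"
      from x show "\<exists>ys'. admissible rs ys' \<and> \<phi> (square_word G ys') = \<phi> (square_word G ys) \<otimes>\<^bsub>Q\<^esub> \<phi> x"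
      proof
        assume "x \<in> square_gens G ?A"
        then show ?thesis using square ys by (auto simp: square_gens_def)
      next
        assume "x \<in> commutator_gens G ?A"
        then obtain u q where u: "u \<in> ?A" "q \<in> carrier G" "x = commutator G u q"
          by (auto simp: commutator_gens_def)
        have uc: "u \<in> carrier G" using u lower_series_closed by blast
        obtain k where k: "k < length rs" "inv (rs ! k) \<otimes> q \<in> lower_series G (Suc 0)"
          using cover u by blast
        obtain zs where zs: "admissible rs zs" "\<phi> (square_word G zs) =
            \<phi> (square_word G ys) \<otimes>\<^bsub>Q\<^esub> (\<phi> u \<otimes>\<^bsub>Q\<^esub> \<phi> u \<otimes>\<^bsub>Q\<^esub> commutator Q (\<phi> u) (\<phi> q))"
          using admissible_perturb[OF \<phi> i rs u(1) k(1) u(2) k(2) ys] by blast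
        \<comment> \<open>The first perturbation produced \<open>u \<otimes> u\<close> along with
          the commutator. Absorbing the same square once more cancels it, because it is its own
          inverse modulo the next term.\<close>
        obtain zs' where zs': "admissible rs zs'"
          "\<phi> (square_word G zs') = \<phi> (square_word G zs) \<otimes>\<^bsub>Q\<^esub> \<phi> (u \<otimes> u)"
          using square[OF u(1) zs(1)] by blast
        have "central Q (\<phi> x)"
          using lower_series_central_mod[OF \<phi>] lower_series_commutator[OF u(1,2)] u(3) by simp
        moreover have "\<phi> (u \<otimes> u) \<otimes>\<^bsub>Q\<^esub> \<phi> (u \<otimes> u) = \<one>\<^bsub>Q\<^esub>"
          using inv2[OF lower_series_square[OF u(1)]] uc by simp
        moreover have "\<phi> x \<in> carrier Q" "\<phi> (u \<otimes> u) \<in> carrier Q" using u uc by auto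
        ultimately have "\<phi> (u \<otimes> u) \<otimes>\<^bsub>Q\<^esub> \<phi> x \<otimes>\<^bsub>Q\<^esub> \<phi> (u \<otimes> u)
            = \<phi> x"
          by (intro h.H.central_conj_involution)
        moreover have "\<phi> x = commutator Q (\<phi> u) (\<phi> q)" using u uc by (simp add: h.hom_commutator)
        ultimately have "(\<phi> u \<otimes>\<^bsub>Q\<^esub> \<phi> u \<otimes>\<^bsub>Q\<^esub> commutator Q (\<phi> u) (\<phi> q)) \<otimes>\<^bsub>Q\<^esub> \<phi> (u \<otimes> u) = \<phi> x"
          using uc by simp
        then have "\<phi> (square_word G zs') = \<phi> (square_word G ys) \<otimes>\<^bsub>Q\<^esub> \<phi> x"
          using zs(2) zs'(2) sc[OF ys] uc u by (simp add: h.H.m_assoc)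
        then show ?thesis using zs'(1) by blast
      qed
    qed
  qed
qed

text \<open>The length depends on the number of coset representatives alone, not on the class
  \<open>c\<close>: each round keeps the length and makes the word correct modulo one further term
  of the series.\<close>

theorem square_word_of_bounded_length:
  assumes rs: "set rs \<subseteq> carrier G"
    and cover: "\<And>q. q \<in> carrier G \<Longrightarrow> \<exists>k<length rs. inv (rs ! k) \<otimes> q \<in> lower_series G (Suc 0)"
    and c: "lower_series G c = {\<one>}" and z: "z \<in> lower_series G (Suc 0)"
  shows "\<exists>ys. length ys = 2 * length rs \<and> set ys \<subseteq> carrier G \<and> square_word G ys = z"
proof -
  have zc: "z \<in> carrier G" using z lower_series_closed by blast
  have "\<exists>ys p. admissible rs ys \<and> p \<in> lower_series G (Suc j) \<and> z = square_word G ys \<otimes> p" for j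
  proof (induction j)
    case 0
    \<comment> \<open>Initial word: unperturbed representatives, all switches off. Its value lies in
      the first term like every product of squares, so it agrees with \<open>z\<close> to the
      required depth.\<close>
    let ?ys = "rs @ replicate (length rs) \<one>"
    interpret P1: subgroup "lower_series G (Suc 0)" G by (rule lower_series_subgroup)
    have "inv (rs ! k) \<otimes> rs ! k = \<one>" if "k < length rs" for k
      using that rs by (simp add: subset_iff)
    then have adm: "admissible rs ?ys"
      using rs P1.one_closed by (auto simp: admissible_def nth_append)
    have "square_word G ys \<in> lower_series G (Suc 0)" if "set ys \<subseteq> carrier G" for ys
      using that
    proof (induction ys)
      case (Cons y ys)
      then have "y \<otimes> y \<in> lower_series G (Suc 0)" by (intro lower_series_square) simp
      with Cons show ?case by (simp del: lower_series.simps)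
    qed (simp del: lower_series.simps)
    then have sw: "square_word G ?ys \<in> lower_series G (Suc 0)" using adm by (simp add: admissible_def)
    then have "inv (square_word G ?ys) \<otimes> z \<in> lower_series G (Suc 0)"
      using z by (intro P1.m_closed P1.m_inv_closed)
    moreover have "square_word G ?ys \<in> carrier G" using sw lower_series_closed by blast
    then have "z = square_word G ?ys \<otimes> (inv (square_word G ?ys) \<otimes> z)"
      using zc by (simp add: cancel_left_inv)
    ultimately show ?case using adm by blast
  next
    case (Suc j)
    then obtain ys p where ys: "admissible rs ys" "p \<in> lower_series G (Suc j)" "z = square_word G ys \<otimes> p"
      by blast
    interpret N: normal "lower_series G (Suc (Suc j))" G by (rule lower_series_normal)
    obtain Q :: "'a set monoid" and \<phi> where \<phi>: "group_hom G Q \<phi>" "carrier Q = \<phi> ` carrier G"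
      "\<And>x. x \<in> carrier G \<Longrightarrow> \<phi> x = \<one>\<^bsub>Q\<^esub> \<longleftrightarrow> x \<in> lower_series G (Suc (Suc j))"
      by (rule N.exists_quotient_hom) blast
    interpret h: group_hom G Q \<phi> by fact
    obtain zs where zs: "admissible rs zs" "\<phi> (square_word G zs) = \<phi> (square_word G ys) \<otimes>\<^bsub>Q\<^esub> \<phi> p"
      using admissible_step[OF \<phi> rs cover ys(2,1)] by blast
    have sc: "square_word G ys \<in> carrier G" "square_word G zs \<in> carrier G"
      using ys(1) zs(1) by (auto simp: admissible_def)
    have pc: "p \<in> carrier G" using ys(2) lower_series_closed by blast
    have "\<phi> z = \<phi> (square_word G zs)" unfolding zs(2) ys(3) using sc pc by simp
    then have "\<phi> (inv (square_word G zs) \<otimes> z) = \<one>\<^bsub>Q\<^esub>" using sc zc by simp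
    then have "inv (square_word G zs) \<otimes> z \<in> lower_series G (Suc (Suc j))"
      using \<phi>(3)[of "inv (square_word G zs) \<otimes> z"] sc zc by simp
    moreover have "z = square_word G zs \<otimes> (inv (square_word G zs) \<otimes> z)"
      using zc sc by (simp add: cancel_left_inv)
    ultimately show ?case using zs(1) by blast
  qed
  from this[of c] obtain ys p where ys: "admissible rs ys" "p \<in> lower_series G (Suc c)"
    "z = square_word G ys \<otimes> p" by blast
  have "p = \<one>" using ys(2) lower_series_Suc_subset[of c] c by blast
  then show ?thesis using ys by (auto simp: admissible_def)
qed

section \<open>Finite 2-groups: central involutions and termination of the lower series\<close>

lemma two_group_nontrivial_center:
  assumes ord: "order G = 2 ^ k" and k: "k > 0"
  shows "\<exists>z. central G z \<and> z \<noteq> \<one>"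
proof (rule ccontr)
  assume no: "\<not> ?thesis"
  let ?f = "\<lambda>g. \<lambda>h \<in> carrier G. g \<otimes> h \<otimes> inv g"
  interpret A: group_action G "carrier G" ?f by (rule action_by_conjugation)
  have fin: "finite (carrier G)" using ord by (metis order_gt_0_iff_finite zero_less_numeral zero_less_power)
  let ?O = "orbits G (carrier G) ?f"
  have orb1: "orbit G ?f \<one> = {\<one>}"
    using one_closed by (auto simp: orbit_def intro!: exI[of _ "\<one>"])
  \<comment> \<open>Class equation: a conjugacy orbit has 2-power size, and size one would mean a
    central element. If only \<open>\<one>\<close> were central, the group order would be
    odd.\<close>
  have "even (card B)" if B: "B \<in> ?O - {{\<one>}}" for B
  proof -
    from B obtain x where x: "x \<in> carrier G" "B = orbit G ?f x" by (auto simp: orbits_def)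
    have "x \<noteq> \<one>" using B x orb1 by auto
    then have "\<not> central G x" using no by blast
    then obtain g where g: "g \<in> carrier G" "x \<otimes> g \<noteq> g \<otimes> x" using x by (auto simp: central_def)
    have "x \<in> B" "g \<otimes> x \<otimes> inv g \<in> B"
      using x g A.orbit_refl by (auto simp: orbit_def)
    moreover have "g \<otimes> x \<otimes> inv g \<noteq> x"
    proof
      assume eq: "g \<otimes> x \<otimes> inv g = x"
      have "g \<otimes> x = (g \<otimes> x \<otimes> inv g) \<otimes> g" using g x by (simp add: m_assoc)
      also have "\<dots> = x \<otimes> g" by (simp only: eq)
      finally show False using g(2) by simp
    qed
    ultimately have "card B \<noteq> 1" by (auto simp: card_1_singleton_iff)
    have "card B dvd 2 ^ k"
      unfolding x(2) ord[symmetric] A.orbit_stabilizer_theorem[OF x(1), symmetric] by (rule dvd_triv_left)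
    then obtain l where "card B = 2 ^ l"
      using divides_primepow_nat[OF two_is_prime_nat] by blast
    with \<open>card B \<noteq> 1\<close> show "even (card B)" by (cases "l = 0") simp_all
  qed
  then have "even (\<Sum>B\<in>?O - {{\<one>}}. card B)" by (rule dvd_sum)
  moreover have "finite ?O" using fin by (simp add: orbits_def)
  moreover have "{\<one>} \<in> ?O" using orb1 by (auto simp: orbits_def)
  ultimately have "odd (\<Sum>B\<in>?O. card B)" by (simp add: sum.remove[of ?O "{\<one>}"])
  moreover have "(\<Sum>B\<in>?O. card B) = order G"
    using A.disjoint_sum[OF fin, of "\<lambda>_. 1 :: nat"] by (simp add: order_def)
  ultimately show False using ord k by simp
qed

text \<open>The last nontrivial entry among the repeated squares of a central element is an
  involution, and powers of a central element are central.\<close>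

lemma two_group_central_involution:
  assumes ord: "order G = 2 ^ k" and k: "k > 0"
  shows "\<exists>w. central G w \<and> w \<noteq> \<one> \<and> w \<otimes> w = \<one>"
proof -
  obtain z where z: "central G z" "z \<noteq> \<one>" using two_group_nontrivial_center[OF assms] by blast
  have zc: "z \<in> carrier G" using z(1) by (rule central_closed)
  define m where "m = (LEAST m. z [^] ((2::nat) ^ m) = \<one>)"
  have "z [^] ((2::nat) ^ k) = \<one>" using pow_order_eq_1[OF zc] ord by simp
  then have m: "z [^] ((2::nat) ^ m) = \<one>" unfolding m_def by (rule LeastI)
  have "m \<noteq> 0" using m z zc by (cases m) auto
  then obtain l where l: "m = Suc l" by (cases m) auto
  have ne: "z [^] ((2::nat) ^ l) \<noteq> \<one>" using not_less_Least[of l "\<lambda>m. z [^] ((2::nat) ^ m) = \<one>"] l m_def by simp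
  have cent: "central G (z [^] (j::nat))" for j
  proof (induction j)
    case (Suc j)
    then show ?case using z(1) by (simp add: central_mult)
  qed (simp add: central_def)
  have "z [^] ((2::nat) ^ l) \<otimes> z [^] ((2::nat) ^ l) = \<one>"
    using m l zc by (simp add: nat_pow_mult mult_2)
  then show ?thesis using ne cent by blast
qed

text \<open>\<open>N'\<close> is the preimage of a subgroup generated by a central involution of the
  quotient by \<open>N\<close>: order two sends its squares into \<open>N\<close>, centrality sends
  its commutators there.\<close>

lemma two_group_lower_series_step:
  assumes ord: "order G = 2 ^ k" and N: "N \<lhd> G" "N \<noteq> carrier G"
  shows "\<exists>N'. N' \<lhd> G \<and> N \<subset> N' \<and> square_gens G N' \<union> commutator_gens G N' \<subseteq> N"
proof -
  interpret N: normal N G by fact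
  obtain Q :: "'a set monoid" and \<phi> where \<phi>: "group_hom G Q \<phi>" "carrier Q = \<phi> ` carrier G"
    "\<And>x. x \<in> carrier G \<Longrightarrow> \<phi> x = \<one>\<^bsub>Q\<^esub> \<longleftrightarrow> x \<in> N" and card: "order Q * card N = order G"
    by (rule N.exists_quotient_hom) blast
  interpret h: group_hom G Q \<phi> by fact
  have "order Q dvd 2 ^ k" using card ord by (metis dvd_triv_left)
  then obtain j where j: "order Q = 2 ^ j" using divides_primepow_nat two_is_prime_nat by blast
  obtain x where x: "x \<in> carrier G" "x \<notin> N" using N N.subset by blast
  have "j \<noteq> 0"
  proof
    assume "j = 0"
    then have "order Q = 1" using j by simp
    then obtain y where "carrier Q = {y}" unfolding order_def by (rule card_1_singletonE)
    then have "\<phi> x = \<one>\<^bsub>Q\<^esub>" using x h.hom_closed[OF x(1)] h.H.one_closed by auto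
    then show False using x \<phi>(3) by blast
  qed
  then obtain w where w: "central Q w" "w \<noteq> \<one>\<^bsub>Q\<^esub>" "w \<otimes>\<^bsub>Q\<^esub> w = \<one>\<^bsub>Q\<^esub>"
    using h.H.two_group_central_involution[OF j] by blast
  have wc: "w \<in> carrier Q" using w(1) by (rule h.H.central_closed)
  let ?N = "{x \<in> carrier G. \<phi> x \<in> {\<one>\<^bsub>Q\<^esub>, w}}"
  have winv: "inv\<^bsub>Q\<^esub> w = w" using w wc h.H.inv_equality by blast
  have comm: "\<phi> u \<otimes>\<^bsub>Q\<^esub> y = y \<otimes>\<^bsub>Q\<^esub> \<phi> u" if "u \<in> ?N" "y \<in> carrier Q" for u y
    using that w(1) by (auto simp: central_def)
  have sub: "subgroup ?N G"
    by (rule subgroupI) (use w wc winv in auto)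
  have "?N \<lhd> G"
  proof (rule normal_invI[OF sub])
    fix g u assume g: "g \<in> carrier G" and u: "u \<in> ?N"
    then have "\<phi> (g \<otimes> u \<otimes> inv g) = \<phi> u \<otimes>\<^bsub>Q\<^esub> \<phi> g \<otimes>\<^bsub>Q\<^esub> inv\<^bsub>Q\<^esub> \<phi> g"
      using comm[OF u, of "\<phi> g"] by simp
    also have "\<dots> = \<phi> u" using g u by (simp add: h.H.m_assoc)
    finally show "g \<otimes> u \<otimes> inv g \<in> ?N" using g u by auto
  qed
  moreover have "N \<subset> ?N"
  proof
    show "N \<subseteq> ?N" using \<phi>(3) N.subset by auto
    obtain y where "y \<in> carrier G" "\<phi> y = w" using wc \<phi>(2) by auto
    then show "N \<noteq> ?N" using w(2) \<phi>(3) by blast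
  qed
  moreover have "square_gens G ?N \<subseteq> N"
  proof
    fix y assume "y \<in> square_gens G ?N"
    then obtain u where u: "u \<in> carrier G" "\<phi> u = \<one>\<^bsub>Q\<^esub> \<or> \<phi> u = w" "y = u \<otimes> u"
      by (auto simp: square_gens_def)
    then have "\<phi> y = \<one>\<^bsub>Q\<^esub>" using w(3) by (elim disjE) simp_all
    then show "y \<in> N" using \<phi>(3)[of y] u by simp
  qed
  moreover have "commutator_gens G ?N \<subseteq> N"
  proof
    fix y assume "y \<in> commutator_gens G ?N"
    then obtain u q where u: "u \<in> ?N" "q \<in> carrier G" "y = commutator G u q"
      by (auto simp: commutator_gens_def)
    then have "\<phi> y = \<one>\<^bsub>Q\<^esub>" using comm[OF u(1), of "\<phi> q"]
      by (simp add: h.hom_commutator h.H.commutator_eq_one_iff del: insert_iff)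
    then show "y \<in> N" using \<phi>(3)[of y] u by simp
  qed
  ultimately show ?thesis by blast
qed

text \<open>An ascending chain with the property of the previous lemma bounds the lower series from
  above. The claim is made for all normal subgroups, so that the induction can enlarge
  \<open>N\<close> until it is the whole group and then descend with one more term per step.\<close>

lemma two_group_lower_series_trivial:
  assumes ord: "order G = 2 ^ k"
  shows "\<exists>c. lower_series G c = {\<one>}"
proof -
  have fin: "finite (carrier G)" using ord by (metis order_gt_0_iff_finite zero_less_numeral zero_less_power)
  have "\<exists>c. lower_series G c \<subseteq> N" if "N \<lhd> G" for N
    using that
  proof (induction "card (carrier G) - card N" arbitrary: N rule: less_induct)
    case less
    interpret N: normal N G by fact
    show ?case
    proof (cases "N = carrier G")
      case True
      then show ?thesis using lower_series_closed by blast
    next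
      case False
      obtain N' where N': "N' \<lhd> G" "N \<subset> N'" "square_gens G N' \<union> commutator_gens G N' \<subseteq> N"
        using two_group_lower_series_step[OF ord less.prems False] by blast
      interpret N': normal N' G by fact
      have "card N < card N'" using N'(2) N'.subset fin by (meson finite_subset psubset_card_mono)
      moreover have "card N' \<le> card (carrier G)" by (rule card_mono[OF fin N'.subset])
      ultimately have "card (carrier G) - card N' < card (carrier G) - card N" by linarith
      then obtain c where c: "lower_series G c \<subseteq> N'" using less.hyps[OF _ N'(1)] by blast
      have "square_gens G (lower_series G c) \<union> commutator_gens G (lower_series G c) \<subseteq> N"
        using N'(3) square_gens_mono[OF c] commutator_gens_mono[OF c] by blast
      then have "lower_series G (Suc c) \<subseteq> N"
        by (simp add: generate_subgroup_incl N.is_subgroup)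
      then show ?thesis by blast
    qed
  qed
  then obtain c where "lower_series G c \<subseteq> {\<one>}" using one_is_normal by blast
  moreover have "\<one> \<in> lower_series G c" using subgroup.one_closed[OF lower_series_subgroup] .
  ultimately show ?thesis by blast
qed

end

section \<open>Automorphisms of the quadratic closure\<close>

lemma field_emb_simps:
  assumes "field_emb f"
  shows "f 0 = 0" "f 1 = 1" "f (x + y) = f x + f y" "f (x * y) = f x * f y"
    "f (- x) = - f x" "f (x - y) = f x - f y" "f (inverse x) = inverse (f x)"
    "f x = 0 \<longleftrightarrow> x = 0" "f (x ^ n) = f x ^ n" "f x = f y \<longleftrightarrow> x = y"
proof -
  have one: "f 1 = 1" and add: "\<And>x y. f (x + y) = f x + f y" and mult: "\<And>x y. f (x * y) = f x * f y"
    using assms by (simp_all add: field_emb_def)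
  show zero: "f 0 = 0" using add[of 0 0] by (simp only: add_0_left add_cancel_right_right)
  have neg: "f (- x) = - f x" for x using add[of x "- x"] zero by (simp add: eq_neg_iff_add_eq_0 add.commute)
  have eq0: "f x = 0 \<longleftrightarrow> x = 0" for x
  proof
    assume "f x = 0"
    then have "f (x * inverse x) = 0" by (simp only: mult) simp
    then show "x = 0" using one by (cases "x = 0") auto
  qed (simp add: zero)
  have diff: "f (x - y) = f x - f y" for x y using add[of x "- y"] neg by simp
  show "f (x - y) = f x - f y" by (rule diff)
  show "f x = f y \<longleftrightarrow> x = y" using eq0[of "x - y"] diff by simp
  show "f (inverse x) = inverse (f x)"
  proof (cases "x = 0")
    case False
    then have "f x * f (inverse x) = 1" using mult[of x "inverse x"] one by simp
    then show ?thesis by (simp add: inverse_unique)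
  qed (simp add: zero)
  show "f (x ^ n) = f x ^ n" by (induction n) (simp_all add: one mult)
  show "f 1 = 1" "f (x + y) = f x + f y" "f (x * y) = f x * f y" "f (- x) = - f x" "f x = 0 \<longleftrightarrow> x = 0"
    using one add mult neg eq0 by simp_all
qed

text \<open>Partial isomorphisms between subfields are handled through their graphs: a subfield of
  the product ring that is single-valued is automatically injective.\<close>

definition partial_iso :: "('a::field \<Rightarrow> 'b::field) \<Rightarrow> ('b \<times> 'b) set \<Rightarrow> bool" where
  "partial_iso i P \<longleftrightarrow> (\<forall>c. (i c, i c) \<in> P)
     \<and> (\<forall>x x' y y'. (x, x') \<in> P \<longrightarrow> (y, y') \<in> P \<longrightarrow> (x + y, x' + y') \<in> P \<and> (x * y, x' * y') \<in> P)
     \<and> (\<forall>x x'. (x, x') \<in> P \<longrightarrow> (- x, - x') \<in> P \<and> (inverse x, inverse x') \<in> P)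
     \<and> (\<forall>x'. (0, x') \<in> P \<longrightarrow> x' = 0)"

lemma partial_isoD:
  assumes "partial_iso i P"
  shows "(i c, i c) \<in> P" "(x, x') \<in> P \<Longrightarrow> (y, y') \<in> P \<Longrightarrow> (x + y, x' + y') \<in> P"
    "(x, x') \<in> P \<Longrightarrow> (y, y') \<in> P \<Longrightarrow> (x * y, x' * y') \<in> P"
    "(x, x') \<in> P \<Longrightarrow> (- x, - x') \<in> P" "(x, x') \<in> P \<Longrightarrow> (inverse x, inverse x') \<in> P"
    "(0, x') \<in> P \<Longrightarrow> x' = 0"
  using assms unfolding partial_iso_def by blast+

lemma partial_iso_diff:
  "partial_iso i P \<Longrightarrow> (x, x') \<in> P \<Longrightarrow> (y, y') \<in> P \<Longrightarrow> (x - y, x' - y') \<in> P"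
  using partial_isoD(2)[of i P x x' "- y" "- y'"] partial_isoD(4)[of i P y y'] by simp

lemma partial_iso_functional:
  "partial_iso i P \<Longrightarrow> (x, x') \<in> P \<Longrightarrow> (x, x'') \<in> P \<Longrightarrow> x' = x''"
  using partial_iso_diff[of i P x x' x x''] partial_isoD(6)[of i P "x' - x''"] by simp

lemma partial_iso_zero_one:
  assumes "partial_iso i P" "field_emb i"
  shows "(0, 0) \<in> P" "(1, 1) \<in> P"
  using partial_isoD(1)[OF assms(1), of 0] partial_isoD(1)[OF assms(1), of 1]
  by (simp_all add: field_emb_simps[OF assms(2)])

lemma partial_iso_injective:
  assumes P: "partial_iso i P" and i: "field_emb i" and x: "(x, 0) \<in> P"
  shows "x = 0"
proof (rule ccontr)
  assume "x \<noteq> 0"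
  then have "(1, 0) \<in> P"
    using partial_isoD(3)[OF P x partial_isoD(5)[OF P x]] by simp
  then show False
    using partial_iso_functional[OF P _ partial_iso_zero_one(2)[OF P i]] by force
qed

lemma partial_iso_Union:
  assumes "C \<noteq> {}" "\<And>P. P \<in> C \<Longrightarrow> partial_iso i P" "subset.chain A C"
  shows "partial_iso i (\<Union>C)"
proof -
  have common: "\<exists>P\<in>C. p \<in> P \<and> q \<in> P" if "p \<in> \<Union>C" "q \<in> \<Union>C" for p q
    using that assms(3) unfolding subset.chain_def by blast
  show ?thesis
    unfolding partial_iso_def
  proof (intro conjI allI impI)
    show "(i c, i c) \<in> \<Union>C" for c using assms(1,2) partial_isoD(1) by blast
    show "(x + y, x' + y') \<in> \<Union>C" "(x * y, x' * y') \<in> \<Union>C"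
      if "(x, x') \<in> \<Union>C" "(y, y') \<in> \<Union>C" for x x' y y'
      using common[OF that] assms(2) partial_isoD(2,3) by blast+
    show "(- x, - x') \<in> \<Union>C" "(inverse x, inverse x') \<in> \<Union>C" if "(x, x') \<in> \<Union>C" for x x'
      using that assms(2) partial_isoD(4,5) by blast+
    show "x' = 0" if "(0, x') \<in> \<Union>C" for x'
      using that assms(2) partial_isoD(6) by blast
  qed
qed

text \<open>Turns maximality into totality: a partial isomorphism whose domain admits no new square
  root is defined on the whole tower.\<close>

lemma sqrt_tower_subset_Domain:
  assumes P: "partial_iso i P" and sq: "\<And>x. x * x \<in> Domain P \<Longrightarrow> x \<in> Domain P"
  shows "sqrt_tower i \<subseteq> Domain P"
proof
  note D = partial_isoD[OF P]
  fix z assume "z \<in> sqrt_tower i"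
  then show "z \<in> Domain P"
  proof induction
    case (base c)
    show ?case by (rule DomainI[OF D(1)])
  next
    case (add x y)
    then obtain x' y' where "(x, x') \<in> P" "(y, y') \<in> P" by (elim DomainE)
    then show ?case by (rule DomainI[OF D(2)])
  next
    case (mult x y)
    then obtain x' y' where "(x, x') \<in> P" "(y, y') \<in> P" by (elim DomainE)
    then show ?case by (rule DomainI[OF D(3)])
  next
    case (neg x)
    then obtain x' where "(x, x') \<in> P" by (elim DomainE)
    then show ?case by (rule DomainI[OF D(4)])
  next
    case (inv x)
    then obtain x' where "(x, x') \<in> P" by (elim DomainE)
    then show ?case by (rule DomainI[OF D(5)])
  next
    case (sqrt y x)
    then have "x * x \<in> Domain P" by (simp only:)
    then show ?case by (rule sq)
  qed
qed

definition adjoin :: "('b::field \<times> 'b) set \<Rightarrow> 'b \<Rightarrow> 'b \<Rightarrow> ('b \<times> 'b) set" where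
  "adjoin P x x' = {(u + v * x, u' + v' * x') | u u' v v'. (u, u') \<in> P \<and> (v, v') \<in> P}"

lemma adjoin_superset:
  assumes "partial_iso i P" "field_emb i"
  shows "P \<subseteq> adjoin P x x'" "(x, x') \<in> adjoin P x x'"
proof -
  show "P \<subseteq> adjoin P x x'"
    unfolding adjoin_def using partial_iso_zero_one(1)[OF assms] by force
  show "(x, x') \<in> adjoin P x x'"
    unfolding adjoin_def using partial_iso_zero_one[OF assms] by force
qed

text \<open>As \<open>x\<close> is outside the domain, \<open>u + v * x\<close> vanishes only for
  \<open>u = v = 0\<close>, since otherwise \<open>x\<close> would be a quotient of domain elements.
  This gives single-valuedness of the new graph.\<close>

lemma partial_iso_adjoin:
  assumes P: "partial_iso i P" and i: "field_emb i" and y: "(x * x, x' * x') \<in> P" and x: "x \<notin> Domain P"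
  shows "partial_iso i (adjoin P x x')"
proof -
  note D = partial_isoD[OF P] and diff = partial_iso_diff[OF P]
  have zero: "u = 0 \<and> v = 0" if "(u, u') \<in> P" "(v, v') \<in> P" "u + v * x = 0" for u u' v v'
  proof -
    have "v = 0"
    proof (rule ccontr)
      assume "v \<noteq> 0"
      then have "x = - u * inverse v"
        using that(3) by (simp add: field_simps eq_neg_iff_add_eq_0)
      moreover have "(- u * inverse v, - u' * inverse v') \<in> P" using that by (intro D)
      ultimately show False using x by blast
    qed
    with that show ?thesis by simp
  qed
  have in_adjoin: "(u + v * x, u' + v' * x') \<in> adjoin P x x'" if "(u, u') \<in> P" "(v, v') \<in> P" for u u' v v'
    using that by (auto simp: adjoin_def)
  show ?thesis
    unfolding partial_iso_def
  proof (intro conjI allI impI)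
    show "(i c, i c) \<in> adjoin P x x'" for c using adjoin_superset[OF P i] D(1) by blast
    fix a a' assume a: "(a, a') \<in> adjoin P x x'"
    then obtain u u' v v' where uv: "(u, u') \<in> P" "(v, v') \<in> P" "a = u + v * x" "a' = u' + v' * x'"
      by (auto simp: adjoin_def)
    show "(- a, - a') \<in> adjoin P x x'"
      using in_adjoin[OF D(4)[OF uv(1)] D(4)[OF uv(2)]] uv by simp
    {
      fix b b' assume b: "(b, b') \<in> adjoin P x x'"
      then obtain s s' t t' where st: "(s, s') \<in> P" "(t, t') \<in> P" "b = s + t * x" "b' = s' + t' * x'"
        by (auto simp: adjoin_def)
      show "(a + b, a' + b') \<in> adjoin P x x'"
        using in_adjoin[OF D(2)[OF uv(1) st(1)] D(2)[OF uv(2) st(2)]] uv st by (simp add: algebra_simps)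
      have "(u * s + v * t * (x * x), u' * s' + v' * t' * (x' * x')) \<in> P"
        "(u * t + v * s, u' * t' + v' * s') \<in> P"
        by (simp_all add: D(2-5) uv(1,2) st(1,2) y)
      from in_adjoin[OF this] show "(a * b, a' * b') \<in> adjoin P x x'"
        using uv st by (simp add: algebra_simps)
    }
    \<comment> \<open>The norm of \<open>a\<close>, which lies in the old field. The inverse of
      \<open>a\<close> is its conjugate over the norm, again of the shape that \<open>adjoin\<close>
      requires.\<close>
    define n where "n = u * u - v * v * (x * x)"
    define n' where "n' = u' * u' - v' * v' * (x' * x')"
    have n: "(n, n') \<in> P"
      unfolding n_def n'_def by (simp add: D(2-5) diff uv(1,2) y)
    have fac: "n = a * (u - v * x)" "n' = a' * (u' - v' * x')"
      by (simp_all add: n_def n'_def uv algebra_simps)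
    show "(inverse a, inverse a') \<in> adjoin P x x'"
    proof (cases "a = 0")
      case True
      then have "u = 0" "v = 0" using zero[OF uv(1,2)] uv(3) by auto
      then have "a' = 0" using uv(1,2,4) D(6)[of u'] D(6)[of v'] by simp
      with True a show ?thesis by simp
    next
      case False
      have "u - v * x \<noteq> 0"
      proof
        assume "u - v * x = 0"
        then have "u = 0 \<and> - v = 0" using zero[OF uv(1) D(4)[OF uv(2)]] by simp
        then show False using False uv(3) by simp
      qed
      then have "n \<noteq> 0" using False fac by simp
      then have "n' \<noteq> 0" using n partial_iso_injective[OF P i] by blast
      have "inverse a = (u - v * x) * inverse n"
        using \<open>u - v * x \<noteq> 0\<close> by (simp add: fac(1))
      then have "inverse a = u * inverse n + (- (v * inverse n)) * x"
        by (simp add: algebra_simps)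
      moreover have "inverse a' = (u' - v' * x') * inverse n'"
        using \<open>n' \<noteq> 0\<close> by (simp add: fac(2))
      then have "inverse a' = u' * inverse n' + (- (v' * inverse n')) * x'"
        by (simp add: algebra_simps)
      moreover have "(u * inverse n, u' * inverse n') \<in> P" "(- (v * inverse n), - (v' * inverse n')) \<in> P"
        by (simp_all add: D(2-5) uv(1,2) n)
      ultimately show ?thesis using in_adjoin by metis
    qed
  next
    fix a' assume "(0, a') \<in> adjoin P x x'"
    then obtain u u' v v' where uv: "(u, u') \<in> P" "(v, v') \<in> P" "0 = u + v * x" "a' = u' + v' * x'"
      by (auto simp: adjoin_def)
    then have "u = 0" "v = 0" using zero[OF uv(1,2)] by auto
    then show "a' = 0" using uv(1,2,4) D(6)[of u'] D(6)[of v'] by simp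
  qed
qed

locale quadratic_closure =
  fixes i :: "'a::field \<Rightarrow> 'b::field"
  assumes quadratic_closure: "is_quadratic_closure i"
    and two_neq_zero: "(2::'a) \<noteq> 0"
begin

abbreviation "G \<equiv> galois_group i"

lemma emb: "field_emb i"
  using quadratic_closure by (simp add: is_quadratic_closure_def)

lemmas emb_simps [simp] = field_emb_simps[OF emb]

lemma ex_sqrt: "\<exists>x::'b. x * x = y"
  using quadratic_closure by (simp add: is_quadratic_closure_def)

lemma in_tower: "z \<in> sqrt_tower i"
  using quadratic_closure by (simp add: is_quadratic_closure_def)

lemma two_neq_zero': "(2::'b) \<noteq> 0"
proof -
  have "i 2 = i (1 + 1)" by simp
  also have "\<dots> = 2" by (simp only: emb_simps) simp
  finally show ?thesis using two_neq_zero by (metis emb_simps(8))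
qed

lemma neq_minus: "(x::'b) \<noteq> 0 \<Longrightarrow> x \<noteq> - x" "(x::'b) \<noteq> 0 \<Longrightarrow> - x \<noteq> x"
proof -
  assume "x \<noteq> 0"
  then have "2 * x \<noteq> 0" using two_neq_zero' by simp
  then have "x + x \<noteq> 0" by (metis mult_2)
  then show "x \<noteq> - x" by (metis add.right_inverse)
  then show "- x \<noteq> x" by metis
qed

lemma carrier_iff: "\<sigma> \<in> carrier G \<longleftrightarrow> bij \<sigma> \<and> field_emb \<sigma> \<and> (\<forall>x. \<sigma> (i x) = i x)"
  by (simp add: galois_group_def)

text \<open>By Zorn there is a maximal extension. Every element of the target has a square root, so
  a missing root of a domain element could always be sent somewhere; hence the domain is closed
  under square roots.\<close>

lemma partial_iso_extends:
  assumes P: "partial_iso i P"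
  shows "\<exists>\<sigma>\<in>carrier G. \<forall>(x, y)\<in>P. \<sigma> x = y"
proof -
  let ?A = "{M. partial_iso i M \<and> P \<subseteq> M}"
  have "\<exists>M\<in>?A. \<forall>N\<in>?A. M \<subseteq> N \<longrightarrow> N = M"
  proof (rule subset_Zorn_nonempty)
    show "?A \<noteq> {}" using P by blast
    fix C assume C: "C \<noteq> {}" "subset.chain ?A C"
    then have "C \<subseteq> ?A" by (simp add: subset.chain_def)
    then have "partial_iso i (\<Union>C)" by (intro partial_iso_Union[OF C(1) _ C(2)]) auto
    then show "\<Union>C \<in> ?A" using C(1) \<open>C \<subseteq> ?A\<close> by auto
  qed
  then obtain M where MA: "M \<in> ?A" and maxA: "\<forall>N\<in>?A. M \<subseteq> N \<longrightarrow> N = M" by (elim bexE)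
  from MA have M: "partial_iso i M" "P \<subseteq> M" by simp_all
  have max: "N = M" if "partial_iso i N" "M \<subseteq> N" for N
    using maxA M(2) that by auto
  note D = partial_isoD[OF M(1)]
  have "sqrt_tower i \<subseteq> Domain M"
  proof (rule sqrt_tower_subset_Domain[OF M(1)], rule ccontr)
    fix x assume y: "x * x \<in> Domain M" and x: "x \<notin> Domain M"
    from y obtain y' where y': "(x * x, y') \<in> M" by (elim DomainE)
    obtain x' where x': "x' * x' = y'" using ex_sqrt by blast
    have "partial_iso i (adjoin M x x')"
      using y' x' x by (intro partial_iso_adjoin M emb) auto
    then have "adjoin M x x' = M" using max adjoin_superset(1)[OF M(1) emb] by blast
    then show False using adjoin_superset(2)[OF M(1) emb, of x x'] x by blast
  qed
  then have "\<exists>y. (x, y) \<in> M" for x using in_tower[of x] by blast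
  then obtain f where f: "(x, f x) \<in> M" for x by metis
  have f_eq: "f x = y" if "(x, y) \<in> M" for x y
    using partial_iso_functional[OF M(1) f that] .
  have femb: "field_emb f"
    unfolding field_emb_def
    using f_eq D(2,3) f partial_iso_zero_one[OF M(1) emb] by (auto intro!: f_eq)
  \<comment> \<open>Surjectivity follows the tower as well: a square root of
    \<open>f (v * v)\<close> can only be \<open>f v\<close> or \<open>f (- v)\<close>.\<close>
  have "z \<in> range f" for z
    using in_tower[of z]
  proof induction
    case (base x)
    then show ?case using f_eq[OF D(1)] by (metis rangeI)
  next
    case (sqrt y x)
    then obtain w where w: "y = f w" by blast
    obtain v where "v * v = w" using ex_sqrt by blast
    then have "f v * f v = x * x" using sqrt w field_emb_simps(4)[OF femb, of v v] by simp
    then have "x = f v \<or> x = f (- v)" by (auto simp: field_emb_simps[OF femb] square_eq_iff)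
    then show ?case by blast
  qed (auto simp flip: field_emb_simps(3-5,7)[OF femb])
  then have "bij f"
    by (auto simp: bij_def inj_def field_emb_simps[OF femb])
  then have "f \<in> carrier G" using femb f_eq[OF D(1)] by (auto simp: carrier_iff)
  then show ?thesis using f_eq M(2) by blast
qed

text \<open>Take a maximal subfield that omits \<open>z\<close>, encoded as a subset of the identity
  relation. Adjoining some square root \<open>x\<close> must capture \<open>z = u + v * x\<close>,
  and the automorphism extending \<open>x \<mapsto> - x\<close> moves \<open>z\<close> unless
  \<open>v = 0\<close>.\<close>

lemma fixed_field:
  assumes "\<And>\<sigma>. \<sigma> \<in> carrier G \<Longrightarrow> \<sigma> z = z"
  shows "z \<in> range i"
proof (rule ccontr)
  assume z: "z \<notin> range i"
  let ?A = "{M. partial_iso i M \<and> M \<subseteq> Id \<and> z \<notin> Domain M}"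
  have base: "{(i c, i c) | c. True} \<in> ?A"
    using z unfolding partial_iso_def
    by (auto simp flip: emb_simps)
  have "\<exists>M\<in>?A. \<forall>N\<in>?A. M \<subseteq> N \<longrightarrow> N = M"
  proof (rule subset_Zorn_nonempty)
    show "?A \<noteq> {}" using base by blast
    fix C assume C: "C \<noteq> {}" "subset.chain ?A C"
    then have "C \<subseteq> ?A" by (simp add: subset.chain_def)
    then have "partial_iso i (\<Union>C)" by (intro partial_iso_Union[OF C(1) _ C(2)]) auto
    then show "\<Union>C \<in> ?A" using C(1) \<open>C \<subseteq> ?A\<close> by auto
  qed
  then obtain M where MA: "M \<in> ?A" and maxA: "\<forall>N\<in>?A. M \<subseteq> N \<longrightarrow> N = M" by (elim bexE)
  from MA have M: "partial_iso i M" "M \<subseteq> Id" "z \<notin> Domain M" by simp_all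
  have max: "N = M" if "partial_iso i N" "N \<subseteq> Id" "z \<notin> Domain N" "M \<subseteq> N" for N
    using maxA that by simp
  note D = partial_isoD[OF M(1)]
  have "\<exists>x. x * x \<in> Domain M \<and> x \<notin> Domain M"
  proof (rule ccontr)
    assume no: "\<not> ?thesis"
    have "x \<in> Domain M" if "x * x \<in> Domain M" for x using no that by blast
    then have "z \<in> Domain M"
      using sqrt_tower_subset_Domain[OF M(1)] in_tower[of z] by blast
    then show False using M by blast
  qed
  then obtain x where x: "(x * x, x * x) \<in> M" "x \<notin> Domain M" using M(2) by blast
  have "partial_iso i (adjoin M x x)" using x by (intro partial_iso_adjoin M emb)
  moreover have "adjoin M x x \<subseteq> Id" using M(2) by (auto simp: adjoin_def)
  ultimately have "z \<in> Domain (adjoin M x x)"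
    using max[of "adjoin M x x"] adjoin_superset[OF M(1) emb, of x x] x(2) by (metis DomainI)
  then obtain u u' v v' where "(u, u') \<in> M" "(v, v') \<in> M" "z = u + v * x"
    unfolding adjoin_def by blast
  then have uv: "(u, u) \<in> M" "(v, v) \<in> M" "z = u + v * x" using M(2) by auto
  have "partial_iso i (adjoin M x (- x))" using x by (intro partial_iso_adjoin M emb) simp_all
  from partial_iso_extends[OF this] obtain \<sigma> where \<sigma>: "\<sigma> \<in> carrier G"
    "\<forall>(a, b) \<in> adjoin M x (- x). \<sigma> a = b" by (elim bexE)
  have "(z, u + v * (- x)) \<in> adjoin M x (- x)" using uv by (auto simp: adjoin_def)
  then have "\<sigma> z = u + v * (- x)" using \<sigma>(2) by auto
  then have "v * x = - (v * x)" using assms[OF \<sigma>(1)] uv(3) by simp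
  then have "v * x = 0" using neq_minus(1) by blast
  moreover have "x \<noteq> 0" using x(2) partial_iso_zero_one[OF M(1) emb] by blast
  ultimately have "v = 0" by simp
  then show False using uv M(3) by auto
qed

end

section \<open>Finite groups of 2-power exponent and quadratic characters\<close>

lemma two_power_if_only_prime_two:
  fixes n :: nat
  assumes "n > 0" "\<And>p. Factorial_Ring.prime p \<Longrightarrow> p dvd n \<Longrightarrow> p = 2"
  shows "\<exists>k. n = 2 ^ k"
  using assms
proof (induction n rule: less_induct)
  case (less n)
  show ?case
  proof (cases "n = 1")
    case True
    then show ?thesis by (intro exI[of _ 0]) simp
  next
    case False
    then obtain p where p: "Factorial_Ring.prime p" "p dvd n" using prime_factor_nat by blast
    then have "2 dvd n" using less.prems by blast
    then obtain n' where n': "n = 2 * n'" by blast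
    then have "\<exists>k. n' = 2 ^ k"
      using less.prems by (intro less.IH) auto
    then show ?thesis using n' by (metis power_Suc)
  qed
qed

context group
begin

lemma two_power_order:
  assumes fin: "finite (carrier G)" and exp: "\<And>q. q \<in> carrier G \<Longrightarrow> q [^] ((2::nat) ^ m) = \<one>"
  shows "\<exists>k. order G = 2 ^ k"
proof (rule two_power_if_only_prime_two)
  show "order G > 0" using fin order_gt_0_iff_finite by blast
  fix p :: nat assume p: "Factorial_Ring.prime p" "p dvd order G"
  show "p = 2"
  proof (rule ccontr)
    assume p2: "p \<noteq> 2"
    \<comment> \<open>Sylow's theorem with exponent one gives a subgroup of prime order, as in
      Cauchy's theorem; its nontrivial elements have order dividing both \<open>p\<close> and a
      power of two.\<close>
    obtain l where "order G = p ^ 1 * l" using p(2) by (auto elim: dvdE)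
    then obtain H where H: "subgroup H G" "card H = p ^ 1"
      using sylow_thm[OF p(1) group_axioms _ fin] by blast
    have "\<not> H \<subseteq> {\<one>}"
    proof
      assume "H \<subseteq> {\<one>}"
      then have "card H \<le> 1" using card_mono[of "{\<one>}" H] by simp
      then show False using H(2) prime_gt_1_nat[OF p(1)] by simp
    qed
    then obtain h where h: "h \<in> H" "h \<noteq> \<one>" by blast
    have hc: "h \<in> carrier G" using h(1) subgroup.mem_carrier[OF H(1)] by blast
    interpret H: group "G\<lparr>carrier := H\<rparr>" by (rule subgroup.subgroup_is_group[OF H(1) group_axioms])
    have "h [^]\<^bsub>G\<lparr>carrier := H\<rparr>\<^esub> order (G\<lparr>carrier := H\<rparr>) = \<one>\<^bsub>G\<lparr>carrier := H\<rparr>\<^esub>"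
      using h(1) by (intro H.pow_order_eq_1) simp
    then have "h [^] p = \<one>"
      using H(2) nat_pow_consistent[of h p H] by (simp add: order_def)
    then have "ord h dvd p" "ord h dvd 2 ^ m"
      using hc exp pow_eq_id by blast+
    moreover have "coprime p (2 ^ m)"
      using primes_coprime[OF p(1) two_is_prime_nat p2] by simp
    ultimately have "is_unit (ord h)" by (rule coprime_common_divisor[rotated])
    then have "ord h = 1" by simp
    then show False using h(2) hc ord_eq_1 by blast
  qed
qed

text \<open>A subgroup that is maximal among those containing all squares and omitting
  \<open>s\<close> has index two: for \<open>q\<close> outside it, adding the coset of
  \<open>q\<close> gives a larger subgroup, which must contain \<open>s\<close>. The character is
  the indicator of the complement.\<close>

lemma exists_quadratic_character:
  assumes fin: "finite (carrier G)" and s: "s \<in> carrier G" "s \<notin> lower_series G (Suc 0)"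
  shows "\<exists>\<chi> :: 'a \<Rightarrow> bit. (\<forall>x\<in>carrier G. \<forall>y\<in>carrier G. \<chi> (x \<otimes> y) = \<chi> x + \<chi> y) \<and> \<chi> s = 1"
proof -
  let ?A = "{H. subgroup H G \<and> square_gens G (carrier G) \<subseteq> H \<and> s \<notin> H}"
  have "?A \<subseteq> Pow (carrier G)" using subgroup.subset by blast
  then have "finite ?A" using fin finite_subset by blast
  moreover have "lower_series G (Suc 0) \<in> ?A"
    using s(2) lower_series_subgroup[of "Suc 0"] unfolding lower_series_one by (auto intro: generate.incl)
  ultimately obtain H where "H \<in> ?A" and max: "\<And>K. K \<in> ?A \<Longrightarrow> H \<subseteq> K \<Longrightarrow> H = K"
    using finite_has_maximal[of ?A] by (metis (no_types, lifting) empty_iff)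
  then have H: "subgroup H G" "square_gens G (carrier G) \<subseteq> H" "s \<notin> H" by auto
  interpret H: subgroup H G by fact
  have sq: "q \<otimes> q \<in> H" if "q \<in> carrier G" for q using H(2) that by (auto simp: square_gens_def)
  \<comment> \<open>\<open>q \<otimes> h \<otimes> q\<close> is the square of
    \<open>q \<otimes> h\<close> times \<open>inv h\<close>. This stands in for normality of
    \<open>H\<close> in all coset computations below.\<close>
  have sandwich: "q \<otimes> h \<otimes> q \<in> H" if q: "q \<in> carrier G" and h: "h \<in> H" for q h
  proof -
    have hc: "h \<in> carrier G" using h by simp
    have "((q \<otimes> h) \<otimes> (q \<otimes> h)) \<otimes> inv h \<in> H" using sq[of "q \<otimes> h"] q hc h by blast
    also have "((q \<otimes> h) \<otimes> (q \<otimes> h)) \<otimes> inv h = q \<otimes> h \<otimes> q" using q hc by (simp add: m_assoc)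
    finally show ?thesis .
  qed
  have coset: "\<exists>h\<in>H. q = h \<otimes> s" if q: "q \<in> carrier G" "q \<notin> H" for q
  proof -
    let ?K = "H \<union> {h \<otimes> q | h. h \<in> H}"
    have K: "subgroup ?K G"
    proof (rule subgroupI)
      show "?K \<subseteq> carrier G" using q by auto
      show "?K \<noteq> {}" using H.one_closed by blast
    next
      fix x assume "x \<in> ?K"
      then consider "x \<in> H" | h where "h \<in> H" "x = h \<otimes> q" by blast
      then show "inv x \<in> ?K"
      proof cases
        case 2
        have hc: "h \<in> carrier G" using 2 by simp
        have "inv x = inv (q \<otimes> h \<otimes> q) \<otimes> q"
          using 2 q hc by (simp add: inv_mult_group m_assoc)
        moreover have "inv (q \<otimes> h \<otimes> q) \<in> H" using sandwich q 2 by blast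
        ultimately show ?thesis by blast
      qed auto
    next
      fix x y assume x: "x \<in> ?K" and y: "y \<in> ?K"
      have mr: "x \<otimes> k \<in> ?K" if k: "k \<in> H" for k
      proof -
        from x consider "x \<in> H" | h where "h \<in> H" "x = h \<otimes> q" by blast
        then show ?thesis
        proof cases
          case 2
          have c: "h \<in> carrier G" "k \<in> carrier G" using 2 k by simp_all
          have "x \<otimes> k = (h \<otimes> (q \<otimes> k \<otimes> q) \<otimes> inv (q \<otimes> q)) \<otimes> q"
            using 2 q c by (simp add: inv_mult_group m_assoc)
          moreover have "h \<otimes> (q \<otimes> k \<otimes> q) \<otimes> inv (q \<otimes> q) \<in> H"
            using sandwich[OF q(1) k] sq[OF q(1)] 2 by blast
          ultimately show ?thesis by blast
        qed (use k in auto)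
      qed
      have mq: "x \<otimes> q \<in> ?K"
      proof -
        from x consider "x \<in> H" | h where "h \<in> H" "x = h \<otimes> q" by blast
        then show ?thesis
        proof cases
          case 2
          then have "x \<otimes> q = h \<otimes> (q \<otimes> q)" using q by (simp add: m_assoc)
          moreover have "h \<otimes> (q \<otimes> q) \<in> H" using 2 sq[OF q(1)] by blast
          ultimately show ?thesis by simp
        qed auto
      qed
      have xc: "x \<in> carrier G" using x q by auto
      from y consider "y \<in> H" | k where "k \<in> H" "y = k \<otimes> q" by blast
      then show "x \<otimes> y \<in> ?K"
      proof cases
        case 1
        then show ?thesis by (rule mr)
      next
        case 2
        have kc: "k \<in> carrier G" using 2 by simp
        from mr[OF 2(1)] consider "x \<otimes> k \<in> H" | h where "h \<in> H" "x \<otimes> k = h \<otimes> q" by blast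
        then show ?thesis
        proof cases
          case 1
          then show ?thesis using 2 q xc kc by (auto simp: m_assoc[symmetric])
        next
          case h: 2
          have "x \<otimes> y = h \<otimes> (q \<otimes> q)"
            using 2 h q xc kc by (simp add: m_assoc[symmetric])
          moreover have "h \<otimes> (q \<otimes> q) \<in> H" using h sq[OF q(1)] by blast
          ultimately show ?thesis by simp
        qed
      qed
    qed
    have "\<one> \<otimes> q \<in> ?K" using H.one_closed by blast
    then have "q \<in> ?K" using q by simp
    then have "?K \<noteq> H" using q by blast
    then have "s \<in> ?K" using max[of ?K] K H(2) by blast
    then obtain h where h: "h \<in> H" "s = h \<otimes> q" using H(3) by blast
    have "q = inv h \<otimes> s" using h q by (simp add: m_assoc[symmetric])
    then show ?thesis using h(1) H.m_inv_closed by blast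
  qed
  define \<chi> :: "'a \<Rightarrow> bit" where "\<chi> x = (if x \<in> H then 0 else 1)" for x
  have "\<chi> (x \<otimes> y) = \<chi> x + \<chi> y" if x: "x \<in> carrier G" and y: "y \<in> carrier G" for x y
  proof -
    consider "x \<in> H" "y \<in> H" | "x \<in> H" "y \<notin> H" | "x \<notin> H" "y \<in> H" | "x \<notin> H" "y \<notin> H" by blast
    then show ?thesis
    proof cases
      case 1
      then show ?thesis by (simp add: \<chi>_def)
    next
      case 2
      then have "inv x \<otimes> (x \<otimes> y) = y" using x y by (simp add: m_assoc[symmetric])
      then have "x \<otimes> y \<notin> H" using 2 by (metis H.m_closed H.m_inv_closed)
      then show ?thesis using 2 by (simp add: \<chi>_def)
    next
      case 3
      then have "(x \<otimes> y) \<otimes> inv y = x" using x y by (simp add: m_assoc)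
      then have "x \<otimes> y \<notin> H" using 3 by (metis H.m_closed H.m_inv_closed)
      then show ?thesis using 3 by (simp add: \<chi>_def)
    next
      case 4
      obtain h k where hk: "h \<in> H" "x = h \<otimes> s" "k \<in> H" "y = k \<otimes> s" using coset x y 4 by metis
      then have "x \<otimes> y = h \<otimes> (s \<otimes> k \<otimes> s)" using s by (simp add: m_assoc)
      moreover have "h \<otimes> (s \<otimes> k \<otimes> s) \<in> H" using sandwich[OF s(1) hk(3)] hk(1) by blast
      ultimately show ?thesis using 4 by (simp add: \<chi>_def)
    qed
  qed
  moreover have "\<chi> s = 1" using H by (simp add: \<chi>_def)
  ultimately show ?thesis by blast
qed

end

section \<open>Linear independence of multiplicative maps and a compactness principle\<close>

lemma finite_image_determined:
  assumes fin: "finite (f ` A)" and det: "\<And>x y. x \<in> A \<Longrightarrow> y \<in> A \<Longrightarrow> f x = f y \<Longrightarrow> g x = g y"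
  shows "finite (g ` A)"
proof -
  have "g ` A \<subseteq> (\<lambda>r. g (SOME x. x \<in> A \<and> f x = r)) ` f ` A"
  proof
    fix y assume "y \<in> g ` A"
    then obtain x where x: "x \<in> A" "y = g x" by blast
    have "(SOME x'. x' \<in> A \<and> f x' = f x) \<in> A \<and> f (SOME x'. x' \<in> A \<and> f x' = f x) = f x"
      by (rule someI[of _ x]) (use x(1) in blast)
    then have "y = g (SOME x'. x' \<in> A \<and> f x' = f x)" unfolding x(2) using det[OF x(1)] by simp
    then show "y \<in> (\<lambda>r. g (SOME x. x \<in> A \<and> f x = r)) ` f ` A" using x(1) by blast
  qed
  then show ?thesis by (rule finite_subset[OF _ finite_imageI[OF fin]])
qed

text \<open>Dedekind's independence of characters. The functions are multiplicative only on a subset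
  \<open>L\<close>, because the members of a finite quotient will enter as automorphisms restricted
  to its fixed field.\<close>

lemma dedekind_independence:
  fixes r :: "'r \<Rightarrow> 'b \<Rightarrow> 'k::field"
  assumes "finite R"
    and "\<And>j x y. j \<in> R \<Longrightarrow> x \<in> L \<Longrightarrow> y \<in> L \<Longrightarrow> m x y \<in> L \<and> r j (m x y) = r j x * r j y"
    and "\<And>j k. j \<in> R \<Longrightarrow> k \<in> R \<Longrightarrow> j \<noteq> k \<Longrightarrow> \<exists>z\<in>L. r j z \<noteq> r k z"
    and "\<And>j. j \<in> R \<Longrightarrow> \<exists>z\<in>L. r j z \<noteq> 0"
    and "\<And>z. z \<in> L \<Longrightarrow> (\<Sum>j\<in>R. c j * r j z) = 0"
    and "j \<in> R"
  shows "c j = 0"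
  using assms
proof (induction R arbitrary: c j rule: finite_induct)
  case (insert k R)
  have other: "c j = 0" if j: "j \<in> R" for j
  proof -
    obtain w where w: "w \<in> L" "r j w \<noteq> r k w"
      using insert.prems(2)[of j k] j insert.hyps(2) by blast
    \<comment> \<open>Subtracting \<open>r k w\<close> times the relation at \<open>z\<close> from
      the relation at \<open>m w z\<close> eliminates the summand of \<open>k\<close> and leaves a
      relation over \<open>R\<close>.\<close>
    have "c j * (r j w - r k w) = 0"
    proof (rule insert.IH[where c = "\<lambda>l. c l * (r l w - r k w)"])
      fix z assume z: "z \<in> L"
      have "(\<Sum>l\<in>insert k R. c l * r l (m w z)) = 0" "(\<Sum>l\<in>insert k R. c l * r l z) = 0"
        using insert.prems(4) insert.prems(1)[of k w z] w z by blast+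
      then have "(\<Sum>l\<in>insert k R. c l * r l (m w z)) - r k w * (\<Sum>l\<in>insert k R. c l * r l z) = 0"
        by simp
      also have "(\<Sum>l\<in>insert k R. c l * r l (m w z)) - r k w * (\<Sum>l\<in>insert k R. c l * r l z)
          = (\<Sum>l\<in>insert k R. c l * (r l w - r k w) * r l z)"
        using insert.prems(1) w z
        by (auto simp: sum_distrib_left sum_subtractf[symmetric] algebra_simps intro!: sum.cong)
      finally show "(\<Sum>l\<in>R. c l * (r l w - r k w) * r l z) = 0"
        using insert.hyps by simp
    qed (use insert.prems(1-3) j in blast)+
    then show ?thesis using w by simp
  qed
  obtain w where w: "w \<in> L" "r k w \<noteq> 0" using insert.prems(3) by blast
  have "(\<Sum>l\<in>insert k R. c l * r l w) = 0" using insert.prems(4) w by blast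
  then have "c k * r k w = 0" using insert.hyps other by simp
  then have "c k = 0" using w by simp
  then show ?case using other insert.prems(5) by blast
qed simp

text \<open>A product of finite discrete spaces is compact. By \<open>loc\<close> each condition
  \<open>P S\<close> depends on finitely many coordinates and so defines a closed set;
  \<open>mono\<close> and \<open>ex\<close> give the finite intersection property.\<close>

lemma finite_valued_compactness:
  fixes A :: "'a \<Rightarrow> 'c set" and P :: "'a set \<Rightarrow> ('a \<Rightarrow> 'c) \<Rightarrow> bool"
  assumes fin: "\<And>z. finite (A z)"
    and loc: "\<And>S f g. finite S \<Longrightarrow> P S f \<Longrightarrow> (\<And>z. z \<in> S \<Longrightarrow> f z = g z) \<Longrightarrow> P S g"
    and mono: "\<And>S T f. finite T \<Longrightarrow> S \<subseteq> T \<Longrightarrow> P T f \<Longrightarrow> P S f"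
    and ex: "\<And>S. finite S \<Longrightarrow> \<exists>f. (\<forall>z. f z \<in> A z) \<and> P S f"
  shows "\<exists>f. (\<forall>z. f z \<in> A z) \<and> (\<forall>S. finite S \<longrightarrow> P S f)"
proof -
  define T where "T = product_topology (\<lambda>z. discrete_topology (A z)) UNIV"
  define C where "C S = {f \<in> PiE UNIV A. P S f}" for S
  have top: "topspace T = PiE UNIV A" by (simp add: T_def)
  have comp: "compact_space T"
    unfolding T_def compact_space_product_topology by (simp add: compact_space_discrete_topology fin)
  have closed: "closedin T (C S)" if S: "finite S" for S
  proof -
    have "openin T (topspace T - C S)"
      unfolding T_def openin_product_topology_alt
    proof (intro ballI)
      fix f assume "f \<in> topspace (product_topology (\<lambda>z. discrete_topology (A z)) UNIV) - C S"
      then have f: "\<And>z. f z \<in> A z" "\<not> P S f" by (auto simp: C_def PiE_UNIV_domain)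
      let ?U = "\<lambda>z. if z \<in> S then {f z} else A z"
      have "{z \<in> UNIV. ?U z \<noteq> topspace (discrete_topology (A z))} \<subseteq> S" by auto
      then have "finite {z \<in> UNIV. ?U z \<noteq> topspace (discrete_topology (A z))}"
        using S finite_subset by blast
      moreover have "PiE UNIV ?U \<subseteq> topspace (product_topology (\<lambda>z. discrete_topology (A z)) UNIV) - C S"
      proof
        fix g assume "g \<in> PiE UNIV ?U"
        then have g: "\<And>z. g z \<in> ?U z" by (rule PiE_mem) simp
        have "g z \<in> A z" for z using g[of z] f(1) by (auto split: if_splits)
        moreover have "g z = f z" if "z \<in> S" for z using g[of z] that by simp
        then have "\<not> P S g" using loc[OF S, of g f] f(2) by blast
        ultimately show "g \<in> topspace (product_topology (\<lambda>z. discrete_topology (A z)) UNIV) - C S"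
          by (simp add: C_def PiE_UNIV_domain)
      qed
      ultimately show "\<exists>U. finite {z \<in> UNIV. U z \<noteq> topspace (discrete_topology (A z))} \<and>
          (\<forall>z\<in>UNIV. openin (discrete_topology (A z)) (U z)) \<and> f \<in> PiE UNIV U \<and>
          PiE UNIV U \<subseteq> topspace (product_topology (\<lambda>z. discrete_topology (A z)) UNIV) - C S"
        using f(1) by (intro exI[of _ ?U]) (auto simp: PiE_UNIV_domain)
    qed
    then show ?thesis unfolding closedin_def top by (auto simp: C_def PiE_UNIV_domain)
  qed
  have "\<Inter>(C ` {S. finite S}) \<noteq> {}"
  proof -
    have "\<Inter>\<F> \<noteq> {}" if F: "finite \<F>" "\<F> \<subseteq> C ` {S. finite S}" for \<F>
    proof -
      obtain \<S> where \<S>: "finite \<S>" "\<S> \<subseteq> {S. finite S}" "\<F> = C ` \<S>"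
        using finite_subset_image[OF F] by blast
      then have finU: "finite (\<Union>\<S>)" by auto
      obtain f where f: "\<forall>z. f z \<in> A z" "P (\<Union>\<S>) f" using ex[OF finU] by blast
      have "f \<in> C S" if "S \<in> \<S>" for S
        using f mono[OF finU, of S f] that by (auto simp: C_def PiE_UNIV_domain)
      then show ?thesis using \<S>(3) by blast
    qed
    then show ?thesis
      using comp closed unfolding compact_space_fip by (metis (no_types, lifting) imageE mem_Collect_eq)
  qed
  then obtain f where "f \<in> \<Inter>(C ` {S. finite S})" by blast
  then have f: "f \<in> C S" if "finite S" for S using that by blast
  have "f z \<in> A z" for z using f[of "{}"] by (auto simp: C_def PiE_UNIV_domain)
  moreover have "P S f" if "finite S" for S using f[OF that] by (simp add: C_def)
  ultimately show ?thesis by blast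
qed

section \<open>Finite quotients and characters of the Galois group\<close>

lemma bit_cases: "(b::bit) = 0 \<or> b = 1"
  by (cases b) auto

lemma field_emb_inv:
  assumes "field_emb f" "bij f"
  shows "field_emb (inv_into UNIV f)"
proof -
  have f: "f (inv_into UNIV f x) = x" for x using assms(2) by (simp add: bij_is_surj surj_f_inv_f)
  have eq: "inv_into UNIV f y = x" if "f x = y" for x y using that assms(2) by (metis bij_inv_eq_iff)
  show ?thesis
    unfolding field_emb_def using assms(1) by (auto intro!: eq simp: field_emb_simps f)
qed

context quadratic_closure
begin

lemma mult_G [simp]: "\<sigma> \<otimes>\<^bsub>G\<^esub> \<tau> = \<sigma> \<circ> \<tau>" and one_G [simp]: "\<one>\<^bsub>G\<^esub> = id"
  by (simp_all add: galois_group_def)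

lemma gal_simps:
  assumes "\<sigma> \<in> carrier G"
  shows "\<sigma> 0 = 0" "\<sigma> 1 = 1" "\<sigma> (x + y) = \<sigma> x + \<sigma> y" "\<sigma> (x * y) = \<sigma> x * \<sigma> y"
    "\<sigma> (- x) = - \<sigma> x" "\<sigma> (x - y) = \<sigma> x - \<sigma> y" "\<sigma> (inverse x) = inverse (\<sigma> x)"
    "\<sigma> x = 0 \<longleftrightarrow> x = 0" "\<sigma> (i a) = i a" "\<sigma> x = \<sigma> y \<longleftrightarrow> x = y"
  using assms by (simp_all add: carrier_iff field_emb_simps)

lemma comp_closed: "\<sigma> \<in> carrier G \<Longrightarrow> \<tau> \<in> carrier G \<Longrightarrow> \<sigma> \<circ> \<tau> \<in> carrier G"
  unfolding carrier_iff by (simp add: bij_comp field_emb_def)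

lemma inverse_closed:
  assumes "\<sigma> \<in> carrier G"
  shows "inv_into UNIV \<sigma> \<in> carrier G" "inv_into UNIV \<sigma> \<circ> \<sigma> = id"
proof -
  have b: "bij \<sigma>" and e: "field_emb \<sigma>" and f: "\<And>x. \<sigma> (i x) = i x"
    using assms unfolding carrier_iff by blast+
  have "inv_into UNIV \<sigma> (i x) = i x" for x
    using f[of x] bij_inv_eq_iff[OF b, of "i x" "i x"] by simp
  then show "inv_into UNIV \<sigma> \<in> carrier G"
    unfolding carrier_iff using b e field_emb_inv bij_imp_bij_inv by blast
  show "inv_into UNIV \<sigma> \<circ> \<sigma> = id" using b by (simp add: bij_is_inj)
qed

lemma group_G: "group (galois_group i)"
proof (rule groupI)
  show "\<one>\<^bsub>G\<^esub> \<in> carrier G" unfolding one_G carrier_iff by (simp add: field_emb_def)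
  fix \<sigma> \<tau> \<rho> assume \<sigma>: "\<sigma> \<in> carrier G" and "\<tau> \<in> carrier G"
  then show "\<sigma> \<otimes>\<^bsub>G\<^esub> \<tau> \<in> carrier G" unfolding mult_G by (rule comp_closed)
  show "\<exists>\<tau>\<in>carrier G. \<tau> \<otimes>\<^bsub>G\<^esub> \<sigma> = \<one>\<^bsub>G\<^esub>"
    unfolding mult_G one_G using inverse_closed[OF \<sigma>] by blast
qed (simp_all add: comp_assoc)

sublocale gal: group "galois_group i"
  by (rule group_G)

lemma inv_G_apply:
  "\<sigma> \<in> carrier G \<Longrightarrow> \<sigma> ((inv\<^bsub>G\<^esub> \<sigma>) z) = z" "\<sigma> \<in> carrier G \<Longrightarrow> (inv\<^bsub>G\<^esub> \<sigma>) (\<sigma> z) = z"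
  using gal.r_inv[of \<sigma>] gal.l_inv[of \<sigma>] by (simp_all add: fun_eq_iff)

lemma nat_pow_G: "\<sigma> [^]\<^bsub>G\<^esub> (n::nat) = \<sigma> ^^ n"
  by (induction n) (simp_all add: funpow_Suc_right del: funpow.simps(2))

definition orb :: "'b \<Rightarrow> 'b set" where "orb z = (\<lambda>\<sigma>. \<sigma> z) ` carrier G"

lemma orb_refl: "z \<in> orb z"
  using gal.one_closed by (auto simp: orb_def intro!: image_eqI[of _ _ id])

lemma orb_stable:
  assumes \<sigma>: "\<sigma> \<in> carrier G" and w: "w \<in> orb z"
  shows "\<sigma> w \<in> orb z"
proof -
  obtain \<tau> where \<tau>: "\<tau> \<in> carrier G" "w = \<tau> z" using w unfolding orb_def by blast
  have "(\<sigma> \<circ> \<tau>) z \<in> orb z" unfolding orb_def by (rule imageI) (rule comp_closed[OF \<sigma> \<tau>(1)])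
  then show ?thesis using \<tau>(2) by simp
qed

lemma orbE: "w \<in> orb z \<Longrightarrow> (\<And>\<sigma>. \<sigma> \<in> carrier G \<Longrightarrow> w = \<sigma> z \<Longrightarrow> thesis) \<Longrightarrow> thesis"
  unfolding orb_def by blast

lemma orbI: "\<sigma> \<in> carrier G \<Longrightarrow> \<sigma> z \<in> orb z"
  unfolding orb_def by blast

lemma finite_square_roots: "finite {x::'b. x * x = c}"
proof -
  obtain s where s: "s * s = c" using ex_sqrt by blast
  have "{x. x * x = c} \<subseteq> {s, - s}" by (auto simp: s[symmetric] square_eq_iff)
  then show ?thesis by (rule finite_subset) simp
qed

text \<open>Algebraicity without polynomials: a conjugate of a square root of \<open>y\<close> is a
  square root of a conjugate of \<open>y\<close>, so finiteness passes up the tower.\<close>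

lemma finite_orb: "finite (orb z)"
  using in_tower[of z]
proof induction
  case (base x)
  have "orb (i x) \<subseteq> {i x}" by (auto elim!: orbE simp: gal_simps(9))
  then show ?case by (rule finite_subset) simp
next
  case (add x y)
  have "orb (x + y) \<subseteq> (\<lambda>(u, v). u + v) ` (orb x \<times> orb y)"
    by (auto elim!: orbE intro!: image_eqI[of _ _ "(_ x, _ y)"] orbI simp: gal_simps(3))
  then show ?case by (rule finite_subset) (use add in simp)
next
  case (mult x y)
  have "orb (x * y) \<subseteq> (\<lambda>(u, v). u * v) ` (orb x \<times> orb y)"
    by (auto elim!: orbE intro!: image_eqI[of _ _ "(_ x, _ y)"] orbI simp: gal_simps(4))
  then show ?case by (rule finite_subset) (use mult in simp)
next
  case (neg x)
  have "orb (- x) \<subseteq> uminus ` orb x"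
    by (auto elim!: orbE intro!: image_eqI[OF _ orbI] simp: gal_simps(5))
  then show ?case by (rule finite_subset) (use neg in simp)
next
  case (inv x)
  have "orb (inverse x) \<subseteq> inverse ` orb x"
    by (auto elim!: orbE intro!: image_eqI[OF _ orbI] simp: gal_simps(7))
  then show ?case by (rule finite_subset) (use inv in simp)
next
  case (sqrt y x)
  have "orb x \<subseteq> (\<Union>c\<in>orb y. {w. w * w = c})"
  proof
    fix w assume "w \<in> orb x"
    then obtain \<sigma> where \<sigma>: "\<sigma> \<in> carrier G" "w = \<sigma> x" by (rule orbE)
    then have "w * w = \<sigma> y" using gal_simps(4)[OF \<sigma>(1), of x x] sqrt(2) by simp
    then show "w \<in> (\<Union>c\<in>orb y. {w. w * w = c})" using orbI[OF \<sigma>(1), of y] by blast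
  qed
  then show ?case by (rule finite_subset) (use sqrt finite_square_roots in simp)
qed

lemma funpow_closed: "\<sigma> \<in> carrier G \<Longrightarrow> \<sigma> ^^ n \<in> carrier G"
  using gal.nat_pow_closed[of \<sigma> n] by (simp add: nat_pow_G)

lemma funpow_two_power_mono:
  assumes "(\<sigma> ^^ (2 ^ m)) z = z" "m \<le> n"
  shows "(\<sigma> ^^ (2 ^ n)) z = z"
proof -
  obtain d where "n = m + d" using assms(2) le_Suc_ex by blast
  then have "(2::nat) ^ n = 2 ^ m * 2 ^ d" by (simp add: power_add)
  moreover have "((\<sigma> ^^ (2 ^ m)) ^^ k) z = z" for k
    by (induction k) (simp_all add: assms(1))
  ultimately show ?thesis by (simp add: funpow_mult mult.commute)
qed

text \<open>A power of \<open>\<sigma>\<close> that fixes \<open>y\<close> sends a square root of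
  \<open>y\<close> to itself or its negative, so doubling the exponent once more fixes it. The
  exponent is uniform in \<open>\<sigma>\<close>, which is what makes the finite quotients
  2-groups.\<close>

lemma two_power_exponent: "\<exists>m. \<forall>\<sigma>\<in>carrier G. (\<sigma> ^^ (2 ^ m)) z = z"
  using in_tower[of z]
proof induction
  case (base x)
  have "(\<sigma> ^^ n) (i x) = i x" if "\<sigma> \<in> carrier G" for \<sigma> n
    using funpow_closed[OF that] by (simp add: gal_simps)
  then show ?case by blast
next
  case (add x y)
  then obtain m n where m: "\<forall>\<sigma>\<in>carrier G. (\<sigma> ^^ (2 ^ m)) x = x" and n: "\<forall>\<sigma>\<in>carrier G. (\<sigma> ^^ (2 ^ n)) y = y"
    by blast
  have "(\<sigma> ^^ (2 ^ max m n)) (x + y) = x + y" if \<sigma>: "\<sigma> \<in> carrier G" for \<sigma>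
  proof -
    have "(\<sigma> ^^ (2 ^ max m n)) x = x" "(\<sigma> ^^ (2 ^ max m n)) y = y"
      using m n \<sigma> by (auto intro: funpow_two_power_mono[of m] funpow_two_power_mono[of n])
    then show ?thesis by (simp only: gal_simps(3)[OF funpow_closed[OF \<sigma>]])
  qed
  then show ?case by blast
next
  case (mult x y)
  then obtain m n where m: "\<forall>\<sigma>\<in>carrier G. (\<sigma> ^^ (2 ^ m)) x = x" and n: "\<forall>\<sigma>\<in>carrier G. (\<sigma> ^^ (2 ^ n)) y = y"
    by blast
  have "(\<sigma> ^^ (2 ^ max m n)) (x * y) = x * y" if \<sigma>: "\<sigma> \<in> carrier G" for \<sigma>
  proof -
    have "(\<sigma> ^^ (2 ^ max m n)) x = x" "(\<sigma> ^^ (2 ^ max m n)) y = y"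
      using m n \<sigma> by (auto intro: funpow_two_power_mono[of m] funpow_two_power_mono[of n])
    then show ?thesis by (simp only: gal_simps(4)[OF funpow_closed[OF \<sigma>]])
  qed
  then show ?case by blast
next
  case (neg x)
  then show ?case by (metis funpow_closed gal_simps(5))
next
  case (inv x)
  then show ?case by (metis funpow_closed gal_simps(7))
next
  case (sqrt y x)
  then obtain m where m: "\<forall>\<sigma>\<in>carrier G. (\<sigma> ^^ (2 ^ m)) y = y" by blast
  have "(\<sigma> ^^ (2 ^ Suc m)) x = x" if \<sigma>: "\<sigma> \<in> carrier G" for \<sigma>
  proof -
    let ?\<tau> = "\<sigma> ^^ (2 ^ m)"
    have \<tau>: "?\<tau> \<in> carrier G" using \<sigma> by (rule funpow_closed)
    have "?\<tau> x * ?\<tau> x = x * x" using m \<sigma> sqrt(2) gal_simps(4)[OF \<tau>, of x x] by simp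
    then have "?\<tau> x = x \<or> ?\<tau> x = - x" by (simp only: square_eq_iff)
    then have "?\<tau> (?\<tau> x) = x" by (auto simp: gal_simps[OF \<tau>])
    moreover have "\<sigma> ^^ (2 ^ Suc m) = ?\<tau> \<circ> ?\<tau>" by (simp add: mult_2 funpow_add)
    ultimately show ?thesis by simp
  qed
  then show ?case by blast
qed

definition stab :: "'b set \<Rightarrow> ('b \<Rightarrow> 'b) set" where
  "stab S = {\<sigma> \<in> carrier G. \<forall>z\<in>S. \<sigma> z = z}"

definition stable :: "'b set \<Rightarrow> bool" where
  "stable S \<longleftrightarrow> (\<forall>\<sigma>\<in>carrier G. \<forall>z\<in>S. \<sigma> z \<in> S)"

lemma stab_normal:
  assumes "stable S"
  shows "stab S \<lhd> G"
proof (rule gal.normal_invI)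
  show "subgroup (stab S) G"
  proof (rule gal.subgroupI)
    show "stab S \<noteq> {}" using gal.one_closed unfolding stab_def by force
    show "inv\<^bsub>G\<^esub> \<sigma> \<in> stab S" if "\<sigma> \<in> stab S" for \<sigma>
      using that unfolding stab_def by (auto, metis inv_G_apply(2))
  qed (auto simp: stab_def comp_closed)
  show "\<sigma> \<otimes>\<^bsub>G\<^esub> \<tau> \<otimes>\<^bsub>G\<^esub> inv\<^bsub>G\<^esub> \<sigma> \<in> stab S" if \<sigma>: "\<sigma> \<in> carrier G" and \<tau>: "\<tau> \<in> stab S" for \<sigma> \<tau>
  proof -
    have "\<tau> \<in> carrier G" using \<tau> by (simp add: stab_def)
    moreover have "(inv\<^bsub>G\<^esub> \<sigma>) z \<in> S" if "z \<in> S" for z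
      using assms \<sigma> that unfolding stable_def by blast
    ultimately show ?thesis
      using gal.m_closed[OF gal.m_closed[OF \<sigma>] gal.inv_closed[OF \<sigma>]] \<sigma> \<tau>
      by (auto simp: stab_def inv_G_apply(1)[OF \<sigma>])
  qed
qed

text \<open>The image of \<open>\<sigma>\<close> is determined by its self-map of the finite set
  \<open>S\<close>, whence finiteness. The maximum of the exponents belonging to the elements of
  \<open>S\<close> serves the whole quotient, whence the 2-power order.\<close>

lemma finite_quotient:
  assumes S: "finite S" "stable S"
  obtains Q :: "('b \<Rightarrow> 'b) set monoid" and \<phi> k where
    "group_hom G Q \<phi>" "carrier Q = \<phi> ` carrier G"
    "\<And>\<sigma>. \<sigma> \<in> carrier G \<Longrightarrow> \<phi> \<sigma> = \<one>\<^bsub>Q\<^esub> \<longleftrightarrow> \<sigma> \<in> stab S"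
    "\<And>\<sigma> \<tau>. \<sigma> \<in> carrier G \<Longrightarrow> \<tau> \<in> carrier G \<Longrightarrow> \<phi> \<sigma> = \<phi> \<tau> \<longleftrightarrow> (\<forall>z\<in>S. \<sigma> z = \<tau> z)"
    "finite (carrier Q)" "order Q = 2 ^ k"
proof -
  interpret N: normal "stab S" G by (rule stab_normal[OF S(2)])
  obtain Q :: "('b \<Rightarrow> 'b) set monoid" and \<phi> where \<phi>: "group_hom G Q \<phi>" "carrier Q = \<phi> ` carrier G"
    "\<And>x. x \<in> carrier G \<Longrightarrow> \<phi> x = \<one>\<^bsub>Q\<^esub> \<longleftrightarrow> x \<in> stab S"
    by (rule N.exists_quotient_hom) blast
  interpret h: group_hom G Q \<phi> by fact
  have eq: "\<phi> \<sigma> = \<phi> \<tau> \<longleftrightarrow> (\<forall>z\<in>S. \<sigma> z = \<tau> z)" if \<sigma>: "\<sigma> \<in> carrier G" and \<tau>: "\<tau> \<in> carrier G" for \<sigma> \<tau>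
  proof -
    define \<rho> where "\<rho> = inv\<^bsub>G\<^esub> \<tau> \<otimes>\<^bsub>G\<^esub> \<sigma>"
    have \<rho>: "\<rho> \<in> carrier G" unfolding \<rho>_def by (rule gal.m_closed[OF gal.inv_closed[OF \<tau>] \<sigma>])
    have \<phi>\<rho>: "\<phi> \<rho> = inv\<^bsub>Q\<^esub> \<phi> \<tau> \<otimes>\<^bsub>Q\<^esub> \<phi> \<sigma>"
      unfolding \<rho>_def by (simp only: h.hom_mult[OF gal.inv_closed[OF \<tau>] \<sigma>] h.hom_inv[OF \<tau>])
    have stab: "\<rho> \<in> stab S \<longleftrightarrow> (\<forall>z\<in>S. \<sigma> z = \<tau> z)"
    proof -
      have \<tau>\<rho>: "\<tau> (\<rho> z) = \<sigma> z" for z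
        unfolding \<rho>_def mult_G comp_apply by (rule inv_G_apply(1)[OF \<tau>])
      have "\<rho> z = z \<longleftrightarrow> \<sigma> z = \<tau> z" for z
        using gal_simps(10)[OF \<tau>, of "\<rho> z" z] by (simp only: \<tau>\<rho>)
      then show ?thesis using \<rho> unfolding stab_def by blast
    qed
    show ?thesis
    proof
      assume "\<phi> \<sigma> = \<phi> \<tau>"
      then have "\<phi> \<rho> = \<one>\<^bsub>Q\<^esub>" unfolding \<phi>\<rho> using h.H.l_inv[OF h.hom_closed[OF \<tau>]] by simp
      then show "\<forall>z\<in>S. \<sigma> z = \<tau> z" using \<phi>(3)[OF \<rho>] stab by simp
    next
      assume "\<forall>z\<in>S. \<sigma> z = \<tau> z"
      then have "inv\<^bsub>Q\<^esub> \<phi> \<tau> \<otimes>\<^bsub>Q\<^esub> \<phi> \<sigma> = \<one>\<^bsub>Q\<^esub>" using \<phi>(3)[OF \<rho>] stab \<phi>\<rho> by simp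
      then show "\<phi> \<sigma> = \<phi> \<tau>"
        using h.H.cancel_left_inv(1)[OF h.hom_closed[OF \<tau>] h.hom_closed[OF \<sigma>]] h.hom_closed[OF \<tau>] by simp
    qed
  qed
  let ?r = "\<lambda>\<sigma>. restrict \<sigma> S"
  have "?r ` carrier G \<subseteq> PiE S (\<lambda>_. S)" using S(2) by (auto simp: stable_def)
  then have fin: "finite (?r ` carrier G)" using S(1) finite_PiE[of S "\<lambda>_. S"] finite_subset by blast
  have "\<phi> \<sigma> = \<phi> \<tau>" if "\<sigma> \<in> carrier G" "\<tau> \<in> carrier G" and r: "?r \<sigma> = ?r \<tau>" for \<sigma> \<tau>
  proof -
    have "\<sigma> z = \<tau> z" if "z \<in> S" for z using fun_cong[OF r, of z] that by simp
    then show ?thesis using eq[OF \<open>\<sigma> \<in> carrier G\<close> \<open>\<tau> \<in> carrier G\<close>] by blast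
  qed
  then have finQ: "finite (carrier Q)"
    unfolding \<phi>(2) by (rule finite_image_determined[OF fin])
  obtain m where m0: "\<forall>z. \<forall>\<sigma>\<in>carrier G. (\<sigma> ^^ (2 ^ m z)) z = z"
    using choice[OF allI[OF two_power_exponent]] by (rule exE)
  have m: "(\<sigma> ^^ (2 ^ m z)) z = z" if "\<sigma> \<in> carrier G" for z \<sigma>
    using m0 that by blast
  obtain M where M: "\<forall>n\<in>m ` S. n \<le> M"
    using finite_nat_set_iff_bounded_le[THEN iffD1, OF finite_imageI[OF S(1), of m]] by (rule exE)
  have "q [^]\<^bsub>Q\<^esub> ((2::nat) ^ M) = \<one>\<^bsub>Q\<^esub>" if q: "q \<in> carrier Q" for q
  proof -
    obtain \<sigma> where \<sigma>: "q = \<phi> \<sigma>" "\<sigma> \<in> carrier G" using q unfolding \<phi>(2) by (rule imageE)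
    have fixS: "(\<sigma> ^^ (2 ^ M)) z = z" if "z \<in> S" for z
    proof (rule funpow_two_power_mono[OF m[OF \<sigma>(2)]])
      show "m z \<le> M" using M that by blast
    qed
    have pc: "\<sigma> ^^ (2 ^ M) \<in> carrier G" by (rule funpow_closed[OF \<sigma>(2)])
    then have "\<sigma> ^^ (2 ^ M) \<in> stab S" using fixS unfolding stab_def by blast
    then have "\<phi> (\<sigma> [^]\<^bsub>G\<^esub> ((2::nat) ^ M)) = \<one>\<^bsub>Q\<^esub>"
      using \<phi>(3)[OF pc] by (simp only: nat_pow_G)
    then show ?thesis unfolding \<sigma>(1) h.hom_nat_pow[OF \<sigma>(2)] .
  qed
  from h.H.two_power_order[OF finQ this] obtain k where k: "order Q = 2 ^ k" by (rule exE)
  show ?thesis by (rule that[OF \<phi> eq finQ k])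
qed

section \<open>Kummer characters of the base field\<close>

definition sq :: "'a \<Rightarrow> 'b" where "sq a = (SOME s. s * s = i a)"

text \<open>Although \<open>sq a\<close> is an arbitrary choice of root, the character does not
  depend on it: by \<open>chi_apply\<close> it describes the action on every square root of
  \<open>i a\<close>.\<close>

definition chi :: "'a \<Rightarrow> ('b \<Rightarrow> 'b) \<Rightarrow> bit" where
  "chi a \<sigma> = (if \<sigma> (sq a) = sq a then 0 else 1)"

definition eps :: "bit \<Rightarrow> 'b" where "eps b = (if b = 0 then 1 else - 1)"

lemma sq_square: "sq a * sq a = i a"
  unfolding sq_def using ex_sqrt by (rule someI_ex)

lemma eps_simps [simp]: "eps 0 = 1" "eps 1 = - 1" "eps (b + c) = eps b * eps c" "eps b * eps b = 1"
  using bit_cases[of b] bit_cases[of c] by (auto simp: eps_def)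

lemma eps_inject: "x \<noteq> 0 \<Longrightarrow> eps b * x = eps c * x \<longleftrightarrow> b = c"
  using bit_cases[of b] bit_cases[of c] neq_minus[of 1] by (auto simp: eps_def)

lemma gal_eps [simp]: "\<sigma> \<in> carrier G \<Longrightarrow> \<sigma> (eps b) = eps b"
  by (simp add: eps_def gal_simps)

lemma chi_apply:
  assumes \<sigma>: "\<sigma> \<in> carrier G" and s: "s * s = i a"
  shows "\<sigma> s = eps (chi a \<sigma>) * s"
proof -
  have sq: "\<sigma> (sq a) = eps (chi a \<sigma>) * sq a"
  proof -
    have "\<sigma> (sq a) * \<sigma> (sq a) = sq a * sq a"
      using sq_square[of a] gal_simps(4)[OF \<sigma>, of "sq a" "sq a"] by (simp add: gal_simps(9)[OF \<sigma>])
    then show ?thesis by (auto simp: square_eq_iff chi_def)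
  qed
  have "s = sq a \<or> s = - sq a" using s sq_square[of a] square_eq_iff[of s "sq a"] by simp
  then show ?thesis using sq by (auto simp: gal_simps[OF \<sigma>])
qed

lemma chi_eqI:
  assumes "\<sigma> \<in> carrier G" "s * s = i a" "a \<noteq> 0" "\<sigma> s = eps c * s"
  shows "chi a \<sigma> = c"
proof -
  have "s \<noteq> 0" using assms(2,3) by auto
  moreover have "eps (chi a \<sigma>) * s = eps c * s"
    using chi_apply[OF assms(1,2)] assms(4) by (rule subst)
  ultimately show ?thesis using eps_inject by blast
qed

lemma sq_nonzero: "a \<noteq> 0 \<Longrightarrow> sq a \<noteq> 0"
  using sq_square[of a] by auto

lemma chi_hom:
  assumes "\<sigma> \<in> carrier G" "\<tau> \<in> carrier G" "a \<noteq> 0"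
  shows "chi a (\<sigma> \<circ> \<tau>) = chi a \<sigma> + chi a \<tau>"
proof (rule chi_eqI)
  show "\<sigma> \<circ> \<tau> \<in> carrier G" using gal.m_closed[OF assms(1,2)] by simp
  show "sq a * sq a = i a" by (rule sq_square)
  show "(\<sigma> \<circ> \<tau>) (sq a) = eps (chi a \<sigma> + chi a \<tau>) * sq a"
    using chi_apply[OF assms(1) sq_square[of a]] chi_apply[OF assms(2) sq_square[of a]]
    by (simp add: gal_simps(4)[OF assms(1)] gal_eps[OF assms(1)] del: add_bit_eq_xor)
qed fact

lemma chi_mult:
  assumes "\<sigma> \<in> carrier G" "a \<noteq> 0" "b \<noteq> 0"
  shows "chi (a * b) \<sigma> = chi a \<sigma> + chi b \<sigma>"
proof (rule chi_eqI)
  show "(sq a * sq b) * (sq a * sq b) = i (a * b)"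
    using sq_square[of a] sq_square[of b] by (simp add: ac_simps)
  show "\<sigma> (sq a * sq b) = eps (chi a \<sigma> + chi b \<sigma>) * (sq a * sq b)"
    by (simp add: gal_simps(4)[OF assms(1)] chi_apply[OF assms(1) sq_square] ac_simps del: add_bit_eq_xor)
qed (use assms in auto)

lemma chi_square:
  assumes "\<sigma> \<in> carrier G" "a \<noteq> 0"
  shows "chi (a ^ 2) \<sigma> = 0"
  using assms by (intro chi_eqI[of \<sigma> "i a"]) (auto simp: power2_eq_square gal_simps)

lemma stab_subset: "stab S \<subseteq> carrier G"
  by (auto simp: stab_def)

text \<open>Linear independence of the elements of the finite quotient provides an eigenvector
  for the character; its square lies in the base field.\<close>

lemma kummer_character:
  fixes \<chi> :: "('b \<Rightarrow> 'b) \<Rightarrow> bit"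
  assumes S: "finite S" "stable S"
    and hom: "\<And>\<sigma> \<tau>. \<sigma> \<in> carrier G \<Longrightarrow> \<tau> \<in> carrier G \<Longrightarrow> \<chi> (\<sigma> \<circ> \<tau>) = \<chi> \<sigma> + \<chi> \<tau>"
    and ker: "\<And>\<sigma>. \<sigma> \<in> stab S \<Longrightarrow> \<chi> \<sigma> = 0"
  shows "\<exists>a. a \<noteq> 0 \<and> (\<forall>\<sigma>\<in>carrier G. \<chi> \<sigma> = chi a \<sigma>)"
proof -
  define L where "L = {z. \<forall>\<sigma>\<in>stab S. \<sigma> z = z}"
  define R where "R = (\<lambda>\<sigma>. restrict \<sigma> L) ` carrier G"
  define c where "c r = eps (\<chi> (SOME \<sigma>. \<sigma> \<in> carrier G \<and> r = restrict \<sigma> L))" for r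
  have SL: "S \<subseteq> L" unfolding L_def stab_def by blast
  \<comment> \<open>Automorphisms that agree on \<open>S\<close> differ by an element of
    \<open>stab S\<close>, which fixes \<open>L\<close> and is killed by \<open>\<chi>\<close>.
    Hence the coefficient \<open>c\<close>, defined through a choice, is well determined.\<close>
  have agree: "restrict \<sigma> L = restrict \<tau> L \<and> \<chi> \<sigma> = \<chi> \<tau>"
    if \<sigma>: "\<sigma> \<in> carrier G" and \<tau>: "\<tau> \<in> carrier G" and eq: "\<And>z. z \<in> S \<Longrightarrow> \<sigma> z = \<tau> z" for \<sigma> \<tau>
  proof -
    define \<rho> where "\<rho> = inv\<^bsub>G\<^esub> \<tau> \<circ> \<sigma>"
    have \<rho>: "\<rho> \<in> carrier G" unfolding \<rho>_def by (rule comp_closed[OF gal.inv_closed[OF \<tau>] \<sigma>])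
    have \<tau>\<rho>: "\<tau> \<circ> \<rho> = \<sigma>" unfolding \<rho>_def by (rule ext) (simp only: comp_apply inv_G_apply(1)[OF \<tau>])
    have "\<rho> z = z" if "z \<in> S" for z
      unfolding \<rho>_def comp_apply eq[OF that] by (rule inv_G_apply(2)[OF \<tau>])
    then have st: "\<rho> \<in> stab S" using \<rho> unfolding stab_def by blast
    have "\<sigma> z = \<tau> z" if "z \<in> L" for z
    proof -
      have "\<rho> z = z" using st that unfolding L_def by blast
      then show ?thesis using fun_cong[OF \<tau>\<rho>, of z] by (simp only: comp_apply)
    qed
    then have "restrict \<sigma> L = restrict \<tau> L" by (rule restrict_ext)
    moreover have "\<chi> \<sigma> = \<chi> \<tau>" using hom[OF \<tau> \<rho>] ker[OF st] unfolding \<tau>\<rho> by simp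
    ultimately show ?thesis by blast
  qed
  have L_eq: "\<And>z. z \<in> S \<Longrightarrow> \<sigma> z = \<tau> z" if "restrict \<sigma> L = restrict \<tau> L" for \<sigma> \<tau>
    using fun_cong[OF that] SL by (metis restrict_apply' subsetD)
  have c: "c (restrict \<sigma> L) = eps (\<chi> \<sigma>)" if \<sigma>: "\<sigma> \<in> carrier G" for \<sigma>
  proof -
    define \<tau> where "\<tau> = (SOME \<tau>. \<tau> \<in> carrier G \<and> restrict \<sigma> L = restrict \<tau> L)"
    have "\<tau> \<in> carrier G \<and> restrict \<sigma> L = restrict \<tau> L"
      unfolding \<tau>_def by (rule someI[of _ \<sigma>]) (use \<sigma> in blast)
    then have "\<chi> \<sigma> = \<chi> \<tau>" using agree[OF \<sigma>] L_eq by blast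
    then show ?thesis unfolding c_def \<tau>_def by simp
  qed
  have Lmult: "x * y \<in> L" if "x \<in> L" "y \<in> L" for x y
  proof -
    have "\<sigma> (x * y) = x * y" if "\<sigma> \<in> stab S" for \<sigma>
    proof -
      have "\<sigma> \<in> carrier G" "\<sigma> x = x" "\<sigma> y = y"
        using that \<open>x \<in> L\<close> \<open>y \<in> L\<close> unfolding L_def stab_def by blast+
      then show ?thesis using gal_simps(4)[of \<sigma> x y] by simp
    qed
    then show ?thesis unfolding L_def by blast
  qed
  have L1: "1 \<in> L" using gal_simps(2) unfolding L_def stab_def by blast
  have Lstable: "\<sigma> z \<in> L" if \<sigma>: "\<sigma> \<in> carrier G" and z: "z \<in> L" for \<sigma> z
  proof -
    have "\<tau> (\<sigma> z) = \<sigma> z" if \<tau>: "\<tau> \<in> stab S" for \<tau>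
    proof -
      have "inv\<^bsub>G\<^esub> \<sigma> \<otimes>\<^bsub>G\<^esub> \<tau> \<otimes>\<^bsub>G\<^esub> \<sigma> \<in> stab S"
        using normal.inv_op_closed1[OF stab_normal[OF S(2)] \<sigma> \<tau>] .
      then have "(inv\<^bsub>G\<^esub> \<sigma>) (\<tau> (\<sigma> z)) = z" using z unfolding L_def mult_G by force
      then show ?thesis using inv_G_apply(1)[OF \<sigma>, of "\<tau> (\<sigma> z)"] by simp
    qed
    then show ?thesis unfolding L_def by blast
  qed
  have "(\<lambda>\<sigma>. restrict \<sigma> S) ` carrier G \<subseteq> PiE S (\<lambda>_. S)"
    using S(2) unfolding stable_def by auto
  then have finS: "finite ((\<lambda>\<sigma>. restrict \<sigma> S) ` carrier G)"
    by (rule finite_subset[OF _ finite_PiE[OF S(1) S(1)]])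
  have finR: "finite R"
    unfolding R_def
  proof (rule finite_image_determined[OF finS])
    fix \<sigma> \<tau> assume \<sigma>: "\<sigma> \<in> carrier G" and \<tau>: "\<tau> \<in> carrier G" and r: "restrict \<sigma> S = restrict \<tau> S"
    have "\<sigma> z = \<tau> z" if "z \<in> S" for z using fun_cong[OF r, of z] that by simp
    then show "restrict \<sigma> L = restrict \<tau> L" using agree[OF \<sigma> \<tau>] by blast
  qed
  \<comment> \<open>If the sum vanished on all of \<open>L\<close>, independence would kill every
    coefficient, but they are all \<open>1\<close> or \<open>- 1\<close>.\<close>
  have "\<exists>z\<in>L. (\<Sum>r\<in>R. c r * r z) \<noteq> 0"
  proof (rule ccontr)
    assume "\<not> ?thesis"
    then have zero: "(\<Sum>r\<in>R. c r * r z) = 0" if "z \<in> L" for z using that by blast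
    have "id \<in> carrier G" using gal.one_closed unfolding one_G .
    then have idR: "restrict id L \<in> R" unfolding R_def by blast
    have "c (restrict id L) = 0"
    proof (rule dedekind_independence[where R = R and L = L and m = "(*)" and r = "\<lambda>r. r"
          and c = c and j = "restrict id L", OF finR])
      fix j x y assume "j \<in> R" "x \<in> L" "y \<in> L"
      then show "x * y \<in> L \<and> j (x * y) = j x * j y"
        using Lmult gal_simps(4) unfolding R_def by auto
    next
      fix j k assume j: "j \<in> R" and k: "k \<in> R" and jk: "j \<noteq> k"
      obtain \<sigma> \<tau> where "j = restrict \<sigma> L" "k = restrict \<tau> L" using j k unfolding R_def by blast
      then show "\<exists>z\<in>L. j z \<noteq> k z" using jk by (metis restrict_apply' restrict_ext)
    next
      fix j assume "j \<in> R"
      then have "j 1 = 1" unfolding R_def using L1 gal_simps(2) by auto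
      then show "\<exists>z\<in>L. j z \<noteq> 0" using L1 by (intro bexI[of _ 1]) simp_all
    next
      show "(\<Sum>j\<in>R. c j * j z) = 0" if "z \<in> L" for z by (rule zero[OF that])
      show "restrict id L \<in> R" by (rule idR)
    qed
    then show False using c[OF \<open>id \<in> carrier G\<close>] bit_cases[of "\<chi> id"] by (auto simp: eps_def)
  qed
  then obtain z where z: "z \<in> L" "(\<Sum>r\<in>R. c r * r z) \<noteq> 0" by (elim bexE)
  \<comment> \<open>A Lagrange resolvent: composing with \<open>\<rho>\<close> permutes
    \<open>R\<close> and changes the coefficients by the common sign
    \<open>eps (\<chi> \<rho>)\<close>.\<close>
  define y where "y = (\<Sum>r\<in>R. c r * r z)"
  have y: "\<rho> y = eps (\<chi> \<rho>) * y" if \<rho>: "\<rho> \<in> carrier G" for \<rho>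
  proof -
    define f where "f r = restrict (\<rho> \<circ> r) L" for r
    have f: "f (restrict \<sigma> L) = restrict (\<rho> \<circ> \<sigma>) L" for \<sigma>
      unfolding f_def by (rule restrict_ext) simp
    have inj: "inj_on f R"
    proof (rule inj_onI)
      fix r s assume r: "r \<in> R" and s: "s \<in> R" and eq: "f r = f s"
      obtain \<sigma> \<tau> where \<sigma>\<tau>: "r = restrict \<sigma> L" "s = restrict \<tau> L" using r s unfolding R_def by blast
      have "\<sigma> w = \<tau> w" if "w \<in> L" for w
        using fun_cong[OF eq[unfolded \<sigma>\<tau> f], of w] that gal_simps(10)[OF \<rho>] by simp
      then show "r = s" unfolding \<sigma>\<tau> by (rule restrict_ext)
    qed
    have "f ` R \<subseteq> R"
    proof
      fix s assume "s \<in> f ` R"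
      then obtain \<sigma> where "\<sigma> \<in> carrier G" "s = f (restrict \<sigma> L)" unfolding R_def by blast
      then show "s \<in> R" unfolding f R_def using comp_closed[OF \<rho>] by blast
    qed
    then have fR: "f ` R = R" by (rule endo_inj_surj[OF finR _ inj])
    have summand: "\<rho> (c r * r z) = eps (\<chi> \<rho>) * (c (f r) * f r z)" if r: "r \<in> R" for r
    proof -
      obtain \<sigma> where \<sigma>: "\<sigma> \<in> carrier G" "r = restrict \<sigma> L" using r unfolding R_def by blast
      have cf: "c (f r) = eps (\<chi> \<rho>) * eps (\<chi> \<sigma>)"
        unfolding \<sigma>(2) f c[OF comp_closed[OF \<rho> \<sigma>(1)]] hom[OF \<rho> \<sigma>(1)] by (rule eps_simps(3))
      have fz: "f r z = \<rho> (r z)" unfolding \<sigma>(2) f using z(1) by (simp only: restrict_apply' comp_apply)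
      have cr: "c r = eps (\<chi> \<sigma>)" unfolding \<sigma>(2) by (rule c[OF \<sigma>(1)])
      have "\<rho> (c r * r z) = eps (\<chi> \<sigma>) * \<rho> (r z)"
        unfolding cr by (simp only: gal_simps(4)[OF \<rho>] gal_eps[OF \<rho>])
      also have "\<dots> = (eps (\<chi> \<rho>) * eps (\<chi> \<rho>)) * (eps (\<chi> \<sigma>) * \<rho> (r z))"
        unfolding eps_simps(4) by (simp only: mult_1_left)
      also have "\<dots> = eps (\<chi> \<rho>) * (c (f r) * f r z)"
        unfolding cf fz by (simp only: mult.assoc)
      finally show ?thesis .
    qed
    have sum: "\<rho> (\<Sum>r\<in>A. g r) = (\<Sum>r\<in>A. \<rho> (g r))" for A and g :: "('b \<Rightarrow> 'b) \<Rightarrow> 'b"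
      by (induction A rule: infinite_finite_induct) (simp_all add: gal_simps(1,3)[OF \<rho>])
    have "\<rho> y = (\<Sum>r\<in>R. eps (\<chi> \<rho>) * (c (f r) * f r z))"
      unfolding y_def sum by (rule sum.cong[OF refl summand])
    also have "\<dots> = eps (\<chi> \<rho>) * (\<Sum>r\<in>R. c (f r) * f r z)" by (simp only: sum_distrib_left)
    also have "(\<Sum>r\<in>R. c (f r) * f r z) = (\<Sum>r\<in>f ` R. c r * r z)"
      using sum.reindex[OF inj, of "\<lambda>r. c r * r z"] by (simp only: comp_def)
    finally show ?thesis unfolding fR y_def .
  qed
  have "\<rho> (y * y) = y * y" if "\<rho> \<in> carrier G" for \<rho>
    unfolding gal_simps(4)[OF that] y[OF that]
    using bit_cases[of "\<chi> \<rho>"] by (auto simp: eps_def)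
  then have "y * y \<in> range i" by (rule fixed_field)
  then obtain a where a: "y * y = i a" by blast
  have "y \<noteq> 0" using z(2) unfolding y_def .
  then have "a \<noteq> 0" using a by auto
  moreover have "\<chi> \<sigma> = chi a \<sigma>" if "\<sigma> \<in> carrier G" for \<sigma>
    using chi_eqI[OF that a \<open>a \<noteq> 0\<close> y[OF that]] by simp
  ultimately show ?thesis by blast
qed

section \<open>Continuity of abstract characters\<close>

text \<open>The common kernel of the Kummer characters; for the Krull topology this is the Frattini
  subgroup of the Galois group.\<close>

definition Frat :: "('b \<Rightarrow> 'b) set" where
  "Frat = {\<sigma> \<in> carrier G. \<forall>a. a \<noteq> 0 \<longrightarrow> chi a \<sigma> = 0}"

text \<open>If the image were not a product of squares, some quadratic character of \<open>Q\<close>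
  would detect it. Pulled back to the Galois group, that character is a Kummer character and so
  vanishes on \<open>Frat\<close>.\<close>

lemma Frat_quotient_squares:
  assumes S: "finite S" "stable S" and \<sigma>: "\<sigma> \<in> Frat"
    and \<phi>: "group_hom G Q \<phi>" "carrier Q = \<phi> ` carrier G"
    "\<And>\<sigma>. \<sigma> \<in> carrier G \<Longrightarrow> \<phi> \<sigma> = \<one>\<^bsub>Q\<^esub> \<longleftrightarrow> \<sigma> \<in> stab S" and fin: "finite (carrier Q)"
  shows "\<phi> \<sigma> \<in> lower_series Q (Suc 0)"
proof (rule ccontr)
  interpret h: group_hom G Q \<phi> by fact
  assume no: "\<phi> \<sigma> \<notin> lower_series Q (Suc 0)"
  have \<sigma>c: "\<sigma> \<in> carrier G" using \<sigma> unfolding Frat_def by blast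
  obtain \<chi> :: "_ \<Rightarrow> bit" where \<chi>: "\<forall>x\<in>carrier Q. \<forall>y\<in>carrier Q. \<chi> (x \<otimes>\<^bsub>Q\<^esub> y) = \<chi> x + \<chi> y" "\<chi> (\<phi> \<sigma>) = 1"
    using h.H.exists_quadratic_character[OF fin h.hom_closed[OF \<sigma>c] no] by blast
  have hom: "(\<chi> \<circ> \<phi>) (\<tau> \<circ> \<rho>) = (\<chi> \<circ> \<phi>) \<tau> + (\<chi> \<circ> \<phi>) \<rho>" if "\<tau> \<in> carrier G" "\<rho> \<in> carrier G" for \<tau> \<rho>
    using \<chi>(1) h.hom_closed[OF that(1)] h.hom_closed[OF that(2)] h.hom_mult[OF that]
    unfolding comp_apply mult_G by metis
  have "\<chi> \<one>\<^bsub>Q\<^esub> = \<chi> \<one>\<^bsub>Q\<^esub> + \<chi> \<one>\<^bsub>Q\<^esub>" using \<chi>(1) h.H.one_closed h.H.l_one[OF h.H.one_closed] by metis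
  then have "\<chi> \<one>\<^bsub>Q\<^esub> = 0" using bit_cases[of "\<chi> \<one>\<^bsub>Q\<^esub>"] by auto
  then have ker: "(\<chi> \<circ> \<phi>) \<tau> = 0" if "\<tau> \<in> stab S" for \<tau>
    using \<phi>(3)[of \<tau>] that stab_subset[of S] by auto
  obtain a where a: "a \<noteq> 0" "\<forall>\<tau>\<in>carrier G. (\<chi> \<circ> \<phi>) \<tau> = chi a \<tau>"
    using kummer_character[OF S hom ker] by blast
  then have "chi a \<sigma> = 1" using \<chi>(2) \<sigma>c by (metis comp_apply)
  moreover have "chi a \<sigma> = 0" using \<sigma> a(1) unfolding Frat_def by blast
  ultimately show False by simp
qed

text \<open>The representatives \<open>rs\<close> modulo \<open>Frat\<close> are fixed before
  \<open>S\<close>. Their images represent each finite quotient modulo its first term, because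
  \<open>Frat\<close> maps into that term, so one word length works for every
  \<open>S\<close>.\<close>

lemma square_word_approx:
  assumes rs: "set rs \<subseteq> carrier G"
    and cover: "\<And>\<tau>. \<tau> \<in> carrier G \<Longrightarrow> \<exists>k<length rs. inv\<^bsub>G\<^esub> (rs ! k) \<circ> \<tau> \<in> Frat"
    and \<sigma>: "\<sigma> \<in> Frat" and S: "finite S"
  shows "\<exists>ys. length ys = 2 * length rs \<and> set ys \<subseteq> carrier G \<and> (\<forall>z\<in>S. square_word G ys z = \<sigma> z)"
proof -
  define S' where "S' = (\<Union>z\<in>S. orb z)"
  have fin': "finite S'" unfolding S'_def using S finite_orb by (rule finite_UN_I)
  have st': "stable S'" unfolding stable_def S'_def using orb_stable by blast
  have \<sigma>c: "\<sigma> \<in> carrier G" using \<sigma> unfolding Frat_def by blast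
  obtain Q :: "('b \<Rightarrow> 'b) set monoid" and \<phi> k where \<phi>: "group_hom G Q \<phi>" "carrier Q = \<phi> ` carrier G"
    "\<And>\<sigma>. \<sigma> \<in> carrier G \<Longrightarrow> \<phi> \<sigma> = \<one>\<^bsub>Q\<^esub> \<longleftrightarrow> \<sigma> \<in> stab S'"
    and eq: "\<And>\<sigma> \<tau>. \<sigma> \<in> carrier G \<Longrightarrow> \<tau> \<in> carrier G \<Longrightarrow> \<phi> \<sigma> = \<phi> \<tau> \<longleftrightarrow> (\<forall>z\<in>S'. \<sigma> z = \<tau> z)"
    and finQ: "finite (carrier Q)" and ord: "order Q = 2 ^ k"
    by (rule finite_quotient[OF fin' st'], rule that)
  interpret h: group_hom G Q \<phi> by fact
  note low = Frat_quotient_squares[OF fin' st' _ \<phi> finQ]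
  obtain c where c: "lower_series Q c = {\<one>\<^bsub>Q\<^esub>}" using h.H.two_group_lower_series_trivial[OF ord] by blast
  have "\<exists>zs. length zs = 2 * length (map \<phi> rs) \<and> set zs \<subseteq> carrier Q \<and> square_word Q zs = \<phi> \<sigma>"
  proof (rule h.H.square_word_of_bounded_length[OF _ _ c low[OF \<sigma>]])
    show "set (map \<phi> rs) \<subseteq> carrier Q" using rs h.hom_closed by auto
    fix q assume "q \<in> carrier Q"
    then obtain \<tau> where \<tau>: "\<tau> \<in> carrier G" "q = \<phi> \<tau>" unfolding \<phi>(2) by blast
    obtain l where l: "l < length rs" "inv\<^bsub>G\<^esub> (rs ! l) \<circ> \<tau> \<in> Frat" using cover[OF \<tau>(1)] by blast
    have rl: "rs ! l \<in> carrier G" using rs l(1) nth_mem by blast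
    have "\<phi> (inv\<^bsub>G\<^esub> (rs ! l) \<otimes>\<^bsub>G\<^esub> \<tau>) = inv\<^bsub>Q\<^esub> (\<phi> (rs ! l)) \<otimes>\<^bsub>Q\<^esub> q"
      unfolding \<tau>(2) h.hom_mult[OF gal.inv_closed[OF rl] \<tau>(1)] h.hom_inv[OF rl] by (rule refl)
    then have "inv\<^bsub>Q\<^esub> (map \<phi> rs ! l) \<otimes>\<^bsub>Q\<^esub> q \<in> lower_series Q (Suc 0)"
      using low[OF l(2)] l(1) unfolding mult_G by simp
    then show "\<exists>l<length (map \<phi> rs). inv\<^bsub>Q\<^esub> (map \<phi> rs ! l) \<otimes>\<^bsub>Q\<^esub> q \<in> lower_series Q (Suc 0)"
      using l(1) by (intro exI[of _ l]) simp
  qed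
  then obtain zs where zs: "length zs = 2 * length rs" "set zs \<subseteq> carrier Q" "square_word Q zs = \<phi> \<sigma>"
    unfolding length_map by (elim exE conjE)
  define rep where "rep q = (SOME \<tau>. \<tau> \<in> carrier G \<and> \<phi> \<tau> = q)" for q
  have rep: "rep q \<in> carrier G \<and> \<phi> (rep q) = q" if "q \<in> carrier Q" for q
  proof -
    have "\<exists>\<tau>. \<tau> \<in> carrier G \<and> \<phi> \<tau> = q" using that unfolding \<phi>(2) by blast
    then show ?thesis unfolding rep_def by (rule someI_ex)
  qed
  let ?ys = "map rep zs"
  have ysc: "set ?ys \<subseteq> carrier G" unfolding set_map using rep zs(2) by blast
  have "map \<phi> ?ys = zs"
    unfolding map_map
  proof (rule map_idI)
    fix q assume "q \<in> set zs"
    then have "q \<in> carrier Q" using zs(2) by blast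
    then show "(\<phi> \<circ> rep) q = q" using rep by simp
  qed
  then have "\<phi> (square_word G ?ys) = \<phi> \<sigma>"
    unfolding h.hom_square_word[OF ysc] using zs(3) by simp
  then have "\<forall>z\<in>S'. square_word G ?ys z = \<sigma> z"
    using eq[OF gal.square_word_closed[OF ysc] \<sigma>c] by blast
  moreover have "S \<subseteq> S'" unfolding S'_def using orb_refl by blast
  ultimately show ?thesis using ysc zs(1) by (intro exI[of _ ?ys]) auto
qed

text \<open>Evaluating a composite at \<open>w\<close> also visits images of \<open>w\<close>, so
  agreement is required on a set \<open>B\<close> that the factors preserve.\<close>

lemma square_word_cong:
  assumes "list_all2 (\<lambda>f g. \<forall>w\<in>B. f w = g w \<and> g w \<in> B) fs gs" "w \<in> B"
  shows "square_word G fs w = square_word G gs w \<and> square_word G gs w \<in> B"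
  using assms(1)
proof (induction rule: list_all2_induct)
  case Nil
  then show ?case using assms(2) by (simp add: square_word_def)
next
  case (Cons f fs g gs)
  then show ?case by (simp add: square_word_def)
qed

text \<open>At each \<open>z\<close> the \<open>N\<close> factors take values in the finite orbit of
  \<open>z\<close>, so compactness yields a limiting tuple. Being a field automorphism over the base
  and having product \<open>\<sigma>\<close> can be tested on finite sets, and thus survive the
  limit.\<close>

lemma square_word_limit:
  assumes approx: "\<And>S. finite S \<Longrightarrow>
    \<exists>ys. length ys = N \<and> set ys \<subseteq> carrier G \<and> (\<forall>z\<in>S. square_word G ys z = \<sigma> z)"
  shows "\<exists>ys. length ys = N \<and> set ys \<subseteq> carrier G \<and> square_word G ys = \<sigma>"
proof -
  define A where "A z = {xs. set xs \<subseteq> orb z \<and> length xs = N}" for z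
  \<comment> \<open>The values on \<open>S\<close> must come from a single genuine tuple of
    automorphisms; this coherence is what transfers identities between several arguments to the
    limit.\<close>
  define P where "P S f \<longleftrightarrow> (\<exists>ys. length ys = N \<and> set ys \<subseteq> carrier G \<and>
      (\<forall>z\<in>S. f z = map (\<lambda>y. y z) ys) \<and> (\<forall>z\<in>S. square_word G ys z = \<sigma> z))"
    for S and f :: "'b \<Rightarrow> 'b list"
  have "\<exists>f. (\<forall>z. f z \<in> A z) \<and> (\<forall>S. finite S \<longrightarrow> P S f)"
  proof (rule finite_valued_compactness)
    show "finite (A z)" for z unfolding A_def by (rule finite_lists_length_eq[OF finite_orb])
    show "P S g" if "finite S" "P S f" "\<And>z. z \<in> S \<Longrightarrow> f z = g z" for S f g
      using that(2,3) unfolding P_def by metis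
    show "P S f" if "finite T" "S \<subseteq> T" "P T f" for S T f
      using that(2,3) unfolding P_def by blast
    fix S :: "'b set" assume "finite S"
    then obtain ys where ys: "length ys = N" "set ys \<subseteq> carrier G" "\<forall>z\<in>S. square_word G ys z = \<sigma> z"
      using approx by blast
    have "map (\<lambda>y. y z) ys \<in> A z" for z
      unfolding A_def using ys(1,2) orbI by auto
    moreover have "P S (\<lambda>z. map (\<lambda>y. y z) ys)" unfolding P_def using ys by blast
    ultimately show "\<exists>f. (\<forall>z. f z \<in> A z) \<and> P S f" by (intro exI[of _ "\<lambda>z. map (\<lambda>y. y z) ys"]) simp
  qed
  then obtain f where fA: "\<And>z. f z \<in> A z" and fP: "\<And>S. finite S \<Longrightarrow> P S f" by blast
  define y where "y k z = f z ! k" for k z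
  have loc: "\<exists>ys. length ys = N \<and> set ys \<subseteq> carrier G \<and> (\<forall>z\<in>S. \<forall>k<N. y k z = (ys ! k) z)
      \<and> (\<forall>z\<in>S. square_word G ys z = \<sigma> z)" if finS: "finite S" for S
  proof -
    obtain ys where ys: "length ys = N" "set ys \<subseteq> carrier G"
      "\<forall>z\<in>S. f z = map (\<lambda>y. y z) ys" "\<forall>z\<in>S. square_word G ys z = \<sigma> z"
      using fP[OF finS] unfolding P_def by blast
    have "\<forall>z\<in>S. \<forall>k<N. y k z = (ys ! k) z" using ys(1,3) by (simp add: y_def)
    then show ?thesis using ys(1,2,4) by blast
  qed
  have loc1: "\<exists>\<tau>\<in>carrier G. \<forall>z\<in>S. y k z = \<tau> z" if finS: "finite S" and k: "k < N" for S k
  proof -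
    obtain ys where ys: "length ys = N" "set ys \<subseteq> carrier G" "\<forall>z\<in>S. \<forall>k<N. y k z = (ys ! k) z"
      using loc[OF finS] by blast
    have "ys ! k \<in> carrier G" using ys(1,2) k nth_mem by blast
    then show ?thesis using ys(3) k by blast
  qed
  have yG: "y k \<in> carrier G" if k: "k < N" for k
  proof -
    have emb: "field_emb (y k)"
      unfolding field_emb_def
    proof (intro conjI allI)
      obtain \<tau> where "\<tau> \<in> carrier G" "y k 1 = \<tau> 1" using loc1[of "{1}" k] k by auto
      then show "y k 1 = 1" by (simp add: gal_simps)
      fix u v
      obtain \<tau> where "\<tau> \<in> carrier G" "\<forall>z\<in>{u, v, u + v, u * v}. y k z = \<tau> z"
        using loc1[of "{u, v, u + v, u * v}" k] k by auto
      then show "y k (u + v) = y k u + y k v" "y k (u * v) = y k u * y k v"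
        by (simp_all add: gal_simps)
    qed
    have fixed: "y k (i a) = i a" for a
    proof -
      obtain \<tau> where "\<tau> \<in> carrier G" "y k (i a) = \<tau> (i a)" using loc1[of "{i a}" k] k by auto
      then show ?thesis by (simp add: gal_simps)
    qed
    have inj: "inj (y k)" unfolding inj_def using field_emb_simps(10)[OF emb] by blast
    \<comment> \<open>The limiting factor maps the finite orbit of \<open>w\<close> injectively into
      itself, hence onto it.\<close>
    have "w \<in> range (y k)" for w
    proof -
      obtain \<tau> where \<tau>: "\<tau> \<in> carrier G" "\<forall>z\<in>orb w. y k z = \<tau> z"
        using loc1[OF finite_orb k] by blast
      have "y k ` orb w \<subseteq> orb w" using \<tau> orb_stable by auto
      then have "y k ` orb w = orb w"
        by (rule endo_inj_surj[OF finite_orb _ inj_on_subset[OF inj subset_UNIV]])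
      then show ?thesis using orb_refl[of w] by blast
    qed
    then have "bij (y k)" using inj unfolding bij_def by blast
    then show ?thesis using emb fixed unfolding carrier_iff by blast
  qed
  let ?ys = "map y [0..<N]"
  have "square_word G ?ys z = \<sigma> z" for z
  proof -
    obtain ys where ys: "length ys = N" "set ys \<subseteq> carrier G" "\<forall>w\<in>orb z. \<forall>k<N. y k w = (ys ! k) w"
      "\<forall>w\<in>orb z. square_word G ys w = \<sigma> w"
      using loc[OF finite_orb] by blast
    have "list_all2 (\<lambda>f g. \<forall>w\<in>orb z. f w = g w \<and> g w \<in> orb z) ?ys ys"
    proof (rule list_all2_all_nthI)
      show "length ?ys = length ys" using ys(1) by simp
      fix k assume "k < length ?ys"
      then have k: "k < N" by simp
      have "ys ! k \<in> carrier G" using ys(1,2) k nth_mem by blast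
      then show "\<forall>w\<in>orb z. (?ys ! k) w = (ys ! k) w \<and> (ys ! k) w \<in> orb z"
        using k ys(3) orb_stable by simp
    qed
    from square_word_cong[OF this orb_refl] show ?thesis using ys(4) orb_refl by metis
  qed
  then have "square_word G ?ys = \<sigma>" by (rule ext)
  moreover have "set ?ys \<subseteq> carrier G" using yG by auto
  ultimately show ?thesis by (intro exI[of _ ?ys]) simp
qed

text \<open>Serre's theorem for the group at hand: abstract characters of order two are continuous.\<close>

theorem abstract_character:
  fixes \<chi> :: "('b \<Rightarrow> 'b) \<Rightarrow> bit" and T :: "'a set"
  assumes T: "finite T" "\<And>a. a \<noteq> 0 \<Longrightarrow> \<exists>t\<in>T. t \<noteq> 0 \<and> (\<exists>z. z \<noteq> 0 \<and> a = t * z ^ 2)"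
    and hom: "\<And>\<sigma> \<tau>. \<sigma> \<in> carrier G \<Longrightarrow> \<tau> \<in> carrier G \<Longrightarrow> \<chi> (\<sigma> \<circ> \<tau>) = \<chi> \<sigma> + \<chi> \<tau>"
  shows "\<exists>a. a \<noteq> 0 \<and> (\<forall>\<sigma>\<in>carrier G. \<chi> \<sigma> = chi a \<sigma>)"
proof -
  \<comment> \<open>The roots of representatives of all square classes. An automorphism fixing them
    fixes the square root of every base element up to nothing, so \<open>stab S\<close> lies in
    \<open>Frat\<close> and has finite index.\<close>
  define S where "S = (\<Union>t\<in>T. {s. s * s = i t})"
  have fin: "finite S" unfolding S_def using T(1) finite_square_roots by (rule finite_UN_I)
  have st: "stable S"
    unfolding stable_def
  proof (intro ballI)
    fix \<sigma> s assume \<sigma>: "\<sigma> \<in> carrier G" and "s \<in> S"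
    then obtain t where t: "t \<in> T" "s * s = i t" unfolding S_def by blast
    have "\<sigma> s * \<sigma> s = i t" using t(2) gal_simps(4)[OF \<sigma>, of s s] gal_simps(9)[OF \<sigma>, of t] by simp
    then show "\<sigma> s \<in> S" unfolding S_def using t(1) by blast
  qed
  have sub: "stab S \<subseteq> Frat"
  proof
    fix \<sigma> assume \<sigma>: "\<sigma> \<in> stab S"
    then have \<sigma>c: "\<sigma> \<in> carrier G" using stab_subset by blast
    have "chi a \<sigma> = 0" if a: "a \<noteq> 0" for a
    proof -
      obtain t z where t: "t \<in> T" "t \<noteq> 0" "z \<noteq> 0" "a = t * z ^ 2" using T(2)[OF a] by blast
      have "sq t \<in> S" unfolding S_def using t(1) sq_square by blast
      then have "\<sigma> (sq t) = sq t" using \<sigma> unfolding stab_def by blast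
      then have "chi t \<sigma> = 0" by (simp add: chi_def)
      then show ?thesis
        unfolding t(4) using chi_mult[OF \<sigma>c t(2), of "z ^ 2"] chi_square[OF \<sigma>c t(3)] t(3) by simp
    qed
    then show "\<sigma> \<in> Frat" unfolding Frat_def using \<sigma>c by blast
  qed
  obtain Q :: "('b \<Rightarrow> 'b) set monoid" and \<phi> k where \<phi>: "group_hom G Q \<phi>" "carrier Q = \<phi> ` carrier G"
    "\<And>\<sigma>. \<sigma> \<in> carrier G \<Longrightarrow> \<phi> \<sigma> = \<one>\<^bsub>Q\<^esub> \<longleftrightarrow> \<sigma> \<in> stab S"
    and eq: "\<And>\<sigma> \<tau>. \<sigma> \<in> carrier G \<Longrightarrow> \<tau> \<in> carrier G \<Longrightarrow> \<phi> \<sigma> = \<phi> \<tau> \<longleftrightarrow> (\<forall>z\<in>S. \<sigma> z = \<tau> z)"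
    and finQ: "finite (carrier Q)" and ord: "order Q = 2 ^ k"
    by (rule finite_quotient[OF fin st], rule that)
  interpret h: group_hom G Q \<phi> by fact
  obtain qs where qs: "set qs = carrier Q" using finite_list[OF finQ] by blast
  define rep where "rep q = (SOME \<tau>. \<tau> \<in> carrier G \<and> \<phi> \<tau> = q)" for q
  have rep: "rep q \<in> carrier G \<and> \<phi> (rep q) = q" if "q \<in> carrier Q" for q
  proof -
    have "\<exists>\<tau>. \<tau> \<in> carrier G \<and> \<phi> \<tau> = q" using that unfolding \<phi>(2) by blast
    then show ?thesis unfolding rep_def by (rule someI_ex)
  qed
  have rs: "set (map rep qs) \<subseteq> carrier G" using rep qs by auto
  have cover: "\<exists>k<length (map rep qs). inv\<^bsub>G\<^esub> (map rep qs ! k) \<circ> \<tau> \<in> Frat" if \<tau>: "\<tau> \<in> carrier G" for \<tau>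
  proof -
    obtain k where k: "k < length qs" "qs ! k = \<phi> \<tau>"
      using h.hom_closed[OF \<tau>] qs by (metis in_set_conv_nth)
    define \<rho> where "\<rho> = rep (\<phi> \<tau>)"
    have \<rho>: "\<rho> \<in> carrier G" "\<phi> \<rho> = \<phi> \<tau>" unfolding \<rho>_def using rep[OF h.hom_closed[OF \<tau>]] by blast+
    have "\<phi> (inv\<^bsub>G\<^esub> \<rho> \<otimes>\<^bsub>G\<^esub> \<tau>) = \<one>\<^bsub>Q\<^esub>"
      unfolding h.hom_mult[OF gal.inv_closed[OF \<rho>(1)] \<tau>] h.hom_inv[OF \<rho>(1)] \<rho>(2)
      by (rule h.H.l_inv[OF h.hom_closed[OF \<tau>]])
    then have "inv\<^bsub>G\<^esub> \<rho> \<circ> \<tau> \<in> stab S"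
      using \<phi>(3)[OF gal.m_closed[OF gal.inv_closed[OF \<rho>(1)] \<tau>]] unfolding mult_G by blast
    then have "inv\<^bsub>G\<^esub> (map rep qs ! k) \<circ> \<tau> \<in> Frat"
      using sub k unfolding \<rho>_def by auto
    then show ?thesis using k(1) by (intro exI[of _ k]) simp
  qed
  have one0: "\<chi> \<one>\<^bsub>G\<^esub> = 0"
    using hom[of id id] gal.one_closed bit_cases[of "\<chi> id"] unfolding one_G by auto
  have word0: "\<chi> (square_word G ys) = 0" if "set ys \<subseteq> carrier G" for ys
    using that
  proof (induction ys)
    case Nil
    show ?case using one0 by (simp only: gal.square_word_Nil)
  next
    case (Cons y ys)
    then have y: "y \<in> carrier G" "square_word G ys \<in> carrier G" by auto
    have eq: "\<chi> (square_word G (y # ys)) = \<chi> y + \<chi> y + \<chi> (square_word G ys)"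
      using hom[OF comp_closed[OF y(1) y(1)] y(2)] hom[OF y(1) y(1)] by (simp del: add_bit_eq_xor comp_apply add: comp_assoc)
    have "\<chi> (square_word G ys) = 0" using Cons by simp
    then show ?case unfolding eq using bit_cases[of "\<chi> y"] by auto
  qed
  \<comment> \<open>An exact product of squares is killed by any abstract homomorphism to F_2. With
    the vanishing on \<open>stab S\<close> the character factors through a finite quotient.\<close>
  have "\<chi> \<sigma> = 0" if \<sigma>: "\<sigma> \<in> stab S" for \<sigma>
  proof -
    have "\<sigma> \<in> Frat" using sub \<sigma> by blast
    then obtain ys where "set ys \<subseteq> carrier G" "square_word G ys = \<sigma>"
      using square_word_limit[OF square_word_approx[OF rs cover]] by blast
    then show ?thesis using word0 by blast
  qed
  then show ?thesis using kummer_character[OF fin st hom] by blast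
qed

end

section \<open>Symbols in a field that is not formally real\<close>

definition square_class :: "'a::field \<Rightarrow> 'a set" where
  "square_class x = {y. x \<noteq> 0 \<and> y \<noteq> 0 \<and> (\<exists>z. z \<noteq> 0 \<and> x = y * z ^ 2)}"

lemma square_classes_eq: "square_classes = square_class ` {x. x \<noteq> 0}"
  unfolding square_classes_def quotient_def square_class_def by auto

lemma square_class_mult:
  assumes "c \<noteq> 0"
  shows "square_class (c * x) = (*) c ` square_class x"
proof
  show "square_class (c * x) \<subseteq> (*) c ` square_class x"
  proof
    fix y assume "y \<in> square_class (c * x)"
    then obtain z where z: "c * x \<noteq> 0" "y \<noteq> 0" "z \<noteq> 0" "c * x = y * z ^ 2"
      by (auto simp: square_class_def)
    have "x = (y / c) * z ^ 2" using z(4) assms by (simp add: field_simps)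
    then have "y / c \<in> square_class x" using z assms by (auto simp: square_class_def)
    moreover have "y = c * (y / c)" using assms by simp
    ultimately show "y \<in> (*) c ` square_class x" by (rule image_eqI[rotated])
  qed
  show "(*) c ` square_class x \<subseteq> square_class (c * x)"
    using assms by (auto simp: square_class_def ac_simps)
qed

lemma square_class_self: "x \<noteq> 0 \<Longrightarrow> x \<in> square_class x"
  by (auto simp: square_class_def intro!: exI[of _ 1])

text \<open>Only the vanishing of a symbol is recorded, so bilinearity takes the form of closure
  under products. The rules act on the leading entries, since the argument extends symbols at the
  front.\<close>

locale symbol_calculus =
  fixes null :: "'a::field list \<Rightarrow> bool"
  assumes cons: "a \<noteq> 0 \<Longrightarrow> 0 \<notin> set as \<Longrightarrow> null as \<Longrightarrow> null (a # as)"
    and mult: "a \<noteq> 0 \<Longrightarrow> b \<noteq> 0 \<Longrightarrow> 0 \<notin> set as \<Longrightarrow> null (a # as) \<Longrightarrow> null (b # as) \<Longrightarrow> null (a * b # as)"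
    and square: "a \<noteq> 0 \<Longrightarrow> 0 \<notin> set as \<Longrightarrow> null (a ^ 2 # as)"
    and commute: "a \<noteq> 0 \<Longrightarrow> b \<noteq> 0 \<Longrightarrow> 0 \<notin> set as \<Longrightarrow> null (a # b # as) \<Longrightarrow> null (b # a # as)"
    and steinberg: "a \<noteq> 0 \<Longrightarrow> b \<noteq> 0 \<Longrightarrow> 0 \<notin> set as \<Longrightarrow> a + b = 1 \<Longrightarrow> null (a # b # as)"
begin

lemma mult_square:
  assumes "a \<noteq> 0" "z \<noteq> 0" "0 \<notin> set as"
  shows "null (a * z ^ 2 # as) \<longleftrightarrow> null (a # as)"
proof
  assume "null (a * z ^ 2 # as)"
  then have "null (a * z ^ 2 * (inverse z) ^ 2 # as)"
    using assms square[of "inverse z" as] mult[of "a * z ^ 2" "(inverse z) ^ 2" as] by simp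
  also have "a * z ^ 2 * (inverse z) ^ 2 = a" using assms by (simp add: power_inverse)
  finally show "null (a # as)" .
qed (use assms square[of z as] mult[of a "z ^ 2" as] in simp)

text \<open>Modulo squares every \<open>a\<close> is its own inverse, so multiplying by
  \<open>a\<close> again recovers \<open>b\<close>.\<close>

lemma cancel:
  assumes "a \<noteq> 0" "b \<noteq> 0" "0 \<notin> set as" "null (a * b # as)" "null (a # as)"
  shows "null (b # as)"
proof -
  have "null (a * b * a # as)" using assms mult[of "a * b" a as] by simp
  also have "a * b * a = b * a ^ 2" by (simp add: power2_eq_square)
  finally show ?thesis using assms mult_square[of b a as] by simp
qed

text \<open>The relation \<open>1 - a = (- a) (1 - 1 / a)\<close> derives this from the Steinberg relations
  for \<open>a\<close> and \<open>1 / a\<close>.\<close>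

lemma null_minus:
  assumes a: "a \<noteq> 0" and as: "0 \<notin> set as"
  shows "null (- a # a # as)"
proof (cases "a = 1")
  case True
  have "null (1 ^ 2 # (- 1) # as)" using as by (intro square) auto
  then show ?thesis using True as commute[of 1 "- 1" as] by simp
next
  case False
  define b where "b = inverse a"
  have b: "b \<noteq> 0" "1 - b \<noteq> 0" "1 - a \<noteq> 0" using a False by (auto simp: b_def)
  have "null ((1 - b) # b # as)" using as b by (intro steinberg) auto
  then have "null (b # (1 - b) # as)" using commute[of "1 - b" b as] as b by simp
  then have "null (b * a ^ 2 # (1 - b) # as)" using mult_square[of b a "(1 - b) # as"] a b as by auto
  moreover have "b * a ^ 2 = a" using a by (simp add: b_def power2_eq_square)
  ultimately have "null ((1 - b) # a # as)" using commute[of a "1 - b" as] a b as by simp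
  moreover have "null ((1 - b) * (- a) # a # as)"
  proof -
    have "(1 - b) * (- a) = 1 - a" using a by (simp add: b_def algebra_simps)
    then show ?thesis using steinberg[of "1 - a" a as] a b as by simp
  qed
  ultimately show ?thesis using a b as by (intro cancel[of "1 - b" "- a"]) auto
qed

definition annihilator :: "'a list \<Rightarrow> 'a set" where
  "annihilator as = {b. b \<noteq> 0 \<and> null (b # as)}"

lemma annihilator_Cons:
  assumes "a \<noteq> 0" "0 \<notin> set as"
  shows "annihilator as \<subseteq> annihilator (a # as)"
proof
  fix b assume "b \<in> annihilator as"
  then have b: "b \<noteq> 0" "null (b # as)" by (auto simp: annihilator_def)
  then have "null (a # b # as)" using assms cons[of a "b # as"] by simp
  then show "b \<in> annihilator (a # as)" using commute b(1) assms by (simp add: annihilator_def)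
qed

text \<open>Write \<open>c = 1 + b\<close>. The Steinberg relation for \<open>- b\<close> and
  \<open>c\<close>, with \<open>b\<close> annihilating the symbol, makes \<open>- 1\<close>
  annihilate \<open>c # as\<close>. By the assumed equality \<open>- a\<close> annihilates
  \<open>as\<close>, hence also \<open>c # as\<close>. So \<open>a\<close> annihilates
  \<open>c # as\<close>, that is, \<open>c\<close> annihilates \<open>a # as\<close>, and the
  equality is applied once more.\<close>

lemma annihilator_add_one:
  assumes a: "a \<noteq> 0" and as: "0 \<notin> set as" and eq: "annihilator (a # as) = annihilator as"
    and b: "b \<in> annihilator as" "1 + b \<noteq> 0"
  shows "1 + b \<in> annihilator as"
proof -
  let ?c = "1 + b"
  have b0: "b \<noteq> 0" "null (b # as)" using b(1) by (auto simp: annihilator_def)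
  have "- a \<in> annihilator (a # as)" using null_minus[OF a as] a by (simp add: annihilator_def)
  then have ma: "null (- a # as)" unfolding eq by (simp add: annihilator_def)
  have cas: "0 \<notin> set (?c # as)" using as b(2) by auto
  have "null (?c # b # as)" using b0 b(2) as cons[of ?c "b # as"] by simp
  then have bc: "null (b # ?c # as)" using commute b0(1) b(2) as by blast
  have "null (- b # ?c # as)" using b0(1) b(2) as by (intro steinberg) auto
  then have "null (b * (- 1) # ?c # as)" by simp
  then have "null (- 1 # ?c # as)" using cancel[of b "- 1" "?c # as"] b0(1) cas bc by simp
  moreover have "null (?c # (- a) # as)" using ma a as b(2) cons[of ?c "- a # as"] by simp
  then have "null (- a # ?c # as)" using commute[of ?c "- a" as] a as b(2) by simp
  ultimately have "null ((- 1) * (- a) # ?c # as)" using a cas mult[of "- 1" "- a" "?c # as"] by simp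
  then have "null (?c # a # as)" using commute[of a ?c as] a as b(2) by simp
  then show ?thesis using b(2) eq by (auto simp: annihilator_def)
qed

text \<open>Factoring out a square turns adding \<open>x ^ 2\<close> to \<open>s\<close> into adding
  one to \<open>s\<close> divided by \<open>x ^ 2\<close>. Partial sums may vanish, hence the
  alternative in the claim.\<close>

lemma annihilator_sum_squares:
  assumes a: "a \<noteq> 0" and as: "0 \<notin> set as" and eq: "annihilator (a # as) = annihilator as"
  shows "(\<Sum>x\<leftarrow>xs. x ^ 2) = 0 \<or> (\<Sum>x\<leftarrow>xs. x ^ 2) \<in> annihilator as"
proof (induction xs)
  case (Cons x xs)
  let ?s = "\<Sum>x\<leftarrow>xs. x ^ 2"
  show ?case
  proof (cases "x = 0 \<or> x ^ 2 + ?s = 0")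
    case True
    then show ?thesis using Cons by auto
  next
    case False
    then have x: "x \<noteq> 0" "x ^ 2 + ?s \<noteq> 0" by auto
    show ?thesis
    proof (cases "?s = 0")
      case True
      then show ?thesis using square[of x as] x as by (simp add: annihilator_def)
    next
      case False
      then have s: "?s \<noteq> 0" "null (?s # as)" using Cons by (auto simp: annihilator_def)
      define b where "b = ?s * (inverse x) ^ 2"
      have "b \<in> annihilator as"
        using mult_square[of ?s "inverse x" as] s x as by (simp add: annihilator_def b_def)
      moreover have xb: "x ^ 2 + ?s = (1 + b) * x ^ 2"
        using x by (simp add: b_def power_inverse algebra_simps)
      then have "1 + b \<noteq> 0" using x by auto
      ultimately have "1 + b \<in> annihilator as" using annihilator_add_one[OF a as eq] by blast
      then have "(1 + b) * x ^ 2 \<in> annihilator as"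
        using mult_square[of "1 + b" x as] x as by (simp add: annihilator_def)
      then show ?thesis using xb by simp
    qed
  qed
qed simp

lemma annihilator_strict:
  assumes nr: "\<not> formally_real TYPE('a)" and a: "a \<noteq> 0" and as: "0 \<notin> set as"
    and not_null: "\<not> null (a # as)"
  shows "annihilator as \<subset> annihilator (a # as)"
proof (rule ccontr)
  assume "\<not> ?thesis"
  then have eq: "annihilator (a # as) = annihilator as" using annihilator_Cons[OF a as] by blast
  obtain xs :: "'a list" where xs: "- 1 = (\<Sum>x\<leftarrow>xs. x ^ 2)" using nr unfolding formally_real_def by blast
  have "- 1 \<in> annihilator as"
    using annihilator_sum_squares[OF a as eq, of xs] unfolding xs[symmetric] by simp
  then have m1: "null (- 1 # as)" by (simp add: annihilator_def)
  have "- a \<in> annihilator (a # as)" using null_minus[OF a as] a by (simp add: annihilator_def)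
  then have "null (- a # as)" unfolding eq by (simp add: annihilator_def)
  with m1 have "null ((- 1) * (- a) # as)" using a as mult[of "- 1" "- a" as] by simp
  then show False using not_null by simp
qed

text \<open>Let \<open>c\<close> annihilate \<open>a # as\<close> but not \<open>as\<close>. The
  square classes annihilating \<open>as\<close> and their translates by \<open>c\<close> are
  disjoint and all annihilate \<open>a # as\<close>, which doubles the count. The induction starts
  from the class of \<open>1\<close>.\<close>

lemma two_power_le_card_annihilator:
  assumes nr: "\<not> formally_real TYPE('a)" and fin: "finite (square_classes :: 'a set set)"
    and as: "0 \<notin> set as" and not_null: "\<not> null as"
  shows "2 ^ length as \<le> card (square_class ` annihilator as)"
  using as not_null
proof (induction as)
  have finU: "finite (square_class ` annihilator as)" for as
    by (rule finite_subset[OF _ fin]) (auto simp: square_classes_eq annihilator_def)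
  {
    case Nil
    have "1 \<in> annihilator []" using square[of 1 "[]"] by (simp add: annihilator_def)
    then have "card (square_class ` annihilator []) \<noteq> 0" using finU[of "[]"] by auto
    then show ?case by simp
  next
    case (Cons a as)
    have a: "a \<noteq> 0" "0 \<notin> set as" using Cons.prems(1) by auto
    have "\<not> null as" using Cons.prems(2) cons a by blast
    then have IH: "2 ^ length as \<le> card (square_class ` annihilator as)" using Cons.IH a(2) by blast
    let ?U = "annihilator as" and ?V = "annihilator (a # as)"
    have UV: "?U \<subset> ?V" by (rule annihilator_strict[OF nr a Cons.prems(2)])
    then obtain c where c: "c \<in> ?V" "c \<notin> ?U" by blast
    have c0: "c \<noteq> 0" "null (c # a # as)" using c(1) by (auto simp: annihilator_def)
    let ?A = "square_class ` ?U" and ?B = "(\<lambda>x. square_class (c * x)) ` ?U"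
    have B: "?B = image ((*) c) ` ?A" by (simp add: image_image square_class_mult[OF c0(1)])
    have finB: "finite ?B" unfolding B by (rule finite_imageI[OF finU])
    note B
    moreover have "inj_on (image ((*) c)) ?A"
      using c0(1) by (intro inj_on_image) (auto simp: inj_on_def)
    ultimately have cardB: "card ?B = card ?A" by (simp add: card_image)
    have sub: "?A \<union> ?B \<subseteq> square_class ` ?V"
    proof -
      have "c * x \<in> ?V" if "x \<in> ?U" for x
      proof -
        have "x \<noteq> 0" "null (x # a # as)" using UV that by (auto simp: annihilator_def)
        then show ?thesis using mult[of c x "a # as"] c0 a by (auto simp: annihilator_def)
      qed
      then show ?thesis using UV by blast
    qed
    have disj: "?A \<inter> ?B = {}"
    proof (rule ccontr)
      assume "?A \<inter> ?B \<noteq> {}"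
      then obtain x y where xy: "x \<in> ?U" "y \<in> ?U" "square_class x = square_class (c * y)" by blast
      have x: "x \<noteq> 0" "null (x # as)" and y: "y \<noteq> 0" "null (y # as)"
        using xy by (auto simp: annihilator_def)
      have "x \<in> square_class (c * y)" using square_class_self[OF x(1)] xy(3) by simp
      then obtain z where z: "z \<noteq> 0" "c * y = x * z ^ 2" by (auto simp: square_class_def)
      have "null (x * z ^ 2 # as)" using mult_square[OF x(1) z(1) a(2)] x(2) by simp
      then have "null (y * c # as)" using z(2) by (simp add: mult.commute)
      then have "null (c # as)" using cancel[of y c as] y c0(1) a(2) by blast
      then show False using c(2) c0(1) by (simp add: annihilator_def)
    qed
    have "2 ^ length (a # as) \<le> card ?A + card ?B" using IH cardB by simp
    also have "\<dots> = card (?A \<union> ?B)"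
      by (rule card_Un_disjoint[OF finU finB disj, symmetric])
    also have "\<dots> \<le> card (square_class ` ?V)" by (rule card_mono[OF finU sub])
    finally show ?case .
  }
qed

theorem null_of_length:
  assumes nr: "\<not> formally_real TYPE('a)" and card: "card (square_classes :: 'a set set) = 2 ^ n"
    and as: "0 \<notin> set as" and len: "length as > n"
  shows "null as"
proof (rule ccontr)
  assume not_null: "\<not> null as"
  have fin: "finite (square_classes :: 'a set set)" using card by (metis card.infinite power_not_zero zero_neq_numeral)
  have "2 ^ length as \<le> card (square_class ` annihilator as)"
    by (rule two_power_le_card_annihilator[OF nr fin as not_null])
  also have "\<dots> \<le> card (square_classes :: 'a set set)"
    by (rule card_mono[OF fin]) (auto simp: square_classes_eq annihilator_def)
  finally have "(2::nat) ^ length as \<le> 2 ^ n" using card by simp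
  then show False using len by simp
qed

end

section \<open>Cup products with one-cocycles\<close>

lemma bit_add_self: "(b::bit) + b = 0"
  using bit_cases[of b] by auto

context group
begin

lemma cocycle_one_iff:
  "cocycle G 1 a \<longleftrightarrow> (\<forall>g\<in>carrier G. \<forall>h\<in>carrier G. a [h] + a [g \<otimes> h] + a [g] = 0)"
proof -
  have eq: "coboundary G 1 a [g, h] = a [h] + a [g \<otimes> h] + a [g]" for g h
    by (simp add: coboundary_def del: add_bit_eq_xor)
  show ?thesis
  proof (intro iffI ballI)
    fix g h assume a: "cocycle G 1 a" and gh: "g \<in> carrier G" "h \<in> carrier G"
    from a have "set [g, h] \<subseteq> carrier G \<and> length [g, h] = Suc 1 \<longrightarrow> coboundary G 1 a [g, h] = 0"
      unfolding cocycle_def by (rule spec[where x = "[g, h]"])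
    moreover have "set [g, h] \<subseteq> carrier G \<and> length [g, h] = Suc 1" using gh by simp
    ultimately show "a [h] + a [g \<otimes> h] + a [g] = 0" unfolding eq by (rule mp)
  next
    assume a: "\<forall>g\<in>carrier G. \<forall>h\<in>carrier G. a [h] + a [g \<otimes> h] + a [g] = 0"
    show "cocycle G 1 a"
      unfolding cocycle_def
    proof (intro allI impI)
      fix gs assume gs: "set gs \<subseteq> carrier G \<and> length gs = Suc 1"
      then obtain g h where gh: "gs = [g, h]" by (auto simp: length_Suc_conv)
      show "coboundary G 1 a gs = 0" unfolding gh eq using a gs[unfolded gh] by simp
    qed
  qed
qed

lemma cocycle_one_mult:
  assumes "cocycle G 1 a" "g \<in> carrier G" "h \<in> carrier G"
  shows "a [g \<otimes> h] = a [g] + a [h]"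
proof -
  have "a [h] + a [g \<otimes> h] + a [g] = 0" using assms cocycle_one_iff by blast
  then show ?thesis
    using bit_cases[of "a [h]"] bit_cases[of "a [g]"] bit_cases[of "a [g \<otimes> h]"] by auto
qed

lemma is_coboundaryI:
  assumes "\<And>gs. set gs \<subseteq> carrier G \<Longrightarrow> length gs = Suc k \<Longrightarrow> c gs = coboundary G k h gs"
  shows "is_coboundary G (Suc k) c"
  unfolding is_coboundary_def using assms by auto

lemma is_coboundaryE:
  assumes "is_coboundary G (Suc k) c"
  obtains h where "\<And>gs. set gs \<subseteq> carrier G \<Longrightarrow> length gs = Suc k \<Longrightarrow> c gs = coboundary G k h gs"
  using assms unfolding is_coboundary_def by auto

lemma is_coboundary_cong:
  assumes "is_coboundary G k c" "\<And>gs. set gs \<subseteq> carrier G \<Longrightarrow> length gs = k \<Longrightarrow> c gs = d gs"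
  shows "is_coboundary G k d"
  using assms unfolding is_coboundary_def by (cases "k = 0") auto

lemma coboundary_add:
  "coboundary G k (\<lambda>gs. f gs + g gs) gs = coboundary G k f gs + coboundary G k g gs"
  unfolding coboundary_def by (simp add: sum.distrib ac_simps del: add_bit_eq_xor)

lemma is_coboundary_add:
  assumes "is_coboundary G k c" "is_coboundary G k d"
  shows "is_coboundary G k (\<lambda>gs. c gs + d gs)"
proof (cases k)
  case 0
  then show ?thesis using assms by (simp add: is_coboundary_def)
next
  case (Suc m)
  obtain h where h: "\<And>gs. set gs \<subseteq> carrier G \<Longrightarrow> length gs = Suc m \<Longrightarrow> c gs = coboundary G m h gs"
    using assms(1) unfolding Suc by (rule is_coboundaryE) blast
  obtain h' where h': "\<And>gs. set gs \<subseteq> carrier G \<Longrightarrow> length gs = Suc m \<Longrightarrow> d gs = coboundary G m h' gs"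
    using assms(2) unfolding Suc by (rule is_coboundaryE) blast
  show ?thesis unfolding Suc
    by (rule is_coboundaryI[where h = "\<lambda>gs. h gs + h' gs"]) (simp only: coboundary_add h h')
qed

lemma is_coboundary_zero: "is_coboundary G k (\<lambda>_. 0)"
proof (cases k)
  case (Suc m)
  have "is_coboundary G (Suc m) (\<lambda>_. 0)"
    by (rule is_coboundaryI[where h = "\<lambda>_. 0"]) (simp add: coboundary_def)
  then show ?thesis using Suc by simp
qed (simp add: is_coboundary_def)

lemma is_coboundary_sum:
  fixes m :: nat
  assumes "\<And>j. j < m \<Longrightarrow> is_coboundary G k (f j)"
  shows "is_coboundary G k (\<lambda>gs. \<Sum>j<m. f j gs)"
  using assms
proof (induction m)
  case 0
  show ?case using is_coboundary_zero by simp
next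
  case (Suc m)
  then have "is_coboundary G k (\<lambda>gs. (\<Sum>j<m. f j gs) + f m gs)"
    by (intro is_coboundary_add) auto
  then show ?case by (simp only: sum.lessThan_Suc)
qed

text \<open>Leibniz rule for a closed left factor: if \<open>h\<close> bounds \<open>c\<close>, then
  \<open>cup 1 a h\<close> bounds the product. Splitting the face that merges the first two entries
  by additivity of \<open>a\<close> produces a term that cancels the outer face modulo two.\<close>

lemma is_coboundary_cup_left:
  assumes a: "cocycle G 1 a" and c: "is_coboundary G k c"
  shows "is_coboundary G (Suc k) (cup 1 a c)"
proof (cases k)
  case 0
  then have "c [] = 0" using c by (simp add: is_coboundary_def)
  then show ?thesis unfolding 0
    by (intro is_coboundary_cong[OF is_coboundary_zero]) (auto simp: cup_def length_Suc_conv)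
next
  case (Suc m)
  obtain h where h: "\<And>gs. set gs \<subseteq> carrier G \<Longrightarrow> length gs = Suc m \<Longrightarrow> c gs = coboundary G m h gs"
    using c unfolding Suc by (rule is_coboundaryE) blast
  show ?thesis unfolding Suc
  proof (rule is_coboundaryI[where h = "cup 1 a h"])
    fix gs :: "'a list" assume gs: "set gs \<subseteq> carrier G" "length gs = Suc (Suc m)"
    then obtain g g' r where gs_eq: "gs = g # g' # r" and r: "length r = m" by (auto simp: length_Suc_conv)
    have carr: "g \<in> carrier G" "g' \<in> carrier G" "set (g' # r) \<subseteq> carrier G" using gs(1) gs_eq by auto
    define F where "F j = h (take j (g' # r) @ [(g' # r) ! j \<otimes> (g' # r) ! Suc j] @ drop (Suc (Suc j)) (g' # r))" for j
    have "coboundary G (Suc m) (cup 1 a h) gs = a [g'] * h r +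
       (a [g \<otimes> g'] * h r + (\<Sum>j<m. a [g] * F j)) + a [g] * h (take m (g' # r))"
      unfolding coboundary_def gs_eq sum.lessThan_Suc_shift
      by (simp add: cup_def F_def del: add_bit_eq_xor mult_bit_eq_and)
    also have "\<dots> = a [g'] * h r + (a [g] + a [g']) * h r + a [g] * (\<Sum>j<m. F j) + a [g] * h (take m (g' # r))"
      unfolding cocycle_one_mult[OF a carr(1,2)] sum_distrib_left by (simp only: add.assoc)
    also have "\<dots> = a [g] * (h r + (\<Sum>j<m. F j) + h (take m (g' # r)))"
      using bit_cases[of "a [g]"] bit_cases[of "a [g']"] by (auto simp: bit_add_self simp del: add_bit_eq_xor mult_bit_eq_and)
    also have "\<dots> = a [g] * c (g' # r)"
      using h[of "g' # r"] carr(3) r by (simp add: coboundary_def F_def del: add_bit_eq_xor mult_bit_eq_and)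
    finally show "cup 1 a c gs = coboundary G (Suc m) (cup 1 a h) gs"
      by (simp add: cup_def gs_eq del: mult_bit_eq_and)
  qed
qed

text \<open>The mirror image: now the cancellation takes place between the face merging the last two
  entries and the face dropping the last one. It allows factors to be appended to a
  coboundary.\<close>

lemma is_coboundary_cup_right:
  assumes b: "cocycle G 1 b" and c: "is_coboundary G k c"
  shows "is_coboundary G (Suc k) (\<lambda>gs. c (take k gs) * b (drop k gs))"
proof (cases k)
  case 0
  then have "c [] = 0" using c by (simp add: is_coboundary_def)
  then show ?thesis unfolding 0
    by (intro is_coboundary_cong[OF is_coboundary_zero]) auto
next
  case (Suc m)
  obtain h where h: "\<And>gs. set gs \<subseteq> carrier G \<Longrightarrow> length gs = Suc m \<Longrightarrow> c gs = coboundary G m h gs"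
    using c unfolding Suc by (rule is_coboundaryE) blast
  define H where "H gs = h (take m gs) * b (drop m gs)" for gs
  show ?thesis unfolding Suc
  proof (rule is_coboundaryI[where h = H])
    fix gs :: "'a list" assume gs: "set gs \<subseteq> carrier G" "length gs = Suc (Suc m)"
    define ls p q where "ls = take m gs" and "p = gs ! m" and "q = gs ! Suc m"
    have ls: "length ls = m" using gs(2) by (simp add: ls_def)
    have gs_eq: "gs = ls @ [p, q]"
      using gs(2) id_take_nth_drop[of m gs] Cons_nth_drop_Suc[of "Suc m" gs] by (simp add: ls_def p_def q_def)
    have carr: "p \<in> carrier G" "q \<in> carrier G" "set (ls @ [p]) \<subseteq> carrier G" using gs(1) gs_eq by auto
    let ?L = "ls @ [p]"
    define F where "F j = take j ?L @ [?L ! j \<otimes> ?L ! Suc j] @ drop (Suc (Suc j)) ?L" for j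
    have HT: "H (T @ [y]) = h T * b [y]" if "length T = m" for T y using that by (simp add: H_def)
    have tl: "H (tl gs) = h (tl ?L) * b [q]"
    proof -
      have "tl gs = tl ?L @ [q]" unfolding gs_eq by (cases ls) auto
      then show ?thesis using HT[of "tl ?L" q] ls by simp
    qed
    have face: "H (take j gs @ [gs ! j \<otimes> gs ! Suc j] @ drop (Suc (Suc j)) gs) = h (F j) * b [q]" if j: "j < m" for j
    proof -
      have "take j gs @ [gs ! j \<otimes> gs ! Suc j] @ drop (Suc (Suc j)) gs = F j @ [q]"
      proof -
        have "take j (L @ [q]) @ [(L @ [q]) ! j \<otimes> (L @ [q]) ! Suc j] @ drop (Suc (Suc j)) (L @ [q])
            = (take j L @ [L ! j \<otimes> L ! Suc j] @ drop (Suc (Suc j)) L) @ [q]" if "length L = Suc m" for L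
          using that j by (simp add: nth_append)
        from this[of ?L] show ?thesis using ls by (simp add: gs_eq F_def)
      qed
      moreover have "length (F j) = m" unfolding F_def using j ls by simp
      ultimately show ?thesis using HT by simp
    qed
    have last: "H (take m gs @ [gs ! m \<otimes> gs ! Suc m] @ drop (Suc (Suc m)) gs) = h ls * b [p \<otimes> q]"
    proof -
      have "take m gs @ [gs ! m \<otimes> gs ! Suc m] @ drop (Suc (Suc m)) gs = ls @ [p \<otimes> q]"
        unfolding gs_eq using ls by (simp add: nth_append)
      then show ?thesis using HT[OF ls] by simp
    qed
    have trunc: "H (take (Suc m) gs) = h ls * b [p]"
      unfolding gs_eq using ls HT[OF ls] by simp
    have faces: "(\<Sum>j<m. H (take j gs @ [gs ! j \<otimes> gs ! Suc j] @ drop (Suc (Suc j)) gs))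
        = (\<Sum>j<m. h (F j) * b [q])"
      by (rule sum.cong[OF refl]) (simp only: lessThan_iff face)
    have "coboundary G (Suc m) H gs = h (tl ?L) * b [q] + ((\<Sum>j<m. h (F j) * b [q]) + h ls * b [p \<otimes> q]) + h ls * b [p]"
      unfolding coboundary_def sum.lessThan_Suc tl last trunc faces by (rule refl)
    also have "\<dots> = h (tl ?L) * b [q] + ((\<Sum>j<m. h (F j)) * b [q] + h ls * (b [p] + b [q])) + h ls * b [p]"
      unfolding cocycle_one_mult[OF b carr(1,2)] sum_distrib_right by (rule refl)
    also have "\<dots> = (h (tl ?L) + (\<Sum>j<m. h (F j)) + h ls) * b [q]"
      using bit_cases[of "b [p]"] bit_cases[of "b [q]"] by (auto simp: bit_add_self add.assoc simp del: add_bit_eq_xor mult_bit_eq_and)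
    also have "\<dots> = c ?L * b [q]"
      using h[of ?L] carr(3) ls by (simp add: coboundary_def F_def del: add_bit_eq_xor mult_bit_eq_and)
    finally show "c (take (Suc m) gs) * b (drop (Suc m) gs) = coboundary G (Suc m) H gs"
      using ls by (simp add: gs_eq del: mult_bit_eq_and)
  qed
qed

section \<open>The subgroup that defines the W-group\<close>

lemma conj_nat_pow:
  "x \<in> carrier G \<Longrightarrow> g \<in> carrier G \<Longrightarrow> g \<otimes> x [^] (n::nat) \<otimes> inv g = (g \<otimes> x \<otimes> inv g) [^] n"
proof (induction n)
  case (Suc n)
  have "g \<otimes> x [^] Suc n \<otimes> inv g = (g \<otimes> x [^] n \<otimes> inv g) \<otimes> (g \<otimes> x \<otimes> inv g)"
    using Suc.prems by (simp add: group_word_simps)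
  then show ?case using Suc by simp
qed simp

lemma W_subgroup_eq:
  "W_subgroup G = generate G ({x [^] (4::nat) | x. x \<in> carrier G} \<union>
     {commutator G (x [^] (2::nat)) y | x y. x \<in> carrier G \<and> y \<in> carrier G})"
  unfolding W_subgroup_def commutator_def ..

lemma W_subgroup_normal: "W_subgroup G \<lhd> G"
  unfolding W_subgroup_eq
proof (rule normal_generateI)
  show "{x [^] (4::nat) | x. x \<in> carrier G} \<union>
     {commutator G (x [^] (2::nat)) y | x y. x \<in> carrier G \<and> y \<in> carrier G} \<subseteq> carrier G" by auto
  fix h g assume h: "h \<in> {x [^] (4::nat) | x. x \<in> carrier G} \<union>
     {commutator G (x [^] (2::nat)) y | x y. x \<in> carrier G \<and> y \<in> carrier G}" and g: "g \<in> carrier G"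
  from h show "g \<otimes> h \<otimes> inv g \<in> {x [^] (4::nat) | x. x \<in> carrier G} \<union>
     {commutator G (x [^] (2::nat)) y | x y. x \<in> carrier G \<and> y \<in> carrier G}"
  proof
    assume "h \<in> {x [^] (4::nat) | x. x \<in> carrier G}"
    then obtain x where x: "x \<in> carrier G" "h = x [^] (4::nat)" by blast
    then have "g \<otimes> h \<otimes> inv g = (g \<otimes> x \<otimes> inv g) [^] (4::nat)" using g conj_nat_pow by simp
    moreover have "g \<otimes> x \<otimes> inv g \<in> carrier G" using g x by simp
    ultimately show ?thesis by blast
  next
    assume "h \<in> {commutator G (x [^] (2::nat)) y | x y. x \<in> carrier G \<and> y \<in> carrier G}"
    then obtain x y where x: "x \<in> carrier G" "y \<in> carrier G" "h = commutator G (x [^] (2::nat)) y" by blast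
    then have "g \<otimes> h \<otimes> inv g = commutator G ((g \<otimes> x \<otimes> inv g) [^] (2::nat)) (g \<otimes> y \<otimes> inv g)"
      using g conj_nat_pow[of x g 2] conj_commutator[of "x [^] (2::nat)" g y] by simp
    moreover have "g \<otimes> x \<otimes> inv g \<in> carrier G" "g \<otimes> y \<otimes> inv g \<in> carrier G" using g x by simp_all
    ultimately show ?thesis by blast
  qed
qed

lemma W_subgroup_subset:
  assumes "subgroup K G" "\<And>x. x \<in> carrier G \<Longrightarrow> x [^] (4::nat) \<in> K"
    "\<And>x y. x \<in> carrier G \<Longrightarrow> y \<in> carrier G \<Longrightarrow> commutator G (x [^] (2::nat)) y \<in> K"
  shows "W_subgroup G \<subseteq> K"
  unfolding W_subgroup_eq by (rule generate_subgroup_incl[OF _ assms(1)]) (use assms(2,3) in blast)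

end

lemma cup_list_append:
  "length gs = Suc (length as) \<Longrightarrow>
   cup_list (as @ [b]) gs = cup_list as (take (length as) gs) * b (drop (length as) gs)"
proof (induction as arbitrary: gs)
  case Nil
  then show ?case by (simp add: cup_def)
next
  case (Cons a as)
  then obtain g r where gs: "gs = g # r" "length r = Suc (length as)" by (auto simp: length_Suc_conv)
  then show ?case using Cons.IH[of r] by (simp add: cup_def mult.assoc del: mult_bit_eq_and)
qed

lemma cup_list_cong:
  assumes "list_all2 (\<lambda>a b. \<forall>w\<in>A. a [w] = b [w]) as bs" "length gs = length as" "set gs \<subseteq> A"
  shows "cup_list as gs = cup_list bs gs"
  using assms
proof (induction arbitrary: gs rule: list_all2_induct)
  case (Cons a as b bs)
  then obtain g r where gs: "gs = g # r" "length r = length as" by (auto simp: length_Suc_conv)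
  then show ?case using Cons by (simp add: cup_def)
qed simp

section \<open>Cohomology of the W-group\<close>

context quadratic_closure
begin

abbreviation "N \<equiv> W_subgroup G"
abbreviation "W \<equiv> W_group G"
abbreviation "coset \<sigma> \<equiv> N #>\<^bsub>G\<^esub> \<sigma>"

sublocale W_normal: normal N G
  by (rule gal.W_subgroup_normal)

lemma group_W: "group W"
  unfolding W_group_def by (rule W_normal.factorgroup_is_group)

lemma carrier_W: "w \<in> carrier W \<longleftrightarrow> (\<exists>\<sigma>\<in>carrier G. w = coset \<sigma>)"
  unfolding W_group_def carrier_FactGroup by blast

lemma mult_W:
  assumes "\<sigma> \<in> carrier G" "\<tau> \<in> carrier G"
  shows "(coset \<sigma>) \<otimes>\<^bsub>W\<^esub> (coset \<tau>) = coset (\<sigma> \<circ> \<tau>)"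
  using W_normal.rcos_sum[OF assms] unfolding W_group_def mult_FactGroup mult_G .

definition lift :: "(('b \<Rightarrow> 'b) \<Rightarrow> bit) \<Rightarrow> ('b \<Rightarrow> 'b) set \<Rightarrow> bit" where
  "lift f w = f (SOME \<sigma>. \<sigma> \<in> w)"

lemma lift_coset:
  assumes f: "\<And>\<nu> \<sigma>. \<nu> \<in> N \<Longrightarrow> \<sigma> \<in> carrier G \<Longrightarrow> f (\<nu> \<circ> \<sigma>) = f \<sigma>" and \<sigma>: "\<sigma> \<in> carrier G"
  shows "lift f (coset \<sigma>) = f \<sigma>"
proof -
  have "(SOME \<tau>. \<tau> \<in> coset \<sigma>) \<in> coset \<sigma>"
    by (rule someI[of _ \<sigma>]) (rule gal.rcos_self[OF \<sigma> W_normal.is_subgroup])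
  then obtain \<nu> where "\<nu> \<in> N" "(SOME \<tau>. \<tau> \<in> coset \<sigma>) = \<nu> \<circ> \<sigma>"
    unfolding r_coset_def mult_G by blast
  then show ?thesis unfolding lift_def using f[OF _ \<sigma>] by simp
qed

lemma chi_id: "chi a id = 0" by (simp add: chi_def)

text \<open>A function that is additive up to a bilinear expression in two characters vanishes on the
  fourth powers and on the commutators with squares, so it descends to the W-group.\<close>

lemma twisted_hom_W_subgroup:
  fixes h :: "('b \<Rightarrow> 'b) \<Rightarrow> bit"
  assumes ab: "a \<noteq> 0" "b \<noteq> 0"
    and h: "\<And>\<sigma> \<tau>. \<sigma> \<in> carrier G \<Longrightarrow> \<tau> \<in> carrier G \<Longrightarrow> h (\<sigma> \<circ> \<tau>) = h \<sigma> + h \<tau> + chi a \<sigma> * chi b \<tau>"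
    and \<nu>: "\<nu> \<in> N"
  shows "chi a \<nu> = 0 \<and> chi b \<nu> = 0 \<and> h \<nu> = 0"
proof -
  let ?K = "{\<sigma> \<in> carrier G. chi a \<sigma> = 0 \<and> chi b \<sigma> = 0 \<and> h \<sigma> = 0}"
  have id: "id \<in> carrier G" using gal.one_closed unfolding one_G .
  have hid: "h id = 0" using h[OF id id] chi_id bit_cases[of "h id"] by auto
  note chia = chi_hom[OF _ _ ab(1)] and chib = chi_hom[OF _ _ ab(2)]
  have K: "subgroup ?K G"
  proof (rule gal.subgroupI)
    show "?K \<noteq> {}" using id chi_id hid by blast
    fix \<sigma> assume "\<sigma> \<in> ?K"
    then have \<sigma>: "\<sigma> \<in> carrier G" "chi a \<sigma> = 0" "chi b \<sigma> = 0" "h \<sigma> = 0" by auto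
    let ?i = "inv\<^bsub>G\<^esub> \<sigma>"
    have i: "?i \<in> carrier G" by (rule gal.inv_closed[OF \<sigma>(1)])
    have comp: "?i \<circ> \<sigma> = id" using gal.l_inv[OF \<sigma>(1)] unfolding mult_G one_G .
    have "chi a ?i = 0" using chia[OF i \<sigma>(1)] chi_id \<sigma>(2) unfolding comp by simp
    moreover have "chi b ?i = 0" using chib[OF i \<sigma>(1)] chi_id \<sigma>(3) unfolding comp by simp
    moreover have "h ?i = 0" using h[OF i \<sigma>(1)] hid \<sigma>(3,4) unfolding comp by simp
    ultimately show "?i \<in> ?K" using i by simp
  next
    fix \<sigma> \<tau> assume "\<sigma> \<in> ?K" "\<tau> \<in> ?K"
    then show "\<sigma> \<otimes>\<^bsub>G\<^esub> \<tau> \<in> ?K"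
      unfolding mult_G using comp_closed chia chib h by simp
  qed auto
  have sq: "x \<circ> x \<in> carrier G" "chi a (x \<circ> x) = 0" "chi b (x \<circ> x) = 0" if "x \<in> carrier G" for x
    using comp_closed[OF that that] chia[OF that that] chib[OF that that] by (simp_all add: bit_add_self del: add_bit_eq_xor)
  have "N \<subseteq> ?K"
  proof (rule gal.W_subgroup_subset[OF K])
    fix x assume x: "x \<in> carrier G"
    have "x [^]\<^bsub>G\<^esub> (4::nat) = (x \<circ> x) \<circ> (x \<circ> x)"
      by (simp add: nat_pow_G numeral_eq_Suc comp_assoc)
    moreover have "(x \<circ> x) \<circ> (x \<circ> x) \<in> ?K"
      using sq(1)[OF sq(1)[OF x]] sq(2,3)[OF sq(1)[OF x]] h[OF sq(1)[OF x] sq(1)[OF x]] sq(2)[OF x]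
      by (simp add: bit_add_self del: add_bit_eq_xor comp_apply)
    ultimately show "x [^]\<^bsub>G\<^esub> (4::nat) \<in> ?K" by simp
  next
    fix x y assume x: "x \<in> carrier G" and y: "y \<in> carrier G"
    define u where "u = x \<circ> x"
    have u: "u \<in> carrier G" "chi a u = 0" "chi b u = 0" unfolding u_def using sq[OF x] by simp_all
    have xu: "x [^]\<^bsub>G\<^esub> (2::nat) = u" by (simp add: nat_pow_G numeral_eq_Suc u_def)
    define c where "c = commutator G u y"
    have c: "c \<in> carrier G" unfolding c_def by (rule gal.commutator_closed[OF u(1) y])
    have yu: "y \<circ> u \<in> carrier G" by (rule comp_closed[OF y u(1)])
    have eq: "(y \<circ> u) \<circ> c = u \<circ> y"
      using gal.mult_commutator[OF u(1) y] unfolding c_def mult_G .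
    have ca: "chi a c = 0"
      using chia[OF yu c] chia[OF y u(1)] chia[OF u(1) y] u(2) bit_cases[of "chi a c"] bit_cases[of "chi a y"]
      unfolding eq by auto
    have cb: "chi b c = 0"
      using chib[OF yu c] chib[OF y u(1)] chib[OF u(1) y] u(3) bit_cases[of "chi b c"] bit_cases[of "chi b y"]
      unfolding eq by auto
    \<comment> \<open>Evaluate \<open>h\<close> on both sides of \<open>eq\<close>. All bilinear
      terms vanish because both characters are zero on \<open>u\<close> and \<open>chi b\<close> is
      zero on \<open>c\<close>; the values at \<open>u\<close> and \<open>y\<close> cancel.\<close>
    have "h c = 0"
      using h[OF yu c] h[OF y u(1)] h[OF u(1) y] u cb bit_cases[of "h c"] bit_cases[of "h u"] bit_cases[of "h y"]
      unfolding eq by auto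
    then show "commutator G (x [^]\<^bsub>G\<^esub> (2::nat)) y \<in> ?K"
      unfolding xu c_def[symmetric] using c ca cb by simp
  qed
  then show ?thesis using \<nu> by blast
qed

lemma chi_W_subgroup:
  assumes "a \<noteq> 0" "\<nu> \<in> N"
  shows "chi a \<nu> = 0"
\<comment> \<open>\<open>chi 1\<close> is trivial, so with \<open>b = 1\<close> the zero function
  satisfies the twisted additivity for every \<open>a\<close>.\<close>
proof (rule conjunct1[OF twisted_hom_W_subgroup[where a = a and b = 1 and h = "\<lambda>_. 0"]])
  show "0 = 0 + 0 + chi a \<sigma> * chi 1 \<tau>" if "\<sigma> \<in> carrier G" "\<tau> \<in> carrier G" for \<sigma> \<tau>
    using chi_square[OF that(2), of 1] by simp
qed (use assms in simp_all)

lemma N_closed: "\<nu> \<in> N \<Longrightarrow> \<nu> \<in> carrier G"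
  by (rule subgroup.mem_carrier[OF W_normal.is_subgroup])

lemma lift_chi:
  assumes "a \<noteq> 0" "\<sigma> \<in> carrier G"
  shows "lift (chi a) (coset \<sigma>) = chi a \<sigma>"
proof (rule lift_coset[OF _ assms(2)])
  fix \<nu> \<tau> assume "\<nu> \<in> N" "\<tau> \<in> carrier G"
  then show "chi a (\<nu> \<circ> \<tau>) = chi a \<tau>"
    using chi_hom[OF N_closed _ assms(1)] chi_W_subgroup[OF assms(1)] by simp
qed

definition chiW :: "'a \<Rightarrow> ('b \<Rightarrow> 'b) set list \<Rightarrow> bit" where
  "chiW a gs = lift (chi a) (hd gs)"

lemma chiW_coset: "a \<noteq> 0 \<Longrightarrow> \<sigma> \<in> carrier G \<Longrightarrow> chiW a [coset \<sigma>] = chi a \<sigma>"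
  by (simp add: chiW_def lift_chi)

lemma chiW_cocycle:
  assumes "a \<noteq> 0"
  shows "cocycle W 1 (chiW a)"
  unfolding group.cocycle_one_iff[OF group_W]
proof (intro ballI)
  fix v w assume "v \<in> carrier W" "w \<in> carrier W"
  then obtain \<sigma> \<tau> where st: "\<sigma> \<in> carrier G" "v = coset \<sigma>" "\<tau> \<in> carrier G" "w = coset \<tau>"
    unfolding carrier_W by blast
  show "chiW a [w] + chiW a [v \<otimes>\<^bsub>W\<^esub> w] + chiW a [v] = 0"
    unfolding st(2,4) mult_W[OF st(1,3)] chiW_coset[OF assms st(1)] chiW_coset[OF assms st(3)]
      chiW_coset[OF assms comp_closed[OF st(1,3)]] chi_hom[OF st(1,3) assms]
    using bit_cases[of "chi a \<sigma>"] bit_cases[of "chi a \<tau>"] by auto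
qed

lemma chiW_mult:
  assumes "a \<noteq> 0" "b \<noteq> 0" "w \<in> carrier W"
  shows "chiW (a * b) [w] = chiW a [w] + chiW b [w]"
proof -
  obtain \<sigma> where \<sigma>: "\<sigma> \<in> carrier G" "w = coset \<sigma>" using assms(3) unfolding carrier_W by blast
  have ab: "a * b \<noteq> 0" using assms by simp
  show ?thesis
    unfolding \<sigma>(2) chiW_coset[OF ab \<sigma>(1)] chiW_coset[OF assms(1) \<sigma>(1)] chiW_coset[OF assms(2) \<sigma>(1)]
    by (rule chi_mult[OF \<sigma>(1) assms(1,2)])
qed

lemma chiW_square:
  assumes "a \<noteq> 0" "w \<in> carrier W"
  shows "chiW (a ^ 2) [w] = 0"
proof -
  obtain \<sigma> where \<sigma>: "\<sigma> \<in> carrier G" "w = coset \<sigma>" using assms(2) unfolding carrier_W by blast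
  have a2: "a ^ 2 \<noteq> 0" using assms by simp
  show ?thesis unfolding \<sigma>(2) chiW_coset[OF a2 \<sigma>(1)] by (rule chi_square[OF \<sigma>(1) assms(1)])
qed

text \<open>Pulled back along the coset map, a one-cocycle is an abstract character of the Galois
  group. This is the point at which continuity enters the symbol calculus.\<close>

lemma cocycle_W_eq_chiW:
  fixes T :: "'a set"
  assumes T: "finite T" "\<And>a. a \<noteq> 0 \<Longrightarrow> \<exists>t\<in>T. t \<noteq> 0 \<and> (\<exists>z. z \<noteq> 0 \<and> a = t * z ^ 2)"
    and f: "cocycle W 1 f"
  shows "\<exists>a. a \<noteq> 0 \<and> (\<forall>w\<in>carrier W. f [w] = chiW a [w])"
proof -
  have "f [coset (\<sigma> \<circ> \<tau>)] = f [coset \<sigma>] + f [coset \<tau>]"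
    if "\<sigma> \<in> carrier G" "\<tau> \<in> carrier G" for \<sigma> \<tau>
    unfolding mult_W[OF that, symmetric]
    by (rule group.cocycle_one_mult[OF group_W f]) (use that carrier_W in blast)+
  then obtain a where a: "a \<noteq> 0" "\<forall>\<sigma>\<in>carrier G. f [coset \<sigma>] = chi a \<sigma>"
    using abstract_character[OF T, of "\<lambda>\<sigma>. f [coset \<sigma>]"] by blast
  have "f [w] = chiW a [w]" if w: "w \<in> carrier W" for w
  proof -
    obtain \<sigma> where \<sigma>: "\<sigma> \<in> carrier G" "w = coset \<sigma>" using w unfolding carrier_W by blast
    show ?thesis unfolding \<sigma>(2) chiW_coset[OF a(1) \<sigma>(1)] using a(2) \<sigma>(1) by blast
  qed
  then show ?thesis using a(1) by blast
qed

text \<open>For \<open>a + b = 1\<close> the square roots of \<open>1 - sqrt a\<close> generate a dihedral extension;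
  the sign of the action on one of them is the cochain.\<close>

lemma dihedral_cochain:
  assumes ab: "a \<noteq> 0" "b \<noteq> 0" "a + b = 1"
  shows "\<exists>h. \<forall>\<sigma>\<in>carrier G. \<forall>\<tau>\<in>carrier G. h (\<sigma> \<circ> \<tau>) = h \<sigma> + h \<tau> + chi a \<sigma> * chi b \<tau>"
proof -
  let ?r = "sq b"
  obtain d where d: "d * d = 1 - ?r" using ex_sqrt by blast
  \<comment> \<open>\<open>D 0\<close> and \<open>D 1\<close> are square roots of
    \<open>1 - sq b\<close> and \<open>1 + sq b\<close>, and their product is \<open>sq a\<close>
    because \<open>1 - b = a\<close>. Automorphisms permute the index by \<open>chi b\<close>, up to
    signs.\<close>
  define D where "D e = (if e = 0 then d else sq a / d)" for e :: bit
  have "1 - b = a" using ab(3) by (simp add: eq_diff_eq[symmetric] diff_eq_eq add.commute)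
  then have ia: "i a = 1 - ?r * ?r" unfolding sq_square by (metis emb_simps(2,6))
  have "d \<noteq> 0"
  proof
    assume "d = 0"
    then have "i a = 0" using d ia by simp
    then show False using ab(1) by simp
  qed
  have sqd: "(sq a / d) * (sq a / d) = 1 + ?r"
  proof -
    have "1 - ?r \<noteq> 0" using d \<open>d \<noteq> 0\<close> by (metis mult_eq_0_iff)
    have "(sq a / d) * (sq a / d) = i a / (d * d)" by (simp add: sq_square)
    also have "i a = (1 + ?r) * (d * d)" unfolding ia d by (simp add: algebra_simps)
    finally show ?thesis using \<open>d \<noteq> 0\<close> by simp
  qed
  have Dsq: "D e * D e = 1 - eps e * ?r" for e
    using bit_cases[of e] d sqd by (auto simp: D_def)
  have D0: "D e \<noteq> 0" for e
    using \<open>d \<noteq> 0\<close> sq_nonzero[OF ab(1)] by (simp add: D_def)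
  have Dprod: "D (1 + e) = sq a / D e" for e
    using bit_cases[of e] \<open>d \<noteq> 0\<close> sq_nonzero[OF ab(1)] by (auto simp: D_def)
  \<comment> \<open>\<open>\<sigma> d\<close> is a square root of
    \<open>1 - eps (chi b \<sigma>) * sq b\<close>, hence \<open>D (chi b \<sigma>)\<close> up to a
    sign; \<open>h\<close> records that sign.\<close>
  define h where "h \<sigma> = (if \<sigma> d = D (chi b \<sigma>) then 0 else 1 :: bit)" for \<sigma>
  have h0: "\<sigma> d = eps (h \<sigma>) * D (chi b \<sigma>)" if \<sigma>: "\<sigma> \<in> carrier G" for \<sigma>
  proof -
    have "\<sigma> d * \<sigma> d = \<sigma> (1 - ?r)" using d gal_simps(4)[OF \<sigma>, of d d] by simp
    also have "\<dots> = D (chi b \<sigma>) * D (chi b \<sigma>)"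
      unfolding Dsq gal_simps(6)[OF \<sigma>] gal_simps(2)[OF \<sigma>] chi_apply[OF \<sigma> sq_square] by (rule refl)
    finally have "\<sigma> d = D (chi b \<sigma>) \<or> \<sigma> d = - D (chi b \<sigma>)" by (simp only: square_eq_iff)
    then show ?thesis by (auto simp: h_def)
  qed
  \<comment> \<open>For \<open>e = 1\<close> the numerator \<open>sq a\<close> contributes the extra
    sign \<open>chi a \<sigma>\<close>. In a composite, \<open>e\<close> becomes
    \<open>chi b \<tau>\<close>, and this is the source of the bilinear term.\<close>
  have hD: "\<sigma> (D e) = eps (h \<sigma> + chi a \<sigma> * e) * D (chi b \<sigma> + e)" if \<sigma>: "\<sigma> \<in> carrier G" for \<sigma> e
  proof (cases "e = 0")
    case True
    then show ?thesis using h0[OF \<sigma>] by (simp add: D_def)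
  next
    case False
    then have e: "e = 1" by simp
    have "\<sigma> (D 1) = \<sigma> (sq a) * inverse (\<sigma> d)"
      by (simp add: D_def divide_inverse gal_simps(4,7)[OF \<sigma>])
    also have "\<dots> = eps (chi a \<sigma>) * inverse (eps (h \<sigma>)) * (sq a / D (chi b \<sigma>))"
      unfolding h0[OF \<sigma>] chi_apply[OF \<sigma> sq_square[of a]] by (simp add: divide_inverse)
    also have "inverse (eps (h \<sigma>)) = eps (h \<sigma>)" by (simp add: eps_def)
    also have "eps (chi a \<sigma>) * eps (h \<sigma>) = eps (h \<sigma> + chi a \<sigma>)"
      unfolding eps_simps(3) by (rule mult.commute)
    also have "sq a / D (chi b \<sigma>) = D (chi b \<sigma> + 1)"
      unfolding add.commute[of "chi b \<sigma>" 1] by (rule Dprod[symmetric])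
    finally show ?thesis unfolding e mult_1_right .
  qed
  have "h (\<sigma> \<circ> \<tau>) = h \<sigma> + h \<tau> + chi a \<sigma> * chi b \<tau>" if \<sigma>: "\<sigma> \<in> carrier G" and \<tau>: "\<tau> \<in> carrier G" for \<sigma> \<tau>
  proof -
    have st: "\<sigma> \<circ> \<tau> \<in> carrier G" by (rule comp_closed[OF \<sigma> \<tau>])
    have "(\<sigma> \<circ> \<tau>) d = \<sigma> (eps (h \<tau>) * D (chi b \<tau>))" unfolding comp_apply h0[OF \<tau>] by (rule refl)
    also have "\<dots> = eps (h \<tau>) * (eps (h \<sigma> + chi a \<sigma> * chi b \<tau>) * D (chi b \<sigma> + chi b \<tau>))"
      unfolding gal_simps(4)[OF \<sigma>] gal_eps[OF \<sigma>] hD[OF \<sigma>] by (rule refl)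
    also have "\<dots> = eps (h \<sigma> + h \<tau> + chi a \<sigma> * chi b \<tau>) * D (chi b (\<sigma> \<circ> \<tau>))"
      unfolding chi_hom[OF \<sigma> \<tau> ab(2)] eps_simps(3) by (simp only: ac_simps)
    finally have "eps (h (\<sigma> \<circ> \<tau>)) * D (chi b (\<sigma> \<circ> \<tau>)) = eps (h \<sigma> + h \<tau> + chi a \<sigma> * chi b \<tau>) * D (chi b (\<sigma> \<circ> \<tau>))"
      unfolding h0[OF st] .
    then show ?thesis using eps_inject[OF D0] by blast
  qed
  then show ?thesis by blast
qed

section \<open>Symbol relations in the cohomology of the W-group\<close>

lemma pair_is_coboundary:
  fixes h :: "('b \<Rightarrow> 'b) set \<Rightarrow> bit"
  assumes "\<And>\<sigma> \<tau>. \<sigma> \<in> carrier G \<Longrightarrow> \<tau> \<in> carrier G \<Longrightarrow>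
      c [coset \<sigma>, coset \<tau>] = h (coset \<tau>) + h (coset (\<sigma> \<circ> \<tau>)) + h (coset \<sigma>)"
  shows "is_coboundary W 2 c"
proof -
  have "is_coboundary W (Suc 1) c"
  proof (rule group.is_coboundaryI[OF group_W, where h = "\<lambda>gs. h (hd gs)"])
    fix gs assume gs: "set gs \<subseteq> carrier W" "length gs = Suc 1"
    then obtain v w where vw: "gs = [v, w]" by (auto simp: length_Suc_conv)
    then have "v \<in> carrier W" "w \<in> carrier W" using gs(1) by auto
    then obtain \<sigma> \<tau> where st: "\<sigma> \<in> carrier G" "v = coset \<sigma>" "\<tau> \<in> carrier G" "w = coset \<tau>"
      unfolding carrier_W by blast
    have "coboundary W 1 (\<lambda>gs. h (hd gs)) gs = h w + h (v \<otimes>\<^bsub>W\<^esub> w) + h v"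
      unfolding vw by (simp add: coboundary_def del: add_bit_eq_xor)
    then show "c gs = coboundary W 1 (\<lambda>gs. h (hd gs)) gs"
      using assms[OF st(1,3)] unfolding vw st(2,4) mult_W[OF st(1,3)] by simp
  qed
  then show ?thesis by (simp add: numeral_eq_Suc)
qed

text \<open>The dihedral cochain is twisted-additive, so it is invariant under \<open>N\<close> and
  descends to \<open>W\<close>, where its coboundary is the product of the two characters.\<close>

lemma steinberg_pair:
  assumes ab: "a \<noteq> 0" "b \<noteq> 0" "a + b = 1"
  shows "is_coboundary W 2 (cup_list [chiW a, chiW b])"
proof -
  obtain h where h0: "\<forall>\<sigma>\<in>carrier G. \<forall>\<tau>\<in>carrier G. h (\<sigma> \<circ> \<tau>) = h \<sigma> + h \<tau> + chi a \<sigma> * chi b \<tau>"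
    using dihedral_cochain[OF ab] by (rule exE)
  have h: "h (\<sigma> \<circ> \<tau>) = h \<sigma> + h \<tau> + chi a \<sigma> * chi b \<tau>" if "\<sigma> \<in> carrier G" "\<tau> \<in> carrier G" for \<sigma> \<tau>
    using h0 that by blast
  have inv: "h (\<nu> \<circ> \<sigma>) = h \<sigma>" if "\<nu> \<in> N" "\<sigma> \<in> carrier G" for \<nu> \<sigma>
  proof -
    have "chi a \<nu> = 0 \<and> chi b \<nu> = 0 \<and> h \<nu> = 0"
      by (rule twisted_hom_W_subgroup[where h = h, OF ab(1,2) h that(1)])
    then show ?thesis using h[OF N_closed[OF that(1)] that(2)] by simp
  qed
  show ?thesis
  proof (rule pair_is_coboundary[where h = "lift h"])
    fix \<sigma> \<tau> assume \<sigma>: "\<sigma> \<in> carrier G" and \<tau>: "\<tau> \<in> carrier G"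
    have lh: "lift h (coset \<rho>) = h \<rho>" if "\<rho> \<in> carrier G" for \<rho>
      by (rule lift_coset[where f = h, OF inv that])
    have "cup_list [chiW a, chiW b] [coset \<sigma>, coset \<tau>] = chi a \<sigma> * chi b \<tau>"
      using chiW_coset[OF ab(1) \<sigma>] chiW_coset[OF ab(2) \<tau>] by (simp add: cup_def del: mult_bit_eq_and)
    then show "cup_list [chiW a, chiW b] [coset \<sigma>, coset \<tau>] =
        lift h (coset \<tau>) + lift h (coset (\<sigma> \<circ> \<tau>)) + lift h (coset \<sigma>)"
      unfolding lh[OF \<sigma>] lh[OF \<tau>] lh[OF comp_closed[OF \<sigma> \<tau>]] h[OF \<sigma> \<tau>]
      using bit_cases[of "h \<sigma>"] bit_cases[of "h \<tau>"] by auto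
  qed
qed

text \<open>The pointwise product of two characters has the sum of both cup products as coboundary:
  these are the mixed terms of the product of two sums.\<close>

lemma commute_pair:
  assumes ab: "a \<noteq> 0" "b \<noteq> 0"
  shows "is_coboundary W 2 (\<lambda>gs. cup_list [chiW a, chiW b] gs + cup_list [chiW b, chiW a] gs)"
proof (rule pair_is_coboundary[where h = "\<lambda>w. chiW a [w] * chiW b [w]"])
  fix \<sigma> \<tau> assume \<sigma>: "\<sigma> \<in> carrier G" and \<tau>: "\<tau> \<in> carrier G"
  have st: "\<sigma> \<circ> \<tau> \<in> carrier G" by (rule comp_closed[OF \<sigma> \<tau>])
  show "cup_list [chiW a, chiW b] [coset \<sigma>, coset \<tau>] + cup_list [chiW b, chiW a] [coset \<sigma>, coset \<tau>] =
      chiW a [coset \<tau>] * chiW b [coset \<tau>] + chiW a [coset (\<sigma> \<circ> \<tau>)] * chiW b [coset (\<sigma> \<circ> \<tau>)] +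
      chiW a [coset \<sigma>] * chiW b [coset \<sigma>]"
    unfolding chiW_coset[OF ab(1) st] chiW_coset[OF ab(2) st] chi_hom[OF \<sigma> \<tau> ab(1)] chi_hom[OF \<sigma> \<tau> ab(2)]
    using chiW_coset[OF ab(1) \<sigma>] chiW_coset[OF ab(2) \<sigma>] chiW_coset[OF ab(1) \<tau>] chiW_coset[OF ab(2) \<tau>]
      bit_cases[of "chi a \<sigma>"] bit_cases[of "chi b \<sigma>"] bit_cases[of "chi a \<tau>"] bit_cases[of "chi b \<tau>"]
    by (auto simp: cup_def)
qed

text \<open>Makes a relation in degree two usable in front of any symbol. Factors are appended at
  the end one at a time, hence the reverse induction.\<close>

lemma pair_extend:
  assumes c: "is_coboundary W 2 c" and as: "0 \<notin> set as"
  shows "is_coboundary W (length as + 2) (\<lambda>gs. c (take 2 gs) * cup_list (map chiW as) (drop 2 gs))"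
  using as
proof (induction as rule: rev_induct)
  case Nil
  have "is_coboundary W 2 (\<lambda>gs. c (take 2 gs) * cup_list (map chiW []) (drop 2 gs))"
    by (rule group.is_coboundary_cong[OF group_W c]) simp
  then show ?case by (simp add: numeral_2_eq_2)
next
  case (snoc b as)
  let ?k = "length as + 2"
  let ?c = "\<lambda>gs. c (take 2 gs) * cup_list (map chiW as) (drop 2 gs)"
  have b: "b \<noteq> 0" using snoc.prems by auto
  have "is_coboundary W (Suc ?k) (\<lambda>gs. ?c (take ?k gs) * chiW b (drop ?k gs))"
    using snoc by (intro group.is_coboundary_cup_right[OF group_W chiW_cocycle[OF b]]) auto
  then have "is_coboundary W (Suc ?k) (\<lambda>gs. c (take 2 gs) * cup_list (map chiW (as @ [b])) (drop 2 gs))"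
  proof (rule group.is_coboundary_cong[OF group_W])
    fix gs :: "('b \<Rightarrow> 'b) set list" assume gs: "length gs = Suc ?k"
    have "cup_list (map chiW as @ [chiW b]) (drop 2 gs) =
        cup_list (map chiW as) (take (length as) (drop 2 gs)) * chiW b (drop (length as) (drop 2 gs))"
      using cup_list_append[of "drop 2 gs" "map chiW as" "chiW b"] gs by simp
    moreover have "take (length as) (drop 2 gs) = drop 2 (take ?k gs)" by (simp add: drop_take)
    moreover have "drop (length as) (drop 2 gs) = drop ?k gs" by (simp add: add.commute)
    ultimately show "?c (take ?k gs) * chiW b (drop ?k gs) =
        c (take 2 gs) * cup_list (map chiW (as @ [b])) (drop 2 gs)"
      by (simp add: mult.assoc min_def del: mult_bit_eq_and)
  qed
  then show ?case by simp
qed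

definition null :: "'a list \<Rightarrow> bool" where
  "null as \<longleftrightarrow> is_coboundary W (length as) (cup_list (map chiW as))"

lemma cup_list_pair:
  "length gs = length as + 2 \<Longrightarrow>
   cup_list (f # g # as) gs = cup_list [f, g] (take 2 gs) * cup_list as (drop 2 gs)"
  by (auto simp: length_Suc_conv cup_def mult.assoc numeral_2_eq_2 simp del: mult_bit_eq_and)

lemma null_pairI:
  assumes "is_coboundary W 2 (cup_list [chiW a, chiW b])" "0 \<notin> set as"
  shows "null (a # b # as)"
proof -
  have "is_coboundary W (length as + 2) (cup_list (chiW a # chiW b # map chiW as))"
    by (rule group.is_coboundary_cong[OF group_W pair_extend[OF assms]])
      (simp only: cup_list_pair length_map)
  then show ?thesis by (simp add: null_def)
qed

sublocale symbols: symbol_calculus null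
proof
  fix a b :: 'a and as :: "'a list" assume a: "a \<noteq> 0" and as: "0 \<notin> set as"
  show "null (a # as)" if "null as"
    using group.is_coboundary_cup_left[OF group_W chiW_cocycle[OF a]] that by (simp add: null_def)
  show "null (a ^ 2 # as)"
  proof -
    have "is_coboundary W (Suc (length as)) (cup_list (map chiW (a ^ 2 # as)))"
    proof (rule group.is_coboundary_cong[OF group_W group.is_coboundary_zero[OF group_W]])
      fix gs assume gs: "set gs \<subseteq> carrier W" "length gs = Suc (length as)"
      then obtain w r where "gs = w # r" by (auto simp: length_Suc_conv)
      then show "0 = cup_list (map chiW (a ^ 2 # as)) gs"
        using chiW_square[OF a, of w] gs(1) by (simp add: cup_def)
    qed
    then show ?thesis by (simp add: null_def)
  qed
  assume b: "b \<noteq> 0"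
  show "null (a * b # as)" if "null (a # as)" "null (b # as)"
  proof -
    have "is_coboundary W (Suc (length as)) (\<lambda>gs. cup_list (map chiW (a # as)) gs + cup_list (map chiW (b # as)) gs)"
      using that by (intro group.is_coboundary_add[OF group_W]) (simp_all add: null_def)
    then have "is_coboundary W (Suc (length as)) (cup_list (map chiW (a * b # as)))"
    proof (rule group.is_coboundary_cong[OF group_W])
      fix gs assume gs: "set gs \<subseteq> carrier W" "length gs = Suc (length as)"
      then obtain w r where "gs = w # r" by (auto simp: length_Suc_conv)
      then show "cup_list (map chiW (a # as)) gs + cup_list (map chiW (b # as)) gs = cup_list (map chiW (a * b # as)) gs"
        using chiW_mult[OF a b, of w] gs(1)
        by (simp add: cup_def distrib_right del: mult_bit_eq_and add_bit_eq_xor)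
    qed
    then show ?thesis by (simp add: null_def)
  qed
  show "null (a # b # as)" if "a + b = 1"
    by (rule null_pairI[OF steinberg_pair[OF a b that] as])
  show "null (b # a # as)" if ab: "null (a # b # as)"
  proof -
    let ?k = "length as + 2"
    let ?c = "\<lambda>gs. cup_list [chiW a, chiW b] gs + cup_list [chiW b, chiW a] gs"
    have ab': "is_coboundary W ?k (cup_list (chiW a # chiW b # map chiW as))" using ab by (simp add: null_def)
    \<comment> \<open>Adding the given coboundary to the extended sum of both orders cancels the
      original order modulo two and leaves the swapped one.\<close>
    have "is_coboundary W ?k (\<lambda>gs. ?c (take 2 gs) * cup_list (map chiW as) (drop 2 gs)
        + cup_list (chiW a # chiW b # map chiW as) gs)"
      by (rule group.is_coboundary_add[OF group_W pair_extend[OF commute_pair[OF a b] as] ab'])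
    then have "is_coboundary W ?k (cup_list (chiW b # chiW a # map chiW as))"
    proof (rule group.is_coboundary_cong[OF group_W])
      fix gs :: "('b \<Rightarrow> 'b) set list" assume gs: "length gs = ?k"
      have len: "length gs = length (map chiW as) + 2" using gs by simp
      show "?c (take 2 gs) * cup_list (map chiW as) (drop 2 gs) + cup_list (chiW a # chiW b # map chiW as) gs
          = cup_list (chiW b # chiW a # map chiW as) gs"
        unfolding cup_list_pair[OF len]
        using bit_cases[of "cup_list [chiW a, chiW b] (take 2 gs)"] bit_cases[of "cup_list [chiW b, chiW a] (take 2 gs)"]
          bit_cases[of "cup_list (map chiW as) (drop 2 gs)"]
        by (auto simp del: cup_list.simps)
    qed
    then show ?thesis by (simp add: null_def)
  qed
qed

text \<open>Each one-cocycle agrees on \<open>W\<close> with some \<open>chiW a\<close>, so every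
  summand equals a symbol on the relevant lists, not merely up to a coboundary, and the bound for
  symbols applies termwise.\<close>

theorem R_deg_vanishes:
  assumes nr: "\<not> formally_real TYPE('a)" and card: "card (square_classes :: 'a set set) = 2 ^ n"
    and k: "k > n" and c: "c \<in> R_deg W k"
  shows "is_coboundary W k c"
proof -
  \<comment> \<open>One representative from every square class; finiteness of this set is what the
    continuity theorem asks for.\<close>
  define T :: "'a set" where "T = (\<lambda>C. SOME x. x \<in> C) ` square_classes"
  have "finite (square_classes :: 'a set set)"
    using card by (intro card_ge_0_finite) simp
  then have T: "finite T" unfolding T_def by (rule finite_imageI)
  have T': "\<exists>t\<in>T. t \<noteq> 0 \<and> (\<exists>z. z \<noteq> 0 \<and> a = t * z ^ 2)" if a: "a \<noteq> 0" for a :: 'a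
  proof -
    define t where "t = (SOME x. x \<in> square_class a)"
    have "t \<in> square_class a" unfolding t_def by (rule someI[of _ a]) (rule square_class_self[OF a])
    moreover have "t \<in> T" unfolding T_def t_def square_classes_eq using a by blast
    ultimately show ?thesis by (auto simp: square_class_def)
  qed
  obtain m :: nat and A where A: "\<And>j. j < m \<Longrightarrow> length (A j) = k"
    "\<And>j a. j < m \<Longrightarrow> a \<in> set (A j) \<Longrightarrow> cocycle W 1 a" and c_eq: "c = (\<lambda>gs. \<Sum>j<m. cup_list (A j) gs)"
    using c unfolding R_deg_def by blast
  have "is_coboundary W k (cup_list (A j))" if j: "j < m" for j
  proof -
    define r where "r f = (SOME a. a \<noteq> 0 \<and> (\<forall>w\<in>carrier W. f [w] = chiW a [w]))" for f
    have r: "r f \<noteq> 0 \<and> (\<forall>w\<in>carrier W. f [w] = chiW (r f) [w])" if "f \<in> set (A j)" for f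
      unfolding r_def by (rule someI_ex) (rule cocycle_W_eq_chiW[OF T T' A(2)[OF j that]])
    let ?as = "map r (A j)"
    have "0 \<notin> set ?as" using r by auto
    then have "null ?as" using k A(1)[OF j] by (intro symbols.null_of_length[OF nr card]) simp_all
    then have "is_coboundary W k (cup_list (map chiW ?as))" using A(1)[OF j] by (simp add: null_def)
    then show ?thesis
    proof (rule group.is_coboundary_cong[OF group_W])
      fix gs assume gs: "set gs \<subseteq> carrier W" "length gs = k"
      have "list_all2 (\<lambda>f g. \<forall>w\<in>carrier W. f [w] = g [w]) (A j) (map chiW ?as)"
      proof (rule list_all2_all_nthI)
        fix l assume "l < length (A j)"
        then show "\<forall>w\<in>carrier W. (A j ! l) [w] = (map chiW ?as ! l) [w]" using r[OF nth_mem] by simp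
      qed simp
      from cup_list_cong[OF this _ gs(1)] show "cup_list (map chiW ?as) gs = cup_list (A j) gs"
        using gs(2) A(1)[OF j] by simp
    qed
  qed
  then show ?thesis unfolding c_eq by (rule group.is_coboundary_sum[OF group_W])
qed

end

theorem theorem3p21:
  fixes i :: "'a::field \<Rightarrow> 'b::field" and n :: nat
  assumes "(2::'a) \<noteq> 0"
    and "\<not> formally_real TYPE('a)"
    and "card (square_classes :: 'a set set) = 2 ^ n"
    and "is_quadratic_closure i"
  shows "\<forall>k>n. \<forall>c \<in> R_deg (W_group (galois_group i)) k.
           is_coboundary (W_group (galois_group i)) k c"
proof -
  interpret quadratic_closure i using assms(1,4) by unfold_locales
  show ?thesis using R_deg_vanishes[OF assms(2,3)] by blast
qed

end
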